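(* (i) Let $Q\in N_\kappa(H)$ have a minimal representation $$Q(z)=Q(z_0)^*+(z-\bar z_0)\Gamma^+\big(I+(z-z_0)(A-z)^{-1}\big)\Gamma,\qquad z\in\rho(A),$$ with $A$ a self-adjoint linear relation in a Pontryagin space $K$ of negative index $\kappa$, $z_0\in\rho(A)\cap\mathbb{C}^+$ and $\Gamma:H\to K$ bounded. Suppose $K=K_1[+]K_2$ with $K_1,K_2$ closed non-degenerate subspaces invariant under $A$ (i.e. $(A-z)^{-1}K_i\subseteq K_i$ for all $z\in\rho(A)$). Let $E_i$ be the orthogonal projection onto $K_i$, $\kappa_i$ the negative index of $K_i$, $A_i:=A\cap(K_i\times K_i)$ (a self-adjoint relation in $K_i$ with $(A_i-z)^{-1}=(A-z)^{-1}|_{K_i}$), and $\Gamma_i:=E_i\Gamma:H\to K_i$. Let $S_1,S_2$ be any bounded self-adjoint operators on $H$ with $S_1+S_2=\tfrac12(Q(z_0)+Q(z_0)^* )$ and put $$Q_i(z):=S_i-\tfrac{z_0-\bar z_0}{2}\Gamma_i^+\Gamma_i+(z-\bar z_0)\Gamma_i^+\big(I+(z-z_0)(A_i-z)^{-1}\big)\Gamma_i .$$ Then (a) each $Q_i\in N_{\kappa_i}(H)$ and the representation of $Q_i$ by the triplet $(K_i,A_i,\Gamma_i)$ is minimal; (b) $Q=Q_1+Q_2$; (c) $\kappa_1+\kappa_2=\kappa$. (ii) Conversely, let $Q_i\in N_{\kappa_i}(H)$, $i=1,2$, be minimally represented as $Q_i(z)=Q_i(z_0)^*+(z-\bar z_0)\Gamma_i^+(I_i+(z-z_0)(A_i-z)^{-1})\Gamma_i$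 by triplets $(K_i,A_i,\Gamma_i)$ (with a common $z_0\in\rho(A_1)\cap\rho(A_2)\cap\mathbb{C}^+$), and let $Q=Q_1+Q_2$. Define $K:=K_1[+]K_2$, $A:=A_1\oplus A_2$, $\Gamma h:=\Gamma_1h[+]\Gamma_2h$, so $\Gamma^+(k_1[+]k_2)=\Gamma_1^+k_1+\Gamma_2^+k_2$. If $\Gamma^+:K\to H$ is injective, then $$Q(z)=Q_1(z_0)^*+Q_2(z_0)^*+(z-\bar z_0)\Gamma^+\big(I+(z-z_0)(A-z)^{-1}\big)\Gamma$$ is a minimal representation of $Q$ (hence, up to isomorphism, its unique minimal representation), and $Q\in N_{\kappa_1+\kappa_2}(H)$.
   Context: $H$ is a Hilbert space with inner product $(\cdot,\cdot)$; $L(H)$ the bounded operators on $H$. A Pontryagin space $(K,[\cdot,\cdot])$ is a Krein space whose inner product has finitely many (its negative index) negative squares. For bounded $\Gamma:H\to K$, $\Gamma^+:K\to H$ is defined by $(h,\Gamma^+k)=[\Gamma h,k]$. $N_\kappa(H)$ is the class of functions $Q:D(Q)\to L(H)$ meromorphic in $\mathbb{C}\setminus\mathbb{R}$ with $Q(\bar z)^*=Q(z)$ such that the kernel $N_Q(z,w)=\frac{Q(z)-Q(w)^*}{z-\bar w}$ ($z,w\in D(Q)\cap\mathbb{C}^+$) has exactly $\kappa$ negative squares: for all $n$, $z_1,\dots,z_n\in D(Q)\cap\mathbb{C}^+$, $h_1,\dots,h_n\in H$ the Hermitian matrix $((N_Q(z_i,z_j)h_i,h_j))_{i,j}$ has at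 most $\kappa$ negative eigenvalues, and exactly $\kappa$ for some choice. Every $Q\in N_\kappa(H)$ admits a representation of the displayed form with $A$ self-adjoint in a Pontryagin space; it is called minimal if $K=\overline{\operatorname{span}}\{(I+(z-z_0)(A-z)^{-1})\Gamma h:z\in\rho(A),h\in H\}$, and it is minimal iff the negative index of $K$ equals $\kappa$; the minimal representing triplet $(K,A,\Gamma)$ is unique up to isomorphism. *)

theory Defs
  imports "Jordan_Normal_Form.Char_Poly" "HOL-Library.Product_Plus"
begin

text \<open>
  Conventions.  A complex vector space is a type of class ab_group_add together with a
  scalar multiplication sc such that vector_space sc holds.  An inner product
  ip is linear in the first and conjugate linear in the second argument.
  The Hilbert space H is a whole type; the Pontryagin space K is a whole type, and
  subspaces of K (such as K_1, K_2) are given by carrier sets V.  The topology of a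
  Krein space is the one induced by (any) fundamental symmetry J, i.e. by the Hilbert
  inner product (J x, y).
\<close>

definition gram :: "('p \<Rightarrow> 'p \<Rightarrow> complex) \<Rightarrow> 'p list \<Rightarrow> complex mat" where
  "gram k xs = mat (length xs) (length xs) (\<lambda>(i, j). k (xs ! i) (xs ! j))"

definition neg_eigs :: "complex mat \<Rightarrow> nat" where
  "neg_eigs M = (\<Sum>a \<in> {a. poly (char_poly M) a = 0 \<and> a \<in> \<real> \<and> Re a < 0}. order a (char_poly M))"

definition neg_squares :: "('p \<Rightarrow> 'p \<Rightarrow> complex) \<Rightarrow> 'p set \<Rightarrow> nat \<Rightarrow> bool" where
  "neg_squares k P \<kappa> \<longleftrightarrow>
     (\<forall>xs. set xs \<subseteq> P \<longrightarrow> neg_eigs (gram k xs) \<le> \<kappa>) \<and>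
     (\<exists>xs. set xs \<subseteq> P \<and> neg_eigs (gram k xs) = \<kappa>)"

definition csubspace :: "(complex \<Rightarrow> 'a::ab_group_add \<Rightarrow> 'a) \<Rightarrow> 'a set \<Rightarrow> bool" where
  "csubspace sc V \<longleftrightarrow> 0 \<in> V \<and> (\<forall>x\<in>V. \<forall>y\<in>V. x + y \<in> V) \<and> (\<forall>c. \<forall>x\<in>V. sc c x \<in> V)"

definition cspan :: "(complex \<Rightarrow> 'a::ab_group_add \<Rightarrow> 'a) \<Rightarrow> 'a set \<Rightarrow> 'a set" where
  "cspan sc S = \<Inter>{W. csubspace sc W \<and> S \<subseteq> W}"

definition hermitian_form :: "(complex \<Rightarrow> 'a::ab_group_add \<Rightarrow> 'a) \<Rightarrow> ('a \<Rightarrow> 'a \<Rightarrow> complex) \<Rightarrow> bool" where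
  "hermitian_form sc ip \<longleftrightarrow> vector_space sc \<and>
     (\<forall>x y z. ip (x + y) z = ip x z + ip y z) \<and>
     (\<forall>c x y. ip (sc c x) y = c * ip x y) \<and>
     (\<forall>x y. ip y x = cnj (ip x y))"

definition ipnorm :: "('a \<Rightarrow> 'a \<Rightarrow> complex) \<Rightarrow> 'a \<Rightarrow> real" where
  "ipnorm ip x = sqrt (Re (ip x x))"

definition hilbert_on :: "(complex \<Rightarrow> 'a::ab_group_add \<Rightarrow> 'a) \<Rightarrow> ('a \<Rightarrow> 'a \<Rightarrow> complex) \<Rightarrow> 'a set \<Rightarrow> bool" where
  "hilbert_on sc ip V \<longleftrightarrow> hermitian_form sc ip \<and> csubspace sc V \<and>
     (\<forall>x\<in>V. ip x x \<in> \<real> \<and> Re (ip x x) \<ge> 0 \<and> (ip x x = 0 \<longrightarrow> x = 0)) \<and>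
     (\<forall>s::nat \<Rightarrow> 'a. (\<forall>n. s n \<in> V) \<longrightarrow>
        (\<forall>e>0. \<exists>N. \<forall>m\<ge>N. \<forall>n\<ge>N. ipnorm ip (s m - s n) < e) \<longrightarrow>
        (\<exists>l\<in>V. (\<lambda>n. ipnorm ip (s n - l)) \<longlonglongrightarrow> 0))"

definition hilbert :: "(complex \<Rightarrow> 'a::ab_group_add \<Rightarrow> 'a) \<Rightarrow> ('a \<Rightarrow> 'a \<Rightarrow> complex) \<Rightarrow> bool" where
  "hilbert sc ip \<longleftrightarrow> hilbert_on sc ip UNIV"

definition fund_sym :: "(complex \<Rightarrow> 'a::ab_group_add \<Rightarrow> 'a) \<Rightarrow> ('a \<Rightarrow> 'a \<Rightarrow> complex) \<Rightarrow> ('a \<Rightarrow> 'a) \<Rightarrow> bool" where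
  "fund_sym sc ip J \<longleftrightarrow>
     (\<forall>x y. J (x + y) = J x + J y) \<and> (\<forall>c x. J (sc c x) = sc c (J x)) \<and>
     (\<forall>x. J (J x) = x) \<and> (\<forall>x y. ip (J x) y = ip x (J y)) \<and>
     hilbert sc (\<lambda>x y. ip (J x) y)"

definition krein :: "(complex \<Rightarrow> 'a::ab_group_add \<Rightarrow> 'a) \<Rightarrow> ('a \<Rightarrow> 'a \<Rightarrow> complex) \<Rightarrow> bool" where
  "krein sc ip \<longleftrightarrow> hermitian_form sc ip \<and> (\<exists>J. fund_sym sc ip J)"

definition pontryagin :: "(complex \<Rightarrow> 'a::ab_group_add \<Rightarrow> 'a) \<Rightarrow> ('a \<Rightarrow> 'a \<Rightarrow> complex) \<Rightarrow> nat \<Rightarrow> bool" where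
  "pontryagin sc ip \<kappa> \<longleftrightarrow> krein sc ip \<and> neg_squares ip UNIV \<kappa>"

definition knorm :: "(complex \<Rightarrow> 'a::ab_group_add \<Rightarrow> 'a) \<Rightarrow> ('a \<Rightarrow> 'a \<Rightarrow> complex) \<Rightarrow> 'a \<Rightarrow> real" where
  "knorm sc ip x = ipnorm (\<lambda>x y. ip ((SOME J. fund_sym sc ip J) x) y) x"

definition kclosure :: "(complex \<Rightarrow> 'a::ab_group_add \<Rightarrow> 'a) \<Rightarrow> ('a \<Rightarrow> 'a \<Rightarrow> complex) \<Rightarrow> 'a set \<Rightarrow> 'a set" where
  "kclosure sc ip S = {x. \<forall>e>0. \<exists>y\<in>S. knorm sc ip (x - y) < e}"

definition closed_nondeg_subspace :: "(complex \<Rightarrow> 'a::ab_group_add \<Rightarrow> 'a) \<Rightarrow> ('a \<Rightarrow> 'a \<Rightarrow> complex) \<Rightarrow> 'a set \<Rightarrow> bool" where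
  "closed_nondeg_subspace sc ip V \<longleftrightarrow> csubspace sc V \<and> kclosure sc ip V = V \<and>
     (\<forall>x\<in>V. (\<forall>y\<in>V. ip x y = 0) \<longrightarrow> x = 0)"

definition oproj :: "('a::ab_group_add \<Rightarrow> 'a \<Rightarrow> complex) \<Rightarrow> 'a set \<Rightarrow> 'a \<Rightarrow> 'a" where
  "oproj ip V k = (THE v. v \<in> V \<and> (\<forall>u\<in>V. ip (k - v) u = 0))"

definition clinear :: "(complex \<Rightarrow> 'a::ab_group_add \<Rightarrow> 'a) \<Rightarrow> (complex \<Rightarrow> 'b::ab_group_add \<Rightarrow> 'b) \<Rightarrow> ('a \<Rightarrow> 'b) \<Rightarrow> bool" where
  "clinear sa sb T \<longleftrightarrow> (\<forall>x y. T (x + y) = T x + T y) \<and> (\<forall>c x. T (sa c x) = sb c (T x))"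

definition bop :: "(complex \<Rightarrow> 'h::ab_group_add \<Rightarrow> 'h) \<Rightarrow> ('h \<Rightarrow> 'h \<Rightarrow> complex) \<Rightarrow> ('h \<Rightarrow> 'h) \<Rightarrow> bool" where
  "bop sc ip T \<longleftrightarrow> clinear sc sc T \<and> (\<exists>C. \<forall>h. ipnorm ip (T h) \<le> C * ipnorm ip h)"

definition opnorm :: "('h \<Rightarrow> 'h \<Rightarrow> complex) \<Rightarrow> ('h \<Rightarrow> 'h) \<Rightarrow> real" where
  "opnorm ip T = Sup {ipnorm ip (T h) | h. ipnorm ip h \<le> 1}"

definition hadj :: "('h \<Rightarrow> 'h \<Rightarrow> complex) \<Rightarrow> ('h \<Rightarrow> 'h) \<Rightarrow> 'h \<Rightarrow> 'h" where
  "hadj ip T h = (THE y. \<forall>x. ip x y = ip (T x) h)"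

definition bsa :: "(complex \<Rightarrow> 'h::ab_group_add \<Rightarrow> 'h) \<Rightarrow> ('h \<Rightarrow> 'h \<Rightarrow> complex) \<Rightarrow> ('h \<Rightarrow> 'h) \<Rightarrow> bool" where
  "bsa sc ip T \<longleftrightarrow> bop sc ip T \<and> (\<forall>x y. ip (T x) y = ip x (T y))"

definition bop_HK :: "(complex \<Rightarrow> 'h::ab_group_add \<Rightarrow> 'h) \<Rightarrow> ('h \<Rightarrow> 'h \<Rightarrow> complex) \<Rightarrow>
    (complex \<Rightarrow> 'k::ab_group_add \<Rightarrow> 'k) \<Rightarrow> ('k \<Rightarrow> 'k \<Rightarrow> complex) \<Rightarrow> ('h \<Rightarrow> 'k) \<Rightarrow> bool" where
  "bop_HK sch iph sck ipk G \<longleftrightarrow> clinear sch sck G \<and>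
     (\<exists>C. \<forall>h. knorm sck ipk (G h) \<le> C * ipnorm iph h)"

definition gadj :: "('h \<Rightarrow> 'h \<Rightarrow> complex) \<Rightarrow> ('k \<Rightarrow> 'k \<Rightarrow> complex) \<Rightarrow> ('h \<Rightarrow> 'k) \<Rightarrow> 'k \<Rightarrow> 'h" where
  "gadj iph ipk G k = (THE y. \<forall>h. iph h y = ipk (G h) k)"

definition selfadj_rel :: "('k \<Rightarrow> 'k \<Rightarrow> complex) \<Rightarrow> 'k set \<Rightarrow> ('k \<times> 'k) set \<Rightarrow> bool" where
  "selfadj_rel ip V A \<longleftrightarrow> A \<subseteq> V \<times> V \<and>
     A = {(f, g). f \<in> V \<and> g \<in> V \<and> (\<forall>(u, v) \<in> A. ip v f = ip u g)}"

text \<open>(A - z)^-1 y, where (A - z)^-1 = {(g - z f, f) | (f, g) \<in> A}\<close>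
definition resolv :: "(complex \<Rightarrow> 'k::ab_group_add \<Rightarrow> 'k) \<Rightarrow> 'k set \<Rightarrow> ('k \<times> 'k) set \<Rightarrow> complex \<Rightarrow> 'k \<Rightarrow> 'k" where
  "resolv sc V A z y = (THE f. f \<in> V \<and> (f, y + sc z f) \<in> A)"

definition rho :: "(complex \<Rightarrow> 'k::ab_group_add \<Rightarrow> 'k) \<Rightarrow> ('k \<Rightarrow> 'k \<Rightarrow> complex) \<Rightarrow> 'k set \<Rightarrow> ('k \<times> 'k) set \<Rightarrow> complex set" where
  "rho sc ip V A = {z. (\<forall>y\<in>V. \<exists>!f. f \<in> V \<and> (f, y + sc z f) \<in> A) \<and>
      (\<exists>C. \<forall>y\<in>V. knorm sc ip (resolv sc V A z y) \<le> C * knorm sc ip y)}"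

definition holo_at :: "(complex \<Rightarrow> 'h::ab_group_add \<Rightarrow> 'h) \<Rightarrow> ('h \<Rightarrow> 'h \<Rightarrow> complex) \<Rightarrow>
    (complex \<Rightarrow> 'h \<Rightarrow> 'h) \<Rightarrow> complex \<Rightarrow> bool" where
  "holo_at sc ip Q z \<longleftrightarrow> (\<exists>T. bop sc ip T \<and>
     ((\<lambda>w. opnorm ip (\<lambda>h. sc (1 / (w - z)) (Q w h - Q z h) - T h)) \<longlongrightarrow> 0) (at z))"

definition pole_at :: "(complex \<Rightarrow> 'h::ab_group_add \<Rightarrow> 'h) \<Rightarrow> ('h \<Rightarrow> 'h \<Rightarrow> complex) \<Rightarrow>
    (complex \<Rightarrow> 'h \<Rightarrow> 'h) \<Rightarrow> complex \<Rightarrow> bool" where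
  "pole_at sc ip Q z \<longleftrightarrow> (\<exists>n::nat. \<exists>T. bop sc ip T \<and>
     ((\<lambda>w. opnorm ip (\<lambda>h. sc ((w - z) ^ n) (Q w h) - T h)) \<longlongrightarrow> 0) (at z))"

definition meromorphic_nonreal :: "(complex \<Rightarrow> 'h::ab_group_add \<Rightarrow> 'h) \<Rightarrow> ('h \<Rightarrow> 'h \<Rightarrow> complex) \<Rightarrow>
    complex set \<Rightarrow> (complex \<Rightarrow> 'h \<Rightarrow> 'h) \<Rightarrow> bool" where
  "meromorphic_nonreal sc ip D Q \<longleftrightarrow> open D \<and> (\<forall>z\<in>D. bop sc ip (Q z) \<and> holo_at sc ip Q z) \<and>
     (\<forall>z. z \<notin> \<real> \<and> z \<notin> D \<longrightarrow> (\<exists>r>0. {w. 0 < cmod (w - z) \<and> cmod (w - z) < r} \<subseteq> D) \<and> pole_at sc ip Q z)"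

definition NQ :: "('h \<Rightarrow> 'h \<Rightarrow> complex) \<Rightarrow> (complex \<Rightarrow> 'h::ab_group_add \<Rightarrow> 'h) \<Rightarrow>
    (complex \<Rightarrow> 'h \<Rightarrow> 'h) \<Rightarrow> complex \<Rightarrow> complex \<Rightarrow> 'h \<Rightarrow> 'h" where
  "NQ ip sc Q z w h = sc (1 / (z - cnj w)) (Q z h - hadj ip (Q w) h)"

definition Nkappa :: "(complex \<Rightarrow> 'h::ab_group_add \<Rightarrow> 'h) \<Rightarrow> ('h \<Rightarrow> 'h \<Rightarrow> complex) \<Rightarrow> nat \<Rightarrow>
    complex set \<Rightarrow> (complex \<Rightarrow> 'h \<Rightarrow> 'h) \<Rightarrow> bool" where
  "Nkappa sc ip \<kappa> D Q \<longleftrightarrow> meromorphic_nonreal sc ip D Q \<and>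
     (\<forall>z\<in>D. cnj z \<in> D \<and> hadj ip (Q (cnj z)) = Q z) \<and>
     neg_squares (\<lambda>(z, h) (w, g). ip (NQ ip sc Q z w h) g) ((D \<inter> {z. Im z > 0}) \<times> UNIV) \<kappa>"

definition rep_fun :: "(complex \<Rightarrow> 'h::ab_group_add \<Rightarrow> 'h) \<Rightarrow> ('h \<Rightarrow> 'h \<Rightarrow> complex) \<Rightarrow>
    (complex \<Rightarrow> 'k::ab_group_add \<Rightarrow> 'k) \<Rightarrow> ('k \<Rightarrow> 'k \<Rightarrow> complex) \<Rightarrow> 'k set \<Rightarrow> ('k \<times> 'k) set \<Rightarrow>
    ('h \<Rightarrow> 'k) \<Rightarrow> complex \<Rightarrow> ('h \<Rightarrow> 'h) \<Rightarrow> complex \<Rightarrow> 'h \<Rightarrow> 'h" where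
  "rep_fun sch iph sck ipk V A G z0 C z h =
     C h + sch (z - cnj z0) (gadj iph ipk G (G h + sck (z - z0) (resolv sck V A z (G h))))"

text \<open>Q is represented by the triplet (V, A, \<Gamma>) (V a closed non-degenerate subspace of the
  Pontryagin space K, which is itself a Pontryagin space), with Q(z0)^* as constant term\<close>
definition represents :: "(complex \<Rightarrow> 'h::ab_group_add \<Rightarrow> 'h) \<Rightarrow> ('h \<Rightarrow> 'h \<Rightarrow> complex) \<Rightarrow>
    (complex \<Rightarrow> 'k::ab_group_add \<Rightarrow> 'k) \<Rightarrow> ('k \<Rightarrow> 'k \<Rightarrow> complex) \<Rightarrow> 'k set \<Rightarrow> ('k \<times> 'k) set \<Rightarrow>
    ('h \<Rightarrow> 'k) \<Rightarrow> complex \<Rightarrow> (complex \<Rightarrow> 'h \<Rightarrow> 'h) \<Rightarrow> bool" where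
  "represents sch iph sck ipk V A G z0 Q \<longleftrightarrow>
     (\<exists>\<mu>. pontryagin sck ipk \<mu>) \<and> closed_nondeg_subspace sck ipk V \<and>
     selfadj_rel ipk V A \<and> z0 \<in> rho sck ipk V A \<and> Im z0 > 0 \<and>
     bop_HK sch iph sck ipk G \<and> (\<forall>h. G h \<in> V) \<and>
     (\<forall>z\<in>rho sck ipk V A. \<forall>h. Q z h = rep_fun sch iph sck ipk V A G z0 (hadj iph (Q z0)) z h)"

definition minimal_triplet :: "(complex \<Rightarrow> 'k::ab_group_add \<Rightarrow> 'k) \<Rightarrow> ('k \<Rightarrow> 'k \<Rightarrow> complex) \<Rightarrow>
    'k set \<Rightarrow> ('k \<times> 'k) set \<Rightarrow> ('h \<Rightarrow> 'k) \<Rightarrow> complex \<Rightarrow> bool" where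
  "minimal_triplet sck ipk V A G z0 \<longleftrightarrow>
     V = kclosure sck ipk (cspan sck
       {y. \<exists>z\<in>rho sck ipk V A. \<exists>h. y = G h + sck (z - z0) (resolv sck V A z (G h))})"

definition minimal_rep where
  "minimal_rep sch iph sck ipk V A G z0 Q \<longleftrightarrow>
     represents sch iph sck ipk V A G z0 Q \<and> minimal_triplet sck ipk V A G z0"

definition psc :: "(complex \<Rightarrow> 'a \<Rightarrow> 'a) \<Rightarrow> (complex \<Rightarrow> 'b \<Rightarrow> 'b) \<Rightarrow> complex \<Rightarrow> 'a \<times> 'b \<Rightarrow> 'a \<times> 'b" where
  "psc s1 s2 c x = (s1 c (fst x), s2 c (snd x))"

definition pip :: "('a \<Rightarrow> 'a \<Rightarrow> complex) \<Rightarrow> ('b \<Rightarrow> 'b \<Rightarrow> complex) \<Rightarrow> 'a \<times> 'b \<Rightarrow> 'a \<times> 'b \<Rightarrow> complex" where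
  "pip i1 i2 x y = i1 (fst x) (fst y) + i2 (snd x) (snd y)"

definition prel :: "('a \<times> 'a) set \<Rightarrow> ('b \<times> 'b) set \<Rightarrow> (('a \<times> 'b) \<times> ('a \<times> 'b)) set" where
  "prel A1 A2 = {((f1, f2), (g1, g2)). (f1, g1) \<in> A1 \<and> (f2, g2) \<in> A2}"

end

(*
  For z in the resolvent set put gamma(z) = (I + (z - z0) (A - z)^-1) Gamma.  The resolvent identity gives
  (N_Q(z,w) h, g) = [gamma(z) h, gamma(w) g], so the negative squares of the kernel are those of the linear
  span L of the vectors gamma(z) h, z in the upper half plane; by Sylvester's law of inertia this
  number is the maximal dimension of a negative definite subspace of L.

  (i) The projection E_i commutes with the resolvent, hence gamma_i = E_i gamma and L is contained in
  L_1 [+] L_2 with L_i contained in K_i.  Therefore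
    kappa = neg L <= neg L_1 + neg L_2 <= kappa_1 + kappa_2 <= neg K = kappa,
  and equality holds throughout.  At a nonreal point outside the resolvent set the pole of Q yields, by
  minimality and the maximum principle, a pole of (A - w)^-1 in operator norm, and so poles of the Q_i.

  (ii) If Gamma^+ is injective then ran Gamma = ran gamma(z0) is dense, which gives minimality.  With m_i
  the negative index of K_i, density also gives m_1 + m_2 = neg (ran Gamma) <= neg L <= kappa_1 + kappa_2 <=
  m_1 + m_2.

  No spectral theory is needed: bounds on projections, and the equivalence of the norms of two
  fundamental symmetries, all come from the Hellinger-Toeplitz theorem.
*)
theory Submission
  imports "HOL-Complex_Analysis.Conformal_Mappings" "Jordan_Normal_Form.Schur_Decomposition" Defs
begin

section \<open>Inertia of Hermitian matrices\<close>

text \<open>Two obstacles shape the proof. Meromorphy is demanded at every nonreal point outside the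
  domain, but a bound on Q near such a point says nothing directly about Q_1 and Q_2, whose
  singularities might cancel in the sum. The resolvent excludes this: Q controls [R(w) x, y] for x,
  y in the span of the vectors gamma(u) h, with an order that does not depend on x and y but a
  constant that does. The maximum principle, comparing with a circle on which the resolvent is
  bounded in norm, makes the constant uniform. One power of w - z is spent on a removable
  singularity, which is harmless because any finite order counts as a pole.

  The second obstacle is the topology. \<open>knorm\<close> rests on an arbitrary choice of
  fundamental symmetry, subspaces are measured in the norm of the ambient space, and the symmetry
  chosen for a direct sum need not be the sum of the chosen ones. Bounds are therefore derived from
  the indefinite product alone, where the existence of an adjoint is enough.\<close>

lemma mat_adjoint_eq: "mat_adjoint A = mat (dim_col A) (dim_row A) (\<lambda>(i,j). cnj (A $$ (j,i)))"
  by (rule eq_matI) (auto simp: mat_adjoint_def mat_of_rows_def)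

lemma mat_adjoint_carrier: "(A :: complex mat) \<in> carrier_mat n m \<Longrightarrow> mat_adjoint A \<in> carrier_mat m n"
  by (auto simp: mat_adjoint_eq)

lemma mat_adjoint_mult:
  fixes A B :: "complex mat"
  assumes "A \<in> carrier_mat n m" "B \<in> carrier_mat m k"
  shows "mat_adjoint (A * B) = mat_adjoint B * mat_adjoint A"
  using assms
  by (intro eq_matI) (auto simp: mat_adjoint_eq scalar_prod_def cnj_sum mult.commute)

lemma mat_adjoint_adjoint: "mat_adjoint (mat_adjoint A) = (A :: complex mat)"
  by (rule eq_matI) (auto simp: mat_adjoint_eq)

lemma mat_mult_index:
  assumes "A \<in> carrier_mat n m" "B \<in> carrier_mat m k" "i < n" "j < k"
  shows "(A * B) $$ (i,j) = (\<Sum>l<m. A $$ (i,l) * B $$ (l,j))"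
  using assms by (auto simp: scalar_prod_def intro!: sum.cong)

text \<open>The deflation step of the spectral theorem. The characteristic polynomial splits over
  the complex numbers, so an eigenvector exists; it is completed to a basis, and Gram-Schmidt leaves
  the first basis vector unchanged, so the eigenvector survives, up to scaling, as column 0.\<close>

lemma unitary_with_eigenvector:
  fixes A :: "complex mat"
  assumes A: "A \<in> carrier_mat n n" and n: "n \<noteq> 0"
  shows "\<exists>W e. W \<in> carrier_mat n n \<and> mat_adjoint W * W = 1\<^sub>m n \<and>
    (\<forall>i<n. (A * W) $$ (i,0) = e * W $$ (i,0))"
proof -
  from char_poly_factorized[OF A] obtain as where
    as: "char_poly A = (\<Prod>a\<leftarrow>as. [:- a, 1:])" "length as = n" by auto
  from as n obtain e es where "as = e # es" by (cases as) auto
  with as have "poly (char_poly A) e = 0" by simp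
  hence "eigenvalue A e" using eigenvalue_root_char_poly[OF A] by blast
  then obtain v where v: "v \<in> carrier_vec n" "v \<noteq> 0\<^sub>v n" "A *\<^sub>v v = e \<cdot>\<^sub>v v"
    using A unfolding eigenvalue_def eigenvector_def by auto
  interpret cof_vec_space n "TYPE(complex)" .
  define b where "b = basis_completion v"
  define ws where "ws = gram_schmidt n b"
  from basis_completion[OF v(1,2), folded b_def]
  have span_b: "span (set b) = carrier_vec n" and dist_b: "distinct b"
    and indep: "\<not> lin_dep (set b)" and b: "set b \<subseteq> carrier_vec n" and hdb: "hd b = v"
    and len_b: "length b = n" by auto
  from hdb len_b n obtain vs where bv: "b = v # vs" by (cases b, auto)
  from gram_schmidt_result[OF b dist_b indep refl, folded ws_def]
  have ws: "set ws \<subseteq> carrier_vec n" "corthogonal ws" "length ws = n"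
    by (auto simp: len_b)
  have "hd ws = v" using gram_schmidt_hd[OF v(1), of vs, folded bv] unfolding ws_def .
  hence ws0: "ws ! 0 = v" using ws(3) n by (cases ws) auto
  \<comment> \<open>\<open>gram_schmidt\<close> makes the vectors orthogonal but does not normalize
    them; dividing by \<open>nn\<close> turns the columns of W into an orthonormal system.\<close>
  define nn where "nn i = sqrt (Re (ws ! i \<bullet>c ws ! i))" for i
  define W where "W = mat n n (\<lambda>(i,j). vec_index (ws ! j) i / of_real (nn j))"
  have W: "W \<in> carrier_mat n n" by (auto simp: W_def)
  have wsc: "ws ! i \<in> carrier_vec n" if "i < n" for i using ws that by auto
  have dot: "ws ! j \<bullet>c ws ! i = (\<Sum>k<n. cnj (vec_index (ws ! i) k) * vec_index (ws ! j) k)"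
    if "i < n" "j < n" for i j
    using wsc[OF that(1)] wsc[OF that(2)]
    by (auto simp: scalar_prod_def mult.commute intro!: sum.cong)
  have nn: "ws ! i \<bullet>c ws ! i = of_real (nn i ^ 2)" "nn i \<noteq> 0" if "i < n" for i
  proof -
    have e: "ws ! i \<bullet>c ws ! i = of_real (\<Sum>k<n. (cmod (vec_index (ws ! i) k))^2)"
      unfolding dot[OF that that] of_real_sum
      by (intro sum.cong refl) (metis complex_norm_square mult.commute)
    have p: "(\<Sum>k<n. (cmod (vec_index (ws ! i) k))^2) \<ge> 0" by (intro sum_nonneg) auto
    have "ws ! i \<bullet>c ws ! i \<noteq> 0" using corthogonalD[OF ws(2), of i i] that ws(3) by auto
    hence "(\<Sum>k<n. (cmod (vec_index (ws ! i) k))^2) \<noteq> 0" unfolding e by (metis of_real_0)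
    with p show "ws ! i \<bullet>c ws ! i = of_real (nn i ^ 2)" "nn i \<noteq> 0"
      unfolding nn_def e Re_complex_of_real by auto
  qed
  have "mat_adjoint W * W = 1\<^sub>m n"
  proof (rule eq_matI)
    fix i j assume "i < dim_row (1\<^sub>m n :: complex mat)" "j < dim_col (1\<^sub>m n :: complex mat)"
    hence ij: "i < n" "j < n" by auto
    have "(mat_adjoint W * W) $$ (i,j) = (\<Sum>k<n. mat_adjoint W $$ (i,k) * W $$ (k,j))"
      by (rule mat_mult_index[OF mat_adjoint_carrier[OF W] W ij])
    also have "\<dots> = (\<Sum>k<n. cnj (vec_index (ws ! i) k) * vec_index (ws ! j) k) / of_real (nn i * nn j)"
      unfolding sum_divide_distrib using ij
      by (intro sum.cong refl) (auto simp: mat_adjoint_eq W_def)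
    also have "\<dots> = (ws ! j \<bullet>c ws ! i) / of_real (nn i * nn j)" by (simp add: dot[OF ij])
    also have "\<dots> = (1\<^sub>m n) $$ (i,j)"
      using corthogonalD[OF ws(2), of j i] ij ws(3) nn[OF ij(1)]
      by (cases "i = j") (auto simp: power2_eq_square)
    finally show "(mat_adjoint W * W) $$ (i,j) = (1\<^sub>m n) $$ (i,j)" .
  qed (use W in \<open>auto simp: mat_adjoint_eq\<close>)
  moreover have "(A * W) $$ (i,0) = e * W $$ (i,0)" if i: "i < n" for i
  proof -
    have "(A * W) $$ (i,0) = (\<Sum>l<n. A $$ (i,l) * W $$ (l,0))"
      using mat_mult_index[OF A W i] n by auto
    also have "\<dots> = (\<Sum>l<n. A $$ (i,l) * vec_index v l) / of_real (nn 0)"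
      unfolding sum_divide_distrib using n by (intro sum.cong refl) (auto simp: W_def ws0)
    also have "(\<Sum>l<n. A $$ (i,l) * vec_index v l) = vec_index (A *\<^sub>v v) i"
      using A v(1) i by (auto simp: scalar_prod_def intro!: sum.cong)
    also have "\<dots> = e * vec_index v i" using v i by auto
    finally show ?thesis using i n by (simp add: W_def ws0)
  qed
  ultimately show ?thesis using W by blast
qed

text \<open>Induction on the dimension. Conjugation with W clears column 0 below the diagonal,
  hermiticity then clears row 0, and the induction hypothesis applies to the remaining
  block.\<close>

lemma hermitian_unitary_diagonalization:
  fixes A :: "complex mat"
  assumes "A \<in> carrier_mat n n" "mat_adjoint A = A"
  shows "\<exists>U D. U \<in> carrier_mat n n \<and> D \<in> carrier_mat n n \<and> mat_adjoint U * U = 1\<^sub>m n \<and>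
    diagonal_mat D \<and> mat_adjoint D = D \<and> A = U * D * mat_adjoint U"
  using assms
proof (induction n arbitrary: A)
  case 0
  have "A = 1\<^sub>m 0" "mat_adjoint (1\<^sub>m 0 :: complex mat) = 1\<^sub>m 0"
    using 0 by (auto simp: mat_adjoint_eq)
  then show ?case by (intro exI[of _ "1\<^sub>m 0"]) (auto simp: diagonal_mat_def)
next
  case (Suc m)
  let ?n = "Suc m"
  from unitary_with_eigenvector[OF Suc.prems(1)] obtain W e where
    W: "W \<in> carrier_mat ?n ?n" and WW: "mat_adjoint W * W = 1\<^sub>m ?n"
    and ev: "\<And>i. i < ?n \<Longrightarrow> (A * W) $$ (i,0) = e * W $$ (i,0)" by auto
  note A = Suc.prems(1)
  note W' = mat_adjoint_carrier[OF W]
  have WW': "W * mat_adjoint W = 1\<^sub>m ?n"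
    by (rule mat_mult_left_right_inverse[OF W' W WW])
  have AW: "A * W \<in> carrier_mat ?n ?n" using A W by auto
  define B where "B = mat_adjoint W * (A * W)"
  have B: "B \<in> carrier_mat ?n ?n" unfolding B_def using W' AW by auto
  have hB: "mat_adjoint B = B"
    unfolding B_def mat_adjoint_mult[OF W' AW] mat_adjoint_mult[OF A W] mat_adjoint_adjoint Suc.prems(2)
    using A W W' by (metis assoc_mult_mat)
  have B0: "B $$ (i,0) = (if i = 0 then e else 0)" if i: "i < ?n" for i
  proof -
    have "B $$ (i,0) = (\<Sum>l<?n. mat_adjoint W $$ (i,l) * (A * W) $$ (l,0))"
      unfolding B_def using mat_mult_index[OF W' AW i] by auto
    also have "\<dots> = e * (\<Sum>l<?n. mat_adjoint W $$ (i,l) * W $$ (l,0))"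
      unfolding sum_distrib_left by (intro sum.cong refl) (auto simp: ev)
    also have "\<dots> = e * (mat_adjoint W * W) $$ (i,0)"
      using mat_mult_index[OF W' W i, of 0] by auto
    finally show ?thesis unfolding WW using i by auto
  qed
  have hBi: "B $$ (i,j) = cnj (B $$ (j,i))" if "i < ?n" "j < ?n" for i j
    using arg_cong[OF hB, of "\<lambda>M. M $$ (i,j)"] B that by (auto simp: mat_adjoint_eq)
  have er: "cnj e = e" using hBi[of 0 0] B0[of 0] by auto
  define C where "C = mat m m (\<lambda>(i,j). B $$ (Suc i, Suc j))"
  have C: "C \<in> carrier_mat m m" by (auto simp: C_def)
  have "mat_adjoint C = C"
    by (rule eq_matI) (auto simp: mat_adjoint_eq C_def hBi[symmetric])
  from Suc.IH[OF C this] obtain U D where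
    U: "U \<in> carrier_mat m m" and D: "D \<in> carrier_mat m m" and UU: "mat_adjoint U * U = 1\<^sub>m m"
    and dD: "diagonal_mat D" and hD: "mat_adjoint D = D" and CU: "C = U * D * mat_adjoint U" by blast
  \<comment> \<open>Block matrices with a scalar corner. \<open>blm\<close>, \<open>bla\<close> and
    \<open>bl1\<close> show that products, adjoints and the identity respect this shape, so the
    diagonalization of C lifts to B.\<close>
  let ?bl = "\<lambda>x M. four_block_mat (mat 1 1 (\<lambda>_. x)) (0\<^sub>m 1 m) (0\<^sub>m m 1) M :: complex mat"
  have blm: "?bl x M * ?bl y N = ?bl (x * y) (M * N)" if "M \<in> carrier_mat m m" "N \<in> carrier_mat m m" for x y M N
  proof -
    have one: "mat 1 1 (\<lambda>_. x) * mat 1 1 (\<lambda>_. y) = mat 1 1 (\<lambda>_. x * y :: complex)"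
      by (rule eq_matI) (auto simp: scalar_prod_def)
    show ?thesis
      using that by (subst mult_four_block_mat[of _ 1 1 _ m _ m _ _ 1 _ m]) (auto simp: one[unfolded One_nat_def])
  qed
  have bla: "mat_adjoint (?bl x M) = ?bl (cnj x) (mat_adjoint M)" if "M \<in> carrier_mat m m" for x M
    by (rule eq_matI) (use that in \<open>auto simp: mat_adjoint_eq four_block_mat_def Let_def\<close>)
  have blc: "?bl x M \<in> carrier_mat ?n ?n" if "M \<in> carrier_mat m m" for x M using that by auto
  have bl1: "?bl 1 (1\<^sub>m m) = 1\<^sub>m ?n" by (rule eq_matI) (auto simp: four_block_mat_def Let_def)
  have B_bl: "B = ?bl e C"
  proof (rule eq_matI)
    fix i j assume "i < dim_row (?bl e C)" "j < dim_col (?bl e C)"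
    hence ij: "i < ?n" "j < ?n" using C by auto
    show "B $$ (i,j) = ?bl e C $$ (i,j)"
      using ij B0[of i] B0[of j] hBi[of 0 j] C er
      by (cases i; cases j) (auto simp: four_block_mat_def Let_def C_def)
  qed (use B C in auto)
  note U' = mat_adjoint_carrier[OF U]
  let ?U = "?bl 1 U" and ?D = "?bl e D"
  have BU: "B = ?U * ?D * mat_adjoint ?U"
    unfolding B_bl CU bla[OF U] using U D U' by (simp add: blm del: One_nat_def)
  have UU': "mat_adjoint ?U * ?U = 1\<^sub>m ?n"
    unfolding bla[OF U] using U U' UU by (simp add: blm bl1 del: One_nat_def)
  define V where "V = W * ?U"
  have cU: "?U \<in> carrier_mat ?n ?n" and cD: "?D \<in> carrier_mat ?n ?n"
    using blc[OF U] blc[OF D] by blast+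
  note cU' = mat_adjoint_carrier[OF cU]
  have V: "V \<in> carrier_mat ?n ?n" unfolding V_def using W cU by auto
  have V': "mat_adjoint V = mat_adjoint ?U * mat_adjoint W"
    unfolding V_def by (rule mat_adjoint_mult[OF W cU])
  have "mat_adjoint V * V = mat_adjoint ?U * (mat_adjoint W * W) * ?U"
    unfolding V' unfolding V_def using W W' cU cU' by (simp add: assoc_mult_mat[of _ ?n ?n _ ?n _ ?n])
  also have "\<dots> = 1\<^sub>m ?n" unfolding WW using cU' UU' by simp
  finally have VV: "mat_adjoint V * V = 1\<^sub>m ?n" .
  have "W * B * mat_adjoint W = (W * mat_adjoint W) * A * (W * mat_adjoint W)"
    unfolding B_def using W W' A by (simp add: assoc_mult_mat[of _ ?n ?n _ ?n _ ?n])
  hence "A = W * B * mat_adjoint W" unfolding WW' using A by simp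
  also have "\<dots> = V * ?D * mat_adjoint V"
    unfolding V' BU unfolding V_def using W W' cU cU' cD
    by (simp add: assoc_mult_mat[of _ ?n ?n _ ?n _ ?n])
  finally have "A = V * ?D * mat_adjoint V" .
  moreover have "diagonal_mat ?D"
    using dD D unfolding diagonal_mat_def by (auto simp: four_block_mat_def Let_def)
  moreover have "mat_adjoint ?D = ?D" unfolding bla[OF D] hD er ..
  ultimately show ?case using V cD VV by blast
qed

lemma order_prod_list_linear:
  fixes xs :: "complex list"
  shows "Polynomial.order a (\<Prod>x\<leftarrow>xs. [:- x, 1:]) = count_list xs a"
proof (induction xs)
  case (Cons y ys)
  have nz: "(\<Prod>x\<leftarrow>zs. [:- x, 1:]) \<noteq> (0::complex poly)" for zs by (subst prod_list_zero_iff) auto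
  have "Polynomial.order a [:-y,1:] = (if a = y then 1 else 0)"
    by (cases "a = y") (use order_power_n_n[of y 1] in \<open>auto simp: order_0I\<close>)
  moreover have "Polynomial.order a ([:-y,1:] * (\<Prod>x\<leftarrow>ys. [:- x, 1:])) =
      Polynomial.order a [:-y,1:] + Polynomial.order a (\<Prod>x\<leftarrow>ys. [:- x, 1:])"
    by (rule order_mult) (use nz[of "y # ys"] in simp)
  ultimately show ?case using Cons by simp
qed auto

text \<open>\<open>neg_eigs\<close> adds up the orders of the negative roots, so for a polynomial
  split into linear factors it counts list entries with repetition. The list will be the diagonal of
  D.\<close>

lemma neg_eigs_diagonal_count:
  assumes cp: "char_poly A = (\<Prod>x\<leftarrow>xs. [:- x, 1:])"
  shows "neg_eigs A = length (filter (\<lambda>a. a \<in> \<real> \<and> Re a < 0) xs)"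
proof -
  let ?P = "\<lambda>a::complex. a \<in> \<real> \<and> Re a < 0"
  have r: "{a. poly (char_poly A) a = 0 \<and> a \<in> \<real> \<and> Re a < 0} = set (filter ?P xs)"
    unfolding cp by (auto simp: poly_prod_list prod_list_zero_iff)
  have "neg_eigs A = (\<Sum>a\<in>set (filter ?P xs). count_list xs a)"
    unfolding neg_eigs_def r unfolding cp order_prod_list_linear ..
  also have "\<dots> = (\<Sum>a\<in>set (filter ?P xs). count_list (filter ?P xs) a)"
  proof (intro sum.cong refl)
    fix a assume "a \<in> set (filter ?P xs)"
    hence "?P a" by auto
    thus "count_list xs a = count_list (filter ?P xs) a" by (induction xs) auto
  qed
  also have "\<dots> = length (filter ?P xs)" by (rule sum_count_set) auto
  finally show ?thesis .
qed

text \<open>If g is the Gram matrix of vectors x_i, this is the form evaluated on the sum of the c_i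
  x_i. The conjugate falls on the second index because inner products are conjugate linear in the
  second argument.\<close>

definition hform :: "nat \<Rightarrow> (nat \<Rightarrow> nat \<Rightarrow> complex) \<Rightarrow> (nat \<Rightarrow> complex) \<Rightarrow> complex" where
  "hform n g c = (\<Sum>i<n. \<Sum>j<n. c i * cnj (c j) * g i j)"

text \<open>The spectral theorem in coordinates: d holds the eigenvalues, and the columns of u are
  an orthonormal eigenbasis. Both halves of Sylvester's law are read off from it.\<close>

lemma hermitian_inertia:
  fixes A :: "complex mat"
  assumes A: "A \<in> carrier_mat n n" and h: "mat_adjoint A = A"
  obtains u :: "nat \<Rightarrow> nat \<Rightarrow> complex" and d :: "nat \<Rightarrow> real" where
    "\<And>i j. i < n \<Longrightarrow> j < n \<Longrightarrow> A $$ (i,j) = (\<Sum>k<n. of_real (d k) * u i k * cnj (u j k))"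
    "\<And>k l. k < n \<Longrightarrow> l < n \<Longrightarrow> (\<Sum>i<n. cnj (u i k) * u i l) = (if k = l then 1 else 0)"
    "neg_eigs A = card {k. k < n \<and> d k < 0}"
proof -
  from hermitian_unitary_diagonalization[OF A h] obtain U D where
    U: "U \<in> carrier_mat n n" and D: "D \<in> carrier_mat n n" and UU: "mat_adjoint U * U = 1\<^sub>m n" and
    dD: "diagonal_mat D" and hD: "mat_adjoint D = D" and AU: "A = U * D * mat_adjoint U" by blast
  note U' = mat_adjoint_carrier[OF U]
  define d where "d k = Re (D $$ (k,k))" for k
  have dre: "D $$ (k,k) = of_real (d k)" if "k < n" for k
  proof -
    have "D $$ (k,k) = cnj (D $$ (k,k))"
      using arg_cong[OF hD, of "\<lambda>M. M $$ (k,k)"] D that by (auto simp: mat_adjoint_eq)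
    thus ?thesis unfolding d_def by (metis complex_cnj_cancel_iff complex_is_Real_iff Reals_cnj_iff of_real_Re)
  qed
  have Dij: "D $$ (i,j) = (if i = j then of_real (d i) else 0)" if "i < n" "j < n" for i j
    using dD D dre that unfolding diagonal_mat_def by auto
  have 1: "A $$ (i,j) = (\<Sum>k<n. of_real (d k) * U $$ (i,k) * cnj (U $$ (j,k)))"
    if ij: "i < n" "j < n" for i j
  proof -
    have UD: "U * D \<in> carrier_mat n n" using U D by auto
    have "A $$ (i,j) = (\<Sum>k<n. (U * D) $$ (i,k) * mat_adjoint U $$ (k,j))"
      unfolding AU by (rule mat_mult_index[OF UD U' ij])
    also have "\<dots> = (\<Sum>k<n. of_real (d k) * U $$ (i,k) * cnj (U $$ (j,k)))"
    proof (intro sum.cong refl)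
      fix k assume "k \<in> {..<n}" hence k: "k < n" by auto
      have "(U * D) $$ (i,k) = (\<Sum>l<n. U $$ (i,l) * D $$ (l,k))"
        by (rule mat_mult_index[OF U D ij(1) k])
      also have "\<dots> = (\<Sum>l<n. if l = k then U $$ (i,k) * of_real (d k) else 0)"
        by (intro sum.cong refl) (use k in \<open>auto simp: Dij\<close>)
      also have "\<dots> = U $$ (i,k) * of_real (d k)" using k by (simp add: sum.delta)
      finally show "(U * D) $$ (i,k) * mat_adjoint U $$ (k,j) = of_real (d k) * U $$ (i,k) * cnj (U $$ (j,k))"
        using U k ij by (auto simp: mat_adjoint_eq)
    qed
    finally show ?thesis .
  qed
  have 2: "(\<Sum>i<n. cnj (U $$ (i,k)) * U $$ (i,l)) = (if k = l then 1 else 0)" if kl: "k < n" "l < n" for k l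
  proof -
    have "(\<Sum>i<n. cnj (U $$ (i,k)) * U $$ (i,l)) = (mat_adjoint U * U) $$ (k,l)"
      unfolding mat_mult_index[OF U' U kl] using U kl by (auto simp: mat_adjoint_eq)
    thus ?thesis unfolding UU using kl by auto
  qed
  have UU2: "U * mat_adjoint U = 1\<^sub>m n" by (rule mat_mult_left_right_inverse[OF U' U UU])
  have "similar_mat_wit A D U (mat_adjoint U)"
    by (rule similar_mat_witI[of _ _ n]) (use A D U U' UU UU2 AU in auto)
  hence "similar_mat A D" unfolding similar_mat_def by blast
  hence "char_poly A = char_poly D" by (rule char_poly_similar)
  also have "\<dots> = (\<Prod>a\<leftarrow>diag_mat D. [:- a, 1:])"
    by (rule char_poly_upper_triangular[OF D])
       (use dD D in \<open>auto simp: diagonal_mat_def upper_triangular_def\<close>)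
  finally have "neg_eigs A = length (filter (\<lambda>a. a \<in> \<real> \<and> Re a < 0) (diag_mat D))"
    by (rule neg_eigs_diagonal_count)
  also have "diag_mat D = map (\<lambda>k. of_real (d k)) [0..<n]"
    using D dre by (auto simp: diag_mat_def)
  also have "length (filter (\<lambda>a. a \<in> \<real> \<and> Re a < 0) (map (\<lambda>k. complex_of_real (d k)) [0..<n]))
     = length (filter (\<lambda>k. d k < 0) [0..<n])"
    by (simp add: filter_map o_def)
  also have "\<dots> = card (set (filter (\<lambda>k. d k < 0) [0..<n]))"
    by (rule distinct_card[symmetric]) simp
  also have "set (filter (\<lambda>k. d k < 0) [0..<n]) = {k. k < n \<and> d k < 0}" by auto
  finally have 3: "neg_eigs A = card {k. k < n \<and> d k < 0}" .
  show ?thesis by (rule that[of d "\<lambda>i k. U $$ (i,k)"]) (use 1 2 3 in auto)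
qed

section \<open>Quadratic forms in coordinates and Sylvester's law of inertia\<close>

lemma sum_swap3:
  "(\<Sum>i\<in>A. \<Sum>j\<in>B. \<Sum>k\<in>C. f i j k) = (\<Sum>k\<in>C. \<Sum>i\<in>A. \<Sum>j\<in>B. f i j k :: 'a::comm_monoid_add)"
proof -
  have "(\<Sum>i\<in>A. \<Sum>j\<in>B. \<Sum>k\<in>C. f i j k) = (\<Sum>i\<in>A. \<Sum>k\<in>C. \<Sum>j\<in>B. f i j k)"
    by (intro sum.cong refl sum.swap)
  also have "\<dots> = (\<Sum>k\<in>C. \<Sum>i\<in>A. \<Sum>j\<in>B. f i j k)" by (rule sum.swap)
  finally show ?thesis .
qed

lemma hform_sum_squares:
  assumes "\<And>i j. i < n \<Longrightarrow> j < n \<Longrightarrow> g i j = (\<Sum>k<n. of_real (d k) * u i k * cnj (u j k))"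
  shows "hform n g c = of_real (\<Sum>k<n. d k * (cmod (\<Sum>i<n. c i * u i k))^2)"
proof -
  have "hform n g c = (\<Sum>i<n. \<Sum>j<n. \<Sum>k<n. of_real (d k) * (c i * u i k) * cnj (c j * u j k))"
    unfolding hform_def by (intro sum.cong refl) (simp add: assms sum_distrib_left algebra_simps)
  also have "\<dots> = (\<Sum>k<n. \<Sum>i<n. \<Sum>j<n. of_real (d k) * (c i * u i k) * cnj (c j * u j k))"
    by (rule sum_swap3)
  also have "\<dots> = (\<Sum>k<n. of_real (d k) * ((\<Sum>i<n. c i * u i k) * cnj (\<Sum>j<n. c j * u j k)))"
    by (intro sum.cong refl, simp only: cnj_sum sum_product, simp only: sum_distrib_left mult.assoc)
  also have "\<dots> = of_real (\<Sum>k<n. d k * (cmod (\<Sum>i<n. c i * u i k))^2)"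
    by (simp only: complex_norm_square of_real_sum of_real_mult)
  finally show ?thesis .
qed

text \<open>Gaussian elimination for p homogeneous equations in more than p unknowns. If the last
  equation is not vacuous, an unknown with nonzero coefficient is used to eliminate it.\<close>

lemma underdetermined_nontrivial:
  fixes a :: "nat \<Rightarrow> nat \<Rightarrow> complex"
  assumes "p < k"
  shows "\<exists>c. (\<exists>i<k. c i \<noteq> 0) \<and> (\<forall>j<p. (\<Sum>i<k. c i * a i j) = 0)"
  using assms
proof (induction p arbitrary: k a)
  case 0
  then show ?case by (intro exI[of _ "\<lambda>_. 1"]) auto
next
  case (Suc p)
  then obtain k' where k: "k = Suc k'" "p < k'" by (cases k) auto
  show ?case
  proof (cases "\<forall>i<k. a i p = 0")
    case True
    from Suc.IH[of k a] Suc.prems obtain c where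
      "\<exists>i<k. c i \<noteq> 0" "\<forall>j<p. (\<Sum>i<k. c i * a i j) = 0" by auto
    thus ?thesis using True by (intro exI[of _ c]) (auto simp: less_Suc_eq)
  next
    case False
    then obtain m where m: "m < k" "a m p \<noteq> 0" by auto
    \<comment> \<open>A transposition that moves the pivot m to the last index k', so that the
      unknowns below k' are those of the reduced system.\<close>
    define s where "s i = (if i = m then k' else if i = k' then m else i)" for i
    have bij: "bij_betw s {..<k} {..<k}"
      by (rule bij_betw_byWitness[of _ s]) (use m k in \<open>auto simp: s_def\<close>)
    have ss: "s (s i) = i" for i by (auto simp: s_def)
    define b where "b i = a (s i)" for i
    have bk: "b k' p \<noteq> 0" using m by (auto simp: b_def s_def)
    from Suc.IH[OF k(2), of "\<lambda>i j. b i j - b i p / b k' p * b k' j"] obtain c where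
      c: "\<exists>i<k'. c i \<noteq> 0" "\<And>j. j < p \<Longrightarrow> (\<Sum>i<k'. c i * (b i j - b i p / b k' p * b k' j)) = 0" by blast
    \<comment> \<open>The pivot unknown receives the value - t, chosen so that equation p holds; the
      reduced coefficients then make the other equations hold as well.\<close>
    define t where "t = (\<Sum>i<k'. c i * b i p) / b k' p"
    define e where "e i = (if i = k' then - t else c i)" for i
    have e: "(\<Sum>i<k. e i * b i j) = (\<Sum>i<k'. c i * b i j) - t * b k' j" for j
      unfolding k by (simp add: e_def)
    have "(\<Sum>i<k. e i * b i j) = 0" if "j < Suc p" for j
    proof (cases "j = p")
      case True thus ?thesis unfolding e t_def using bk by simp
    next
      case False
      hence "j < p" using that by auto
      from c(2)[OF this] show ?thesis
        unfolding e t_def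
        by (simp add: algebra_simps sum_subtractf sum_distrib_left sum_distrib_right sum_divide_distrib)
    qed
    moreover have "(\<Sum>i<k. e (s i) * a i j) = (\<Sum>i<k. e i * b i j)" for j
      unfolding b_def by (subst sum.reindex_bij_betw[OF bij, symmetric]) (simp add: ss)
    moreover have "\<exists>i<k. e (s i) \<noteq> 0"
    proof -
      obtain i where i: "i < k'" "c i \<noteq> 0" using c(1) by auto
      have "s i < k" using i m k by (auto simp: s_def)
      thus ?thesis using i by (intro exI[of _ "s i"]) (auto simp: ss e_def)
    qed
    ultimately show ?thesis by (intro exI[of _ "\<lambda>i. e (s i)"]) auto
  qed
qed

text \<open>Upper half of Sylvester's law: the functionals are the coordinates along the
  eigenvectors with negative eigenvalue. On their common kernel only terms with nonnegative
  \<open>d k\<close> are left in \<open>hform_sum_squares\<close>.\<close>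

lemma neg_eigs_functionals:
  assumes A: "A \<in> carrier_mat n n" and h: "mat_adjoint A = A"
  shows "\<exists>f :: nat \<Rightarrow> nat \<Rightarrow> complex. \<forall>c. (\<forall>j<neg_eigs A. (\<Sum>i<n. c i * f i j) = 0) \<longrightarrow>
    Re (hform n (\<lambda>i j. A $$ (i,j)) c) \<ge> 0"
proof -
  obtain u :: "nat \<Rightarrow> nat \<Rightarrow> complex" and d :: "nat \<Rightarrow> real" where
    u: "\<And>i j. i < n \<Longrightarrow> j < n \<Longrightarrow> A $$ (i,j) = (\<Sum>k<n. of_real (d k) * u i k * cnj (u j k))"
    and "\<And>k l. k < n \<Longrightarrow> l < n \<Longrightarrow> (\<Sum>i<n. cnj (u i k) * u i l) = (if k = l then 1 else 0)"
    and N: "neg_eigs A = card {k. k < n \<and> d k < 0}" (is "_ = card ?N")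
    by (rule hermitian_inertia[OF A h]) (rule that)
  obtain e where e: "bij_betw e {0..<card ?N} ?N" using ex_bij_betw_nat_finite[of ?N] by auto
  show ?thesis
  proof (intro exI[of _ "\<lambda>i j. u i (e j)"] allI impI)
    fix c :: "nat \<Rightarrow> complex" assume z: "\<forall>j<neg_eigs A. (\<Sum>i<n. c i * u i (e j)) = 0"
    have "0 \<le> (\<Sum>k<n. d k * (cmod (\<Sum>i<n. c i * u i k))^2)"
    proof (intro sum_nonneg)
      fix k assume "k \<in> {..<n}"
      show "0 \<le> d k * (cmod (\<Sum>i<n. c i * u i k))^2"
      proof (cases "d k < 0")
        case True
        hence "k \<in> ?N" using \<open>k \<in> _\<close> by auto
        then obtain j where "j \<in> {0..<card ?N}" "k = e j"
          using bij_betw_imp_surj_on[OF e] by blast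
        thus ?thesis using z N by auto
      qed auto
    qed
    thus "Re (hform n (\<lambda>i j. A $$ (i,j)) c) \<ge> 0"
      by (subst hform_sum_squares[where d = d and u = u]) (auto simp: u)
  qed
qed

text \<open>Lower half of Sylvester's law: suitably scaled eigenvectors are orthonormal for the
  negated form.\<close>

lemma neg_eigs_witness:
  assumes A: "A \<in> carrier_mat n n" and h: "mat_adjoint A = A"
  obtains w :: "nat \<Rightarrow> nat \<Rightarrow> complex" where
    "\<And>i j. i < neg_eigs A \<Longrightarrow> j < neg_eigs A \<Longrightarrow>
       (\<Sum>a<n. \<Sum>b<n. w i a * cnj (w j b) * A $$ (a,b)) = (if i = j then -1 else 0)"
proof -
  obtain u :: "nat \<Rightarrow> nat \<Rightarrow> complex" and d :: "nat \<Rightarrow> real" where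
    u: "\<And>i j. i < n \<Longrightarrow> j < n \<Longrightarrow> A $$ (i,j) = (\<Sum>k<n. of_real (d k) * u i k * cnj (u j k))"
    and o: "\<And>k l. k < n \<Longrightarrow> l < n \<Longrightarrow> (\<Sum>i<n. cnj (u i k) * u i l) = (if k = l then 1 else 0)"
    and N: "neg_eigs A = card {k. k < n \<and> d k < 0}" (is "_ = card ?N")
    by (rule hermitian_inertia[OF A h]) (rule that)
  obtain e where e: "bij_betw e {0..<card ?N} ?N" using ex_bij_betw_nat_finite[of ?N] by auto
  \<comment> \<open>The diagonalized form pairs coefficients with u without conjugation, so the
    conjugated column isolates the eigenvalue \<open>d (e i)\<close>; the divisor scales the value
    to -1.\<close>
  define w where "w i a = cnj (u a (e i)) / of_real (sqrt (- d (e i)))" for i a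
  show ?thesis
  proof (rule that[of w])
    fix i j assume ij: "i < neg_eigs A" "j < neg_eigs A"
    let ?s = "\<lambda>i. complex_of_real (sqrt (- d (e i)))"
    have eN: "e i \<in> ?N" "e j \<in> ?N" using e ij N unfolding bij_betw_def by auto
    have o': "(\<Sum>a<n. cnj (u a (e l)) * u a k) = (if e l = k then 1 else 0)" if "e l \<in> ?N" "k < n" for l k
      using o[of "e l" k] that by auto
    have o'': "(\<Sum>a<n. u a (e l) * cnj (u a k)) = (if e l = k then 1 else 0)" if "e l \<in> ?N" "k < n" for l k
      using arg_cong[OF o'[OF that], of cnj] by (simp add: cnj_sum)
    have "(\<Sum>a<n. \<Sum>b<n. w i a * cnj (w j b) * A $$ (a,b)) =
       (\<Sum>a<n. \<Sum>b<n. \<Sum>k<n. of_real (d k) / (?s i * ?s j) * (cnj (u a (e i)) * u a k) * (u b (e j) * cnj (u b k)))"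
      by (intro sum.cong refl) (simp add: u w_def sum_distrib_left sum_divide_distrib algebra_simps)
    also have "\<dots> = (\<Sum>k<n. \<Sum>a<n. \<Sum>b<n. of_real (d k) / (?s i * ?s j) * (cnj (u a (e i)) * u a k) * (u b (e j) * cnj (u b k)))"
      by (rule sum_swap3)
    also have "\<dots> = (\<Sum>k<n. of_real (d k) / (?s i * ?s j) * ((\<Sum>a<n. cnj (u a (e i)) * u a k) * (\<Sum>b<n. u b (e j) * cnj (u b k))))"
      by (intro sum.cong refl, simp only: sum_product, simp only: sum_distrib_left mult.assoc)
    also have "\<dots> = (\<Sum>k<n. if k = e i then (if i = j then of_real (d k) / (?s i * ?s j) else 0) else 0)"
    proof (intro sum.cong refl)
      fix k assume "k \<in> {..<n}"
      moreover have "e i = e j \<longleftrightarrow> i = j"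
        using e ij N unfolding bij_betw_def inj_on_def by auto
      ultimately show "of_real (d k) / (?s i * ?s j) * ((\<Sum>a<n. cnj (u a (e i)) * u a k) * (\<Sum>b<n. u b (e j) * cnj (u b k)))
        = (if k = e i then (if i = j then of_real (d k) / (?s i * ?s j) else 0) else 0)"
        using o'[OF eN(1), of k] o''[OF eN(2), of k] by auto
    qed
    also have "\<dots> = (if i = j then of_real (d (e i)) / (?s i * ?s j) else 0)"
      using eN by (simp add: sum.delta)
    also have "\<dots> = (if i = j then -1 else 0)"
    proof -
      have "?s i * ?s i = of_real (- d (e i))" using eN
        by (simp flip: of_real_mult)
      thus ?thesis using eN by (auto simp: field_simps)
    qed
    finally show "(\<Sum>a<n. \<Sum>b<n. w i a * cnj (w j b) * A $$ (a,b)) = (if i = j then -1 else 0)" .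
  qed
qed

text \<open>A linear substitution of variables. It evaluates a form on combinations of the witnesses
  w in terms of the witnesses' own Gram matrix.\<close>

lemma hform_bilinear_combination:
  "hform m (\<lambda>i j. \<Sum>a<n. \<Sum>b<n. w i a * cnj (w j b) * g a b) c = hform n g (\<lambda>a. \<Sum>i<m. c i * w i a)"
proof -
  have "hform n g (\<lambda>a. \<Sum>i<m. c i * w i a) =
    (\<Sum>a<n. \<Sum>b<n. \<Sum>i<m. \<Sum>j<m. c i * cnj (c j) * (w i a * cnj (w j b) * g a b))"
    unfolding hform_def
    by (intro sum.cong refl, simp only: cnj_sum sum_product sum_distrib_right)
       (intro sum.cong refl, simp add: sum_distrib_left sum_distrib_right mult.assoc mult.left_commute)
  also have "\<dots> = (\<Sum>i<m. \<Sum>a<n. \<Sum>b<n. \<Sum>j<m. c i * cnj (c j) * (w i a * cnj (w j b) * g a b))"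
    by (rule sum_swap3)
  also have "\<dots> = (\<Sum>i<m. \<Sum>j<m. \<Sum>a<n. \<Sum>b<n. c i * cnj (c j) * (w i a * cnj (w j b) * g a b))"
    by (intro sum.cong refl sum_swap3)
  also have "\<dots> = hform m (\<lambda>i j. \<Sum>a<n. \<Sum>b<n. w i a * cnj (w j b) * g a b) c"
    unfolding hform_def by (simp only: sum_distrib_left)
  finally show ?thesis ..
qed

lemma hform_minus_identity:
  assumes "\<And>i j. i < m \<Longrightarrow> j < m \<Longrightarrow> g i j = (if i = j then -1 else 0)"
  shows "Re (hform m g c) = - (\<Sum>i<m. (cmod (c i))^2)"
proof -
  have "hform m g c = (\<Sum>i<m. \<Sum>j<m. if j = i then - (c i * cnj (c i)) else 0)"
    unfolding hform_def by (intro sum.cong refl) (auto simp: assms)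
  also have "\<dots> = - of_real (\<Sum>i<m. (cmod (c i))^2)"
    by (simp only: of_real_sum complex_norm_square sum_negf[symmetric]) (simp add: sum.delta)
  finally show ?thesis by simp
qed

lemma sum_cmod_square_pos:
  assumes "\<exists>i<m. c i \<noteq> (0::complex)"
  shows "(\<Sum>i<(m::nat). (cmod (c i))^2) > 0"
proof -
  obtain i where "i < m" "c i \<noteq> 0" using assms by auto
  thus ?thesis by (intro sum_pos2[of _ i]) auto
qed

text \<open>Dimension count: A is negative definite on the span of its witnesses. If the bound
  failed, \<open>neg_eigs B + neg_eigs C\<close> linear conditions would leave a nonzero vector
  there on which B and C, hence A, are nonnegative.\<close>

lemma neg_eigs_subadd:
  assumes A: "A \<in> carrier_mat n n" "mat_adjoint A = A"
    and B: "B \<in> carrier_mat n n" "mat_adjoint B = B"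
    and C: "C \<in> carrier_mat n n" "mat_adjoint C = C"
    and sum: "\<And>i j. i < n \<Longrightarrow> j < n \<Longrightarrow> A $$ (i,j) = B $$ (i,j) + C $$ (i,j)"
  shows "neg_eigs A \<le> neg_eigs B + neg_eigs C"
proof (rule ccontr)
  assume n: "\<not> ?thesis"
  let ?m = "neg_eigs A"
  obtain w where w: "\<And>i j. i < ?m \<Longrightarrow> j < ?m \<Longrightarrow>
       (\<Sum>a<n. \<Sum>b<n. w i a * cnj (w j b) * A $$ (a,b)) = (if i = j then -1 else 0)"
    by (rule neg_eigs_witness[OF A]) (rule that)
  obtain f where f: "\<And>c. (\<forall>j<neg_eigs B. (\<Sum>i<n. c i * f i j) = 0) \<Longrightarrow>
    Re (hform n (\<lambda>i j. B $$ (i,j)) c) \<ge> 0" using neg_eigs_functionals[OF B] by blast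
  obtain g where g: "\<And>c. (\<forall>j<neg_eigs C. (\<Sum>i<n. c i * g i j) = 0) \<Longrightarrow>
    Re (hform n (\<lambda>i j. C $$ (i,j)) c) \<ge> 0" using neg_eigs_functionals[OF C] by blast
  define h where "h i j = (if j < neg_eigs B then f i j else g i (j - neg_eigs B))" for i j
  from n have "neg_eigs B + neg_eigs C < ?m" by simp
  from underdetermined_nontrivial[OF this, of "\<lambda>i j. \<Sum>a<n. w i a * h a j"] obtain c where
    c: "\<exists>i<?m. c i \<noteq> 0" and
    cz: "\<And>j. j < neg_eigs B + neg_eigs C \<Longrightarrow> (\<Sum>i<?m. c i * (\<Sum>a<n. w i a * h a j)) = 0" by blast
  define e where "e a = (\<Sum>i<?m. c i * w i a)" for a
  have ez: "(\<Sum>a<n. e a * h a j) = 0" if "j < neg_eigs B + neg_eigs C" for j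
  proof -
    have "(\<Sum>a<n. e a * h a j) = (\<Sum>a<n. \<Sum>i<?m. c i * w i a * h a j)"
      by (simp add: e_def sum_distrib_right)
    also have "\<dots> = (\<Sum>i<?m. \<Sum>a<n. c i * w i a * h a j)" by (rule sum.swap)
    also have "\<dots> = 0" using cz[OF that] by (simp add: sum_distrib_left mult.assoc)
    finally show ?thesis .
  qed
  have "Re (hform n (\<lambda>i j. B $$ (i,j)) e) \<ge> 0"
  proof (intro f allI impI)
    fix j assume "j < neg_eigs B"
    thus "(\<Sum>i<n. e i * f i j) = 0" using ez[of j] by (simp add: h_def)
  qed
  moreover have "Re (hform n (\<lambda>i j. C $$ (i,j)) e) \<ge> 0"
  proof (intro g allI impI)
    fix j assume "j < neg_eigs C"
    thus "(\<Sum>i<n. e i * g i j) = 0" using ez[of "neg_eigs B + j"] by (simp add: h_def)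
  qed
  moreover have "hform n (\<lambda>i j. A $$ (i,j)) e = hform n (\<lambda>i j. B $$ (i,j)) e + hform n (\<lambda>i j. C $$ (i,j)) e"
    unfolding hform_def sum.distrib[symmetric]
    by (intro sum.cong refl) (simp add: sum distrib_left)
  moreover have "Re (hform n (\<lambda>i j. A $$ (i,j)) e) < 0"
    unfolding e_def hform_bilinear_combination[symmetric]
    using hform_minus_identity[where m = "neg_eigs A" and c = c, OF w] sum_cmod_square_pos[OF c] by simp
  ultimately show False by simp
qed

section \<open>Negative squares of kernels\<close>

text \<open>For a Hermitian form, strict negativity at every nonzero coefficient vector includes
  linear independence, so the length of the list is the dimension of a negative definite
  subspace.\<close>

definition negdef :: "('a \<Rightarrow> 'a \<Rightarrow> complex) \<Rightarrow> 'a list \<Rightarrow> bool" where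
  "negdef ip ys \<longleftrightarrow> (\<forall>c. (\<exists>i<length ys. c i \<noteq> 0) \<longrightarrow>
     Re (hform (length ys) (\<lambda>i j. ip (ys ! i) (ys ! j)) c) < 0)"

text \<open>A normalized basis of a negative definite subspace. The value -1 on the diagonal gives
  the margin that \<open>negdef_perturbation\<close> measures.\<close>

definition negon :: "('a \<Rightarrow> 'a \<Rightarrow> complex) \<Rightarrow> 'a list \<Rightarrow> bool" where
  "negon ip ys \<longleftrightarrow> (\<forall>i<length ys. \<forall>j<length ys. ip (ys ! i) (ys ! j) = (if i = j then -1 else 0))"

lemma negon_imp_negdef: "negon ip ys \<Longrightarrow> negdef ip ys"
  unfolding negdef_def negon_def
  by (auto simp: hform_minus_identity intro!: sum_cmod_square_pos)

text \<open>Errors of size e in the entries change the form by at most n e S, where n is the length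
  of the list and S the squared length of c, while the unperturbed form equals -S. With e =
  1/(2(n+1)) at most half of S is lost; the + 1 keeps e meaningful for the empty list.\<close>

lemma negdef_perturbation:
  assumes on: "negon ip ys" and l: "length zs = length ys"
    and close: "\<And>i j. i < length ys \<Longrightarrow> j < length ys \<Longrightarrow>
      cmod (ip (zs ! i) (zs ! j) - ip (ys ! i) (ys ! j)) \<le> 1 / (2 * (real (length ys) + 1))"
  shows "negdef ip zs"
  unfolding negdef_def
proof (intro allI impI)
  fix c :: "nat \<Rightarrow> complex" assume "\<exists>i<length zs. c i \<noteq> 0"
  let ?m = "length ys"
  have c: "(\<Sum>i<?m. (cmod (c i))^2) > 0" (is "?S > 0") using \<open>\<exists>i<length zs. _ i\<close> l by (auto intro!: sum_cmod_square_pos)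
  let ?e = "1 / (2 * (real ?m + 1))"
  define g where "g i j = ip (zs ! i) (zs ! j) - ip (ys ! i) (ys ! j)" for i j
  have "cmod (hform ?m g c) \<le> (\<Sum>i<?m. \<Sum>j<?m. cmod (c i) * cmod (c j) * ?e)"
    unfolding hform_def
    by (intro order_trans[OF norm_sum] sum_mono)
       (simp only: norm_mult complex_mod_cnj g_def, intro mult_left_mono close mult_nonneg_nonneg norm_ge_zero, simp_all)
  also have "\<dots> \<le> (\<Sum>i<?m. \<Sum>j<?m. ((cmod (c i))^2 + (cmod (c j))^2) / 2 * ?e)"
  proof (intro sum_mono mult_right_mono)
    fix i j show "cmod (c i) * cmod (c j) \<le> ((cmod (c i))^2 + (cmod (c j))^2) / 2"
      using sum_squares_bound[of "cmod (c i)" "cmod (c j)"] by simp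
  qed auto
  also have "\<dots> = real ?m * ?S * ?e"
    by (simp only: sum_distrib_right[symmetric] sum_divide_distrib[symmetric] sum.distrib)
       (simp add: sum_distrib_left[symmetric])
  also have "\<dots> \<le> ?S / 2" using c by (simp add: field_simps)
  finally have 1: "Re (hform ?m g c) \<le> ?S / 2" using complex_Re_le_cmod order_trans by blast
  have "hform ?m (\<lambda>i j. ip (zs ! i) (zs ! j)) c = hform ?m g c + hform ?m (\<lambda>i j. ip (ys ! i) (ys ! j)) c"
    unfolding hform_def g_def by (simp add: sum.distrib[symmetric] algebra_simps)
  moreover have "Re (hform ?m (\<lambda>i j. ip (ys ! i) (ys ! j)) c) = - ?S"
    by (rule hform_minus_identity) (use on in \<open>auto simp: negon_def\<close>)
  ultimately show "Re (hform (length zs) (\<lambda>i j. ip (zs ! i) (zs ! j)) c) < 0"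
    using 1 c l by simp
qed

section \<open>Subspaces and linear spans given by carrier sets\<close>

lemma csubspaceD:
  assumes "csubspace sc V"
  shows "0 \<in> V" "x \<in> V \<Longrightarrow> y \<in> V \<Longrightarrow> x + y \<in> V" "x \<in> V \<Longrightarrow> sc c x \<in> V"
  using assms by (auto simp: csubspace_def)

lemma csubspace_sum:
  assumes "csubspace sc V" "\<And>i. i \<in> I \<Longrightarrow> f i \<in> V"
  shows "sum f I \<in> V"
  using assms(2) by (induction I rule: infinite_finite_induct) (auto simp: csubspaceD[OF assms(1)])

lemma csubspace_cspan: "csubspace sc (cspan sc S)"
  by (auto simp: cspan_def csubspace_def)

lemma cspan_superset: "S \<subseteq> cspan sc S"
  by (auto simp: cspan_def)

lemma cspan_minimal: "csubspace sc W \<Longrightarrow> S \<subseteq> W \<Longrightarrow> cspan sc S \<subseteq> W"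
  by (auto simp: cspan_def)

lemma cspan_mono: "S \<subseteq> T \<Longrightarrow> cspan sc S \<subseteq> cspan sc T"
  by (meson cspan_minimal csubspace_cspan cspan_superset order_trans)

lemma cspan_csubspace: "csubspace sc V \<Longrightarrow> cspan sc V = V"
  by (simp add: cspan_minimal cspan_superset subset_antisym)

text \<open>\<open>cspan\<close> is an intersection, so finite support cannot be read off from it.
  The vectors with finite support form a subspace that contains P, and minimality of the span does
  the rest.\<close>

lemma cspan_finite_support:
  assumes "y \<in> cspan sc P"
  shows "\<exists>xs. set xs \<subseteq> P \<and> y \<in> cspan sc (set xs)"
proof -
  let ?W = "{y. \<exists>xs. set xs \<subseteq> P \<and> y \<in> cspan sc (set xs)}"
  have "csubspace sc ?W"
    unfolding csubspace_def
  proof (intro conjI ballI allI)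
    have "0 \<in> cspan sc (set [])" by (rule csubspaceD(1)[OF csubspace_cspan])
    thus "0 \<in> ?W" by (metis (mono_tags, lifting) empty_subsetI list.set(1) mem_Collect_eq)
  next
    fix x y assume "x \<in> ?W" "y \<in> ?W"
    then obtain xs ys where xs: "set xs \<subseteq> P" "x \<in> cspan sc (set xs)" and
      ys: "set ys \<subseteq> P" "y \<in> cspan sc (set ys)" by auto
    have "x \<in> cspan sc (set (xs @ ys))" "y \<in> cspan sc (set (xs @ ys))"
      using xs ys cspan_mono[of _ "set (xs @ ys)" sc] by (auto simp: subset_iff)
    hence "x + y \<in> cspan sc (set (xs @ ys))" by (rule csubspaceD(2)[OF csubspace_cspan])
    moreover have "set (xs @ ys) \<subseteq> P" using xs ys by auto
    ultimately show "x + y \<in> ?W" by blast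
  next
    fix c x assume "x \<in> ?W"
    thus "sc c x \<in> ?W" using csubspaceD(3)[OF csubspace_cspan] by blast
  qed
  moreover have "P \<subseteq> ?W"
  proof
    fix x assume "x \<in> P"
    thus "x \<in> ?W" using cspan_superset[of "set [x]" sc] by (intro CollectI exI[of _ "[x]"]) auto
  qed
  ultimately show ?thesis using assms cspan_minimal by blast
qed

lemma cspan_finite_support_list:
  assumes "set ys \<subseteq> cspan sc P"
  shows "\<exists>xs. set xs \<subseteq> P \<and> set ys \<subseteq> cspan sc (set xs)"
  using assms
proof (induction ys)
  case Nil
  show ?case by (rule exI[of _ "[]"]) auto
next
  case (Cons y ys)
  then obtain xs where "set xs \<subseteq> P" "set ys \<subseteq> cspan sc (set xs)" by auto
  moreover obtain zs where "set zs \<subseteq> P" "y \<in> cspan sc (set zs)" using cspan_finite_support Cons by (metis list.set_intros(1) subsetD)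
  ultimately show ?case
    using cspan_mono[of "set xs" "set (xs @ zs)" sc] cspan_mono[of "set zs" "set (xs @ zs)" sc]
    by (intro exI[of _ "xs @ zs"]) auto
qed

lemma gram_map:
  assumes "\<And>p q. p \<in> set xs \<Longrightarrow> q \<in> set xs \<Longrightarrow> f p q = ip (g p) (g q)"
  shows "gram f xs = gram ip (map g xs)"
  by (rule eq_matI) (auto simp: gram_def assms)

text \<open>The passage from a kernel on points (z, h) to the vectors that represent it. A list of
  vectors lifts entrywise to a list of points, and the two Gram matrices are equal.\<close>

lemma neg_squares_pullback:
  assumes "\<And>p q. p \<in> P \<Longrightarrow> q \<in> P \<Longrightarrow> f p q = ip (g p) (g q)"
  shows "neg_squares f P k \<longleftrightarrow> neg_squares ip (g ` P) k"
proof -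
  have g: "gram f xs = gram ip (map g xs)" if "set xs \<subseteq> P" for xs
    by (rule gram_map) (use that assms in auto)
  have ex: "\<exists>xs. set xs \<subseteq> P \<and> ys = map g xs" if "set ys \<subseteq> g ` P" for ys
    using that
  proof (induction ys)
    case (Cons y ys)
    then obtain x xs where "x \<in> P" "y = g x" "set xs \<subseteq> P" "ys = map g xs" by auto
    thus ?case by (intro exI[of _ "x # xs"]) auto
  qed auto
  have im: "set (map g xs) \<subseteq> g ` P" if "set xs \<subseteq> P" for xs using that by auto
  show ?thesis unfolding neg_squares_def
  proof (intro iffI conjI allI impI; elim conjE)
    fix ys assume "\<forall>xs. set xs \<subseteq> P \<longrightarrow> neg_eigs (gram f xs) \<le> k" "set ys \<subseteq> g ` P"
    with ex[of ys] g show "neg_eigs (gram ip ys) \<le> k" by metis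
  next
    assume "\<exists>xs. set xs \<subseteq> P \<and> neg_eigs (gram f xs) = k"
    with g im show "\<exists>xs. set xs \<subseteq> g ` P \<and> neg_eigs (gram ip xs) = k" by metis
  next
    fix xs assume "\<forall>xs. set xs \<subseteq> g ` P \<longrightarrow> neg_eigs (gram ip xs) \<le> k" "set xs \<subseteq> P"
    with g im show "neg_eigs (gram f xs) \<le> k" by metis
  next
    assume "\<exists>xs. set xs \<subseteq> g ` P \<and> neg_eigs (gram ip xs) = k"
    with g ex show "\<exists>xs. set xs \<subseteq> P \<and> neg_eigs (gram f xs) = k" by metis
  qed
qed

lemma gram_carrier: "gram ip xs \<in> carrier_mat (length xs) (length xs)"
  by (simp add: gram_def)

lemma gram_adjoint:
  assumes "\<And>x y. x \<in> set xs \<Longrightarrow> y \<in> set xs \<Longrightarrow> ip y x = cnj (ip x y)"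
  shows "mat_adjoint (gram ip xs) = gram ip xs"
  by (rule eq_matI) (auto simp: mat_adjoint_eq gram_def assms[symmetric])

text \<open>Subadditivity for kernels. Part (i) applies it to the components of a vector under the
  two projections, part (ii) to the two factors of the pair space.\<close>

lemma gram_subadd:
  assumes herm: "\<And>p q. p \<in> set xs \<Longrightarrow> q \<in> set xs \<Longrightarrow> k1 q p = cnj (k1 p q)"
      "\<And>p q. p \<in> set xs \<Longrightarrow> q \<in> set xs \<Longrightarrow> k2 q p = cnj (k2 p q)"
    and add: "\<And>p q. p \<in> set xs \<Longrightarrow> q \<in> set xs \<Longrightarrow> k p q = k1 p q + k2 p q"
  shows "neg_eigs (gram k xs) \<le> neg_eigs (gram k1 xs) + neg_eigs (gram k2 xs)"
proof (rule neg_eigs_subadd)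
  show "mat_adjoint (gram k xs) = gram k xs"
  proof (rule gram_adjoint)
    fix p q assume "p \<in> set xs" "q \<in> set xs"
    thus "k q p = cnj (k p q)" using herm(1)[of p q] herm(2)[of p q] by (simp only: add complex_cnj_add)
  qed
  show "mat_adjoint (gram k1 xs) = gram k1 xs" "mat_adjoint (gram k2 xs) = gram k2 xs"
    by (rule gram_adjoint; rule herm; assumption)+
  fix i j assume "i < length xs" "j < length xs"
  thus "gram k xs $$ (i, j) = gram k1 xs $$ (i, j) + gram k2 xs $$ (i, j)"
    using add[of "xs ! i" "xs ! j"] by (simp add: gram_def)
qed (rule gram_carrier)+

section \<open>Hermitian forms, and negative squares as dimensions of negative definite
  subspaces\<close>

locale herm_space =
  fixes sc :: "complex \<Rightarrow> 'a::ab_group_add \<Rightarrow> 'a" and ip :: "'a \<Rightarrow> 'a \<Rightarrow> complex"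
  assumes hermitian: "hermitian_form sc ip"
begin

sublocale vs: vector_space sc
  using hermitian by (simp add: hermitian_form_def)

lemma ip_add_left: "ip (x + y) z = ip x z + ip y z"
  and ip_scale_left: "ip (sc c x) y = c * ip x y"
  and ip_cnj: "ip y x = cnj (ip x y)"
  using hermitian unfolding hermitian_form_def by blast+

lemma ip_add_right: "ip z (x + y) = ip z x + ip z y"
  by (metis complex_cnj_add ip_add_left ip_cnj)

lemma ip_scale_right: "ip x (sc c y) = cnj c * ip x y"
  by (metis complex_cnj_mult ip_scale_left ip_cnj)

lemma ip_zero_left [simp]: "ip 0 x = 0"
  using ip_add_left[of 0 0 x] by simp

lemma ip_zero_right [simp]: "ip x 0 = 0"
  using ip_add_right[of x 0 0] by simp

lemma ip_minus_left: "ip (- x) y = - ip x y"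
  using ip_add_left[of x "- x" y] by (simp add: eq_neg_iff_add_eq_0 add.commute)

lemma ip_minus_right: "ip x (- y) = - ip x y"
  using ip_add_right[of x y "- y"] by (simp add: eq_neg_iff_add_eq_0 add.commute)

lemma ip_diff_left: "ip (x - y) z = ip x z - ip y z"
  using ip_add_left[of x "- y" z] by (simp add: ip_minus_left)

lemma ip_diff_right: "ip z (x - y) = ip z x - ip z y"
  using ip_add_right[of z x "- y"] by (simp add: ip_minus_right)

lemma ip_sum_left: "ip (sum f I) y = (\<Sum>i\<in>I. ip (f i) y)"
  by (induction I rule: infinite_finite_induct) (auto simp: ip_add_left)

lemma ip_sum_right: "ip y (sum f I) = (\<Sum>i\<in>I. ip y (f i))"
  by (induction I rule: infinite_finite_induct) (auto simp: ip_add_right)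

lemmas ip_simps = ip_add_left ip_add_right ip_scale_left ip_scale_right
  ip_diff_left ip_diff_right ip_minus_left ip_minus_right

lemma csubspace_diff: "csubspace sc V \<Longrightarrow> x \<in> V \<Longrightarrow> y \<in> V \<Longrightarrow> x - y \<in> V"
  using csubspaceD(2)[of sc V x "sc (-1) y"] csubspaceD(3)[of sc V y "-1"] by simp

lemma ip_self_real: "ip x x = of_real (Re (ip x x))"
  using ip_cnj[of x x] by (metis Reals_cnj_iff of_real_Re)

definition lincomb :: "'a list \<Rightarrow> (nat \<Rightarrow> complex) \<Rightarrow> 'a" where
  "lincomb xs c = (\<Sum>i<length xs. sc (c i) (xs ! i))"

lemma ip_lincomb:
  "ip (lincomb xs c) (lincomb ys d) = (\<Sum>i<length xs. \<Sum>j<length ys. c i * cnj (d j) * ip (xs ! i) (ys ! j))"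
  by (simp only: lincomb_def ip_sum_left, simp only: ip_sum_right ip_scale_left ip_scale_right)
     (simp add: mult.assoc mult.left_commute)

lemma hform_gram: "hform (length xs) (\<lambda>i j. ip (xs ! i) (xs ! j)) c = ip (lincomb xs c) (lincomb xs c)"
  by (simp add: hform_def ip_lincomb)

lemma lincomb_in_cspan: "lincomb xs c \<in> cspan sc (set xs)"
  unfolding lincomb_def
  by (intro csubspace_sum[OF csubspace_cspan] csubspaceD(3)[OF csubspace_cspan])
     (use cspan_superset in force)

lemma cspan_list_lincomb:
  assumes "y \<in> cspan sc (set xs)"
  shows "\<exists>c. y = lincomb xs c"
proof -
  have "csubspace sc (range (lincomb xs))"
    unfolding csubspace_def
  proof (intro conjI ballI allI)
    have "0 = lincomb xs (\<lambda>_. 0)" by (simp add: lincomb_def)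
    thus "0 \<in> range (lincomb xs)" by blast
  next
    fix x y assume "x \<in> range (lincomb xs)" "y \<in> range (lincomb xs)"
    then obtain c d where "x = lincomb xs c" "y = lincomb xs d" by auto
    hence "x + y = lincomb xs (\<lambda>i. c i + d i)"
      by (simp add: lincomb_def sum.distrib vs.scale_left_distrib)
    thus "x + y \<in> range (lincomb xs)" by blast
  next
    fix a x assume "x \<in> range (lincomb xs)"
    then obtain c where "x = lincomb xs c" by auto
    hence "sc a x = lincomb xs (\<lambda>i. a * c i)"
      by (simp add: lincomb_def vs.scale_sum_right)
    thus "sc a x \<in> range (lincomb xs)" by blast
  qed
  moreover have "set xs \<subseteq> range (lincomb xs)"
  proof
    fix x assume "x \<in> set xs"
    then obtain k where k: "k < length xs" "x = xs ! k" by (metis in_set_conv_nth)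
    have "lincomb xs (\<lambda>i. if i = k then 1 else 0) = (\<Sum>i<length xs. if i = k then xs ! k else 0)"
      unfolding lincomb_def by (intro sum.cong) auto
    also have "\<dots> = x" using k by (simp add: sum.delta)
    finally show "x \<in> range (lincomb xs)" by (metis rangeI)
  qed
  ultimately show ?thesis using cspan_minimal assms by blast
qed

lemma gram_hermitian: "mat_adjoint (gram ip xs) = gram ip xs"
  by (rule gram_adjoint) (rule ip_cnj)

lemma gram_index: "i < length xs \<Longrightarrow> j < length xs \<Longrightarrow> gram ip xs $$ (i,j) = ip (xs ! i) (xs ! j)"
  by (simp add: gram_def)

lemma hform_gram_mat: "hform (length xs) (\<lambda>i j. gram ip xs $$ (i,j)) c = ip (lincomb xs c) (lincomb xs c)"
  unfolding hform_gram[symmetric] hform_def by (intro sum.cong refl) (auto simp: gram_index)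

lemma exists_negon_in_span:
  "\<exists>ys. negon ip ys \<and> set ys \<subseteq> cspan sc (set xs) \<and> length ys = neg_eigs (gram ip xs)"
proof -
  let ?n = "length xs"
  obtain w where w: "\<And>i j. i < neg_eigs (gram ip xs) \<Longrightarrow> j < neg_eigs (gram ip xs) \<Longrightarrow>
       (\<Sum>a<?n. \<Sum>b<?n. w i a * cnj (w j b) * gram ip xs $$ (a,b)) = (if i = j then -1 else 0)"
    by (rule neg_eigs_witness[OF gram_carrier gram_hermitian]) (rule that)
  define ys where "ys = map (\<lambda>i. lincomb xs (w i)) [0..<neg_eigs (gram ip xs)]"
  have "ip (lincomb xs (w i)) (lincomb xs (w j)) = (\<Sum>a<?n. \<Sum>b<?n. w i a * cnj (w j b) * gram ip xs $$ (a,b))" for i j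
    unfolding ip_lincomb by (intro sum.cong refl) (auto simp: gram_index)
  with w have "negon ip ys" by (auto simp: negon_def ys_def)
  moreover have "set ys \<subseteq> cspan sc (set xs)" by (auto simp: ys_def lincomb_in_cspan)
  ultimately show ?thesis by (intro exI[of _ ys]) (auto simp: ys_def)
qed

text \<open>If the list were longer than \<open>neg_eigs\<close>, a nonzero combination of it would
  be annihilated by all functionals of \<open>neg_eigs_functionals\<close>, and there the form is
  nonnegative.\<close>

lemma negdef_length_le:
  assumes "negdef ip ys" "set ys \<subseteq> cspan sc (set xs)"
  shows "length ys \<le> neg_eigs (gram ip xs)"
proof (rule ccontr)
  assume n: "\<not> ?thesis"
  let ?n = "length xs" and ?m = "length ys"
  have "\<forall>i<?m. \<exists>c. ys ! i = lincomb xs c" using cspan_list_lincomb assms(2) by (meson nth_mem subsetD)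
  then obtain w where w: "\<And>i. i < ?m \<Longrightarrow> ys ! i = lincomb xs (w i)" by metis
  obtain f where f: "\<And>c. (\<forall>j<neg_eigs (gram ip xs). (\<Sum>i<?n. c i * f i j) = 0) \<Longrightarrow>
    Re (hform ?n (\<lambda>i j. gram ip xs $$ (i,j)) c) \<ge> 0"
    using neg_eigs_functionals[OF gram_carrier gram_hermitian] by blast
  from n have "neg_eigs (gram ip xs) < ?m" by simp
  from underdetermined_nontrivial[OF this, of "\<lambda>i j. \<Sum>a<?n. w i a * f a j"] obtain c where
    c: "\<exists>i<?m. c i \<noteq> 0" and
    cz: "\<And>j. j < neg_eigs (gram ip xs) \<Longrightarrow> (\<Sum>i<?m. c i * (\<Sum>a<?n. w i a * f a j)) = 0" by blast
  define e where "e a = (\<Sum>i<?m. c i * w i a)" for a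
  have "(\<Sum>a<?n. e a * f a j) = 0" if "j < neg_eigs (gram ip xs)" for j
  proof -
    have "(\<Sum>a<?n. e a * f a j) = (\<Sum>a<?n. \<Sum>i<?m. c i * w i a * f a j)"
      by (simp add: e_def sum_distrib_right)
    also have "\<dots> = (\<Sum>i<?m. \<Sum>a<?n. c i * w i a * f a j)" by (rule sum.swap)
    also have "\<dots> = 0" using cz[OF that] by (simp add: sum_distrib_left mult.assoc)
    finally show ?thesis .
  qed
  hence "Re (hform ?n (\<lambda>i j. gram ip xs $$ (i,j)) e) \<ge> 0" using f by blast
  hence 1: "Re (ip (lincomb xs e) (lincomb xs e)) \<ge> 0" by (simp add: hform_gram_mat)
  have "lincomb ys c = (\<Sum>i<?m. \<Sum>a<?n. sc (c i * w i a) (xs ! a))"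
    unfolding lincomb_def[of ys] by (intro sum.cong refl) (simp add: w lincomb_def vs.scale_sum_right)
  also have "\<dots> = (\<Sum>a<?n. \<Sum>i<?m. sc (c i * w i a) (xs ! a))" by (rule sum.swap)
  also have "\<dots> = lincomb xs e" unfolding lincomb_def e_def by (simp add: vs.scale_sum_left)
  finally have "lincomb ys c = lincomb xs e" .
  with assms(1) c 1 show False unfolding negdef_def hform_gram by force
qed

text \<open>Eigenvalue counts are replaced by lists of vectors. Existence is stated in the strong
  form \<open>negon\<close> and the bound for the weak form \<open>negdef\<close>, so that perturbed
  lists are covered too.\<close>

lemma neg_squares_iff:
  "neg_squares ip P k \<longleftrightarrow>
    (\<exists>ys. negon ip ys \<and> set ys \<subseteq> cspan sc P \<and> length ys = k) \<and>
    (\<forall>ys. negdef ip ys \<and> set ys \<subseteq> cspan sc P \<longrightarrow> length ys \<le> k)"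
proof (intro iffI conjI allI impI; (elim conjE)?)
  assume ns: "neg_squares ip P k"
  then obtain xs where xs: "set xs \<subseteq> P" "neg_eigs (gram ip xs) = k" by (auto simp: neg_squares_def)
  from exists_negon_in_span[of xs] cspan_mono[OF xs(1), of sc] xs(2)
  show "\<exists>ys. negon ip ys \<and> set ys \<subseteq> cspan sc P \<and> length ys = k" by blast
  fix ys assume ys: "negdef ip ys" "set ys \<subseteq> cspan sc P"
  from cspan_finite_support_list[OF ys(2)] obtain xs where "set xs \<subseteq> P" "set ys \<subseteq> cspan sc (set xs)" by auto
  with ns negdef_length_le[OF ys(1)] show "length ys \<le> k" by (meson neg_squares_def order_trans)
next
  assume a: "\<exists>ys. negon ip ys \<and> set ys \<subseteq> cspan sc P \<and> length ys = k"
    and b: "\<forall>ys. negdef ip ys \<and> set ys \<subseteq> cspan sc P \<longrightarrow> length ys \<le> k"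
  have le: "neg_eigs (gram ip xs) \<le> k" if "set xs \<subseteq> P" for xs
    using exists_negon_in_span[of xs] cspan_mono[OF that, of sc] b negon_imp_negdef by (metis order_trans)
  from a obtain ys where ys: "negon ip ys" "set ys \<subseteq> cspan sc P" "length ys = k" by auto
  from cspan_finite_support_list[OF ys(2)] obtain xs where xs: "set xs \<subseteq> P" "set ys \<subseteq> cspan sc (set xs)" by auto
  from negdef_length_le[OF negon_imp_negdef[OF ys(1)] xs(2)] le[OF xs(1)] ys(3) xs(1) le
  show "neg_squares ip P k" unfolding neg_squares_def by (metis le_antisym)
qed

end

section \<open>Hilbert spaces\<close>

locale hilb =
  fixes sc :: "complex \<Rightarrow> 'a::ab_group_add \<Rightarrow> 'a" and ip :: "'a \<Rightarrow> 'a \<Rightarrow> complex"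
  assumes hilbert: "hilbert sc ip"
begin

sublocale herm_space sc ip
  using hilbert by unfold_locales (simp add: hilbert_def hilbert_on_def)

abbreviation nrm :: "'a \<Rightarrow> real" where "nrm \<equiv> ipnorm ip"

lemma ip_self_nonneg: "Re (ip x x) \<ge> 0"
  and ip_self_eq_0: "ip x x = 0 \<Longrightarrow> x = 0"
  using hilbert by (auto simp: hilbert_def hilbert_on_def)

lemma nrm_complete:
  fixes s :: "nat \<Rightarrow> 'a"
  assumes "\<And>e. e > 0 \<Longrightarrow> \<exists>N. \<forall>m\<ge>N. \<forall>n\<ge>N. nrm (s m - s n) < e"
  shows "\<exists>l. (\<lambda>n. nrm (s n - l)) \<longlonglongrightarrow> 0"
  using hilbert assms unfolding hilbert_def hilbert_on_def by simp

lemma nrm_nonneg [simp]: "nrm x \<ge> 0"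
  using ip_self_nonneg by (simp add: ipnorm_def)

lemma nrm_power2: "(nrm x)\<^sup>2 = Re (ip x x)"
  using ip_self_nonneg by (simp add: ipnorm_def)

lemma ip_self: "ip x x = of_real ((nrm x)\<^sup>2)"
  unfolding nrm_power2 by (rule ip_self_real)

lemma nrm_zero [simp]: "nrm 0 = 0"
  by (simp add: ipnorm_def)

lemma nrm_eq_0 [simp]: "nrm x = 0 \<longleftrightarrow> x = 0"
  using ip_self[of x] ip_self_eq_0[of x] by auto

lemma nrm_scale: "nrm (sc c x) = cmod c * nrm x"
proof -
  have "ip (sc c x) (sc c x) = c * cnj c * ip x x" by (simp add: ip_simps)
  also have "\<dots> = of_real ((cmod c * nrm x)\<^sup>2)"
    by (simp only: ip_self[of x] power_mult_distrib of_real_mult complex_norm_square)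
  finally have "ip (sc c x) (sc c x) = of_real ((cmod c * nrm x)\<^sup>2)" .
  hence "(nrm (sc c x))\<^sup>2 = (cmod c * nrm x)\<^sup>2" by (simp add: nrm_power2)
  thus ?thesis by (simp add: power2_eq_iff_nonneg)
qed

lemma nrm_minus [simp]: "nrm (- x) = nrm x"
  by (simp add: ipnorm_def ip_simps)

lemma nrm_minus_commute: "nrm (x - y) = nrm (y - x)"
  using nrm_minus[of "x - y"] by simp

text \<open>Pythagoras for the component of x orthogonal to y. It yields Cauchy-Schwarz and, in the
  projection theorem, the orthogonality of the minimizer.\<close>

lemma nrm_orthogonalize:
  assumes "y \<noteq> 0"
  shows "(nrm (x - sc (ip x y / ip y y) y))\<^sup>2 = (nrm x)\<^sup>2 - (cmod (ip x y) / nrm y)\<^sup>2"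
proof -
  have y: "nrm y \<noteq> 0" "ip y y \<noteq> 0" using assms ip_self_eq_0 by auto
  let ?t = "ip x y / ip y y"
  have c: "ip y x = cnj (ip x y)" by (rule ip_cnj)
  have e: "ip (x - sc ?t y) (x - sc ?t y) = ip x x - ip x y * cnj (ip x y) / ip y y"
    using y by (simp add: ip_simps c ip_self[of y] field_simps power2_eq_square)
  also have "\<dots> = of_real ((nrm x)\<^sup>2 - (cmod (ip x y) / nrm y)\<^sup>2)"
    by (simp only: ip_self of_real_diff power_divide of_real_divide complex_norm_square)
  finally show ?thesis by (simp add: nrm_power2)
qed

lemma cauchy_schwarz: "cmod (ip x y) \<le> nrm x * nrm y"
proof (cases "y = 0")
  case False
  hence y: "nrm y > 0" using nrm_eq_0[of y] nrm_nonneg[of y] by linarith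
  have "0 \<le> (nrm (x - sc (ip x y / ip y y) y))\<^sup>2" by simp
  hence "(cmod (ip x y) / nrm y)\<^sup>2 \<le> (nrm x)\<^sup>2" unfolding nrm_orthogonalize[OF False] by simp
  hence "cmod (ip x y) / nrm y \<le> nrm x" by (rule power2_le_imp_le) simp
  thus ?thesis using y by (simp add: field_simps)
qed simp

lemma nrm_triangle: "nrm (x + y) \<le> nrm x + nrm y"
proof (rule power2_le_imp_le)
  have "(nrm (x + y))\<^sup>2 = (nrm x)\<^sup>2 + (nrm y)\<^sup>2 + 2 * Re (ip x y)"
    using ip_cnj[of x y] by (simp add: nrm_power2 ip_simps)
  also have "\<dots> \<le> (nrm x)\<^sup>2 + (nrm y)\<^sup>2 + 2 * (nrm x * nrm y)"
    using cauchy_schwarz[of x y] complex_Re_le_cmod[of "ip x y"] by linarith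
  finally show "(nrm (x + y))\<^sup>2 \<le> (nrm x + nrm y)\<^sup>2" by (simp add: power2_sum)
qed simp

lemma nrm_triangle3: "nrm (x - z) \<le> nrm (x - y) + nrm (y - z)"
  using nrm_triangle[of "x - y" "y - z"] by simp

lemma nrm_triangle_rev: "nrm x \<le> nrm y + nrm (x - y)"
  using nrm_triangle[of y "x - y"] by simp

lemma parallelogram: "(nrm (x + y))\<^sup>2 + (nrm (x - y))\<^sup>2 = 2 * (nrm x)\<^sup>2 + 2 * (nrm y)\<^sup>2"
  by (simp add: nrm_power2 ip_simps)

section \<open>Closure, orthogonal projection and the Riesz theorem\<close>

definition clos :: "'a set \<Rightarrow> 'a set" where
  "clos S = {x. \<forall>e>0. \<exists>y\<in>S. nrm (x - y) < e}"

lemma clos_superset: "S \<subseteq> clos S"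
  unfolding clos_def by (auto intro!: bexI)

lemma clos_mono: "S \<subseteq> T \<Longrightarrow> clos S \<subseteq> clos T"
  unfolding clos_def by blast

lemma clos_idem: "clos (clos S) \<subseteq> clos S"
proof
  fix x assume x: "x \<in> clos (clos S)"
  show "x \<in> clos S" unfolding clos_def
  proof (intro CollectI allI impI)
    fix e :: real assume "e > 0"
    hence e: "e/2 > 0" by simp
    have cl: "\<exists>y\<in>T. nrm (x - y) < e/2" if "x \<in> clos T" for x T
      using that e unfolding clos_def by blast
    from cl[OF x] obtain y where y: "y \<in> clos S" "nrm (x - y) < e/2" by blast
    from cl[OF y(1)] obtain z where "z \<in> S" "nrm (y - z) < e/2" by blast
    with y nrm_triangle3[of x z y] show "\<exists>y\<in>S. nrm (x - y) < e" by (intro bexI[of _ z]) auto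
  qed
qed

lemma limit_in_clos:
  assumes "\<And>n. s n \<in> S" "(\<lambda>n. nrm (s n - l)) \<longlonglongrightarrow> 0"
  shows "l \<in> clos S"
  unfolding clos_def
proof (intro CollectI allI impI)
  fix e :: real assume "e > 0"
  then obtain n where "nrm (s n - l) < e"
    using LIMSEQ_D[OF assms(2), of e] by auto
  thus "\<exists>y\<in>S. nrm (l - y) < e" using assms(1)[of n] by (auto simp: nrm_minus_commute)
qed

lemma csubspace_clos:
  assumes S: "csubspace sc S"
  shows "csubspace sc (clos S)"
  unfolding csubspace_def
proof (intro conjI ballI allI)
  show "0 \<in> clos S" using csubspaceD(1)[OF S] clos_superset by blast
next
  fix x y assume x: "x \<in> clos S" and y: "y \<in> clos S"
  show "x + y \<in> clos S" unfolding clos_def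
  proof (intro CollectI allI impI)
    fix e :: real assume "e > 0"
    hence e: "e/2 > 0" by simp
    from x e obtain u where u: "u \<in> S" "nrm (x - u) < e/2" unfolding clos_def by blast
    from y e obtain v where v: "v \<in> S" "nrm (y - v) < e/2" unfolding clos_def by blast
    have "nrm (x + y - (u + v)) \<le> nrm (x - u) + nrm (y - v)"
      using nrm_triangle[of "x - u" "y - v"] by (simp add: algebra_simps)
    thus "\<exists>z\<in>S. nrm (x + y - z) < e"
      using u v csubspaceD(2)[OF S u(1) v(1)] by (intro bexI[of _ "u + v"]) auto
  qed
next
  fix c x assume x: "x \<in> clos S"
  show "sc c x \<in> clos S" unfolding clos_def
  proof (intro CollectI allI impI)
    fix e :: real assume e: "e > 0"
    hence "e / (cmod c + 1) > 0" by (simp add: add_nonneg_pos)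
    with x obtain u where u: "u \<in> S" "nrm (x - u) < e / (cmod c + 1)" unfolding clos_def by blast
    have "nrm (sc c x - sc c u) = cmod c * nrm (x - u)"
      by (simp flip: vs.scale_right_diff_distrib add: nrm_scale)
    also have "\<dots> \<le> (cmod c + 1) * nrm (x - u)" by (simp add: mult_right_mono)
    also have "\<dots> < e"
      using u(2) pos_less_divide_eq[of "cmod c + 1" "nrm (x - u)" e] by (simp add: add_nonneg_pos mult.commute)
    finally show "\<exists>z\<in>S. nrm (sc c x - z) < e"
      using csubspaceD(3)[OF S u(1)] by (intro bexI[of _ "sc c u"]) auto
  qed
qed

theorem orthogonal_projection:
  assumes V: "csubspace sc V" and cl: "clos V \<subseteq> V"
  shows "\<exists>v\<in>V. \<forall>u\<in>V. ip (x - v) u = 0"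
proof -
  define D where "D = {(nrm (x - v))\<^sup>2 | v. v \<in> V}"
  define d where "d = Inf D"
  have bdd: "bdd_below D" unfolding D_def by (rule bdd_belowI[of _ 0]) auto
  have ne: "D \<noteq> {}" unfolding D_def using csubspaceD(1)[OF V] by auto
  have dle: "d \<le> (nrm (x - v))\<^sup>2" if "v \<in> V" for v
    unfolding d_def by (rule cInf_lower[OF _ bdd]) (use that in \<open>auto simp: D_def\<close>)
  have "\<exists>v\<in>V. (nrm (x - v))\<^sup>2 < d + 1 / real (Suc n)" for n
  proof -
    have "Inf D < d + 1 / real (Suc n)" by (simp add: d_def)
    then obtain a where "a \<in> D" "a < d + 1 / real (Suc n)" using cInf_lessD[OF ne] by blast
    thus ?thesis by (auto simp: D_def)
  qed
  then obtain v where vV: "\<And>n. v n \<in> V" and vd: "\<And>n. (nrm (x - v n))\<^sup>2 < d + 1 / real (Suc n)" by metis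
  have close: "(nrm (v m - v n))\<^sup>2 \<le> 2 / real (Suc m) + 2 / real (Suc n)" for m n
  proof -
    \<comment> \<open>The midpoint lies in V, so its squared distance from x is at least d; the
      parallelogram law then makes a minimizing sequence Cauchy.\<close>
    have w: "sc (1/2) (v m + v n) \<in> V" by (intro csubspaceD[OF V] vV)
    have two: "sc 2 y = y + y" for y using vs.scale_left_distrib[of 1 1 y] by simp
    have "(x - v n) + (x - v m) = sc 2 (x - sc (1/2) (v m + v n))"
      by (simp only: vs.scale_right_diff_distrib vs.scale_scale) (simp add: two algebra_simps)
    hence "(nrm ((x - v n) + (x - v m)))\<^sup>2 = 4 * (nrm (x - sc (1/2) (v m + v n)))\<^sup>2"
      by (simp add: nrm_scale power_mult_distrib)
    moreover have "(x - v n) - (x - v m) = v m - v n" by simp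
    ultimately have "(nrm (v m - v n))\<^sup>2 = 2 * (nrm (x - v n))\<^sup>2 + 2 * (nrm (x - v m))\<^sup>2
      - 4 * (nrm (x - sc (1/2) (v m + v n)))\<^sup>2"
      using parallelogram[of "x - v n" "x - v m"] by simp
    moreover have "2 / real (Suc m) = 2 * (1 / real (Suc m))" "2 / real (Suc n) = 2 * (1 / real (Suc n))"
      by simp_all
    ultimately show ?thesis using dle[OF w] vd[of m] vd[of n] by linarith
  qed
  have "\<exists>N. \<forall>m\<ge>N. \<forall>n\<ge>N. nrm (v m - v n) < e" if e: "e > 0" for e
  proof -
    obtain N where N: "4 / e\<^sup>2 < real N" using reals_Archimedean2 by blast
    have "nrm (v m - v n) < e" if "m \<ge> N" "n \<ge> N" for m n
    proof (rule power2_less_imp_less)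
      have "real N > 0" using N e by (smt (verit) zero_less_divide_iff zero_less_power)
      hence "2 / real (Suc m) \<le> 2 / real N" "2 / real (Suc n) \<le> 2 / real N"
        using that by (auto intro!: divide_left_mono)
      moreover have "4 / real N < e\<^sup>2" using N e \<open>real N > 0\<close> by (simp add: field_simps)
      ultimately show "(nrm (v m - v n))\<^sup>2 < e\<^sup>2" using close[of m n] by simp
    qed (use e in auto)
    thus ?thesis by blast
  qed
  from nrm_complete[OF this] obtain l where l: "(\<lambda>n. nrm (v n - l)) \<longlonglongrightarrow> 0" by blast
  have lV: "l \<in> V" using limit_in_clos[OF vV l] cl by blast
  have "(\<lambda>n. sqrt (d + 1 / real (Suc n)) + nrm (v n - l)) \<longlonglongrightarrow> sqrt (d + 0) + 0"
    by (intro tendsto_intros l LIMSEQ_inverse_real_of_nat[unfolded inverse_eq_divide])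
  moreover have "nrm (x - l) \<le> sqrt (d + 1 / real (Suc n)) + nrm (v n - l)" for n
    using nrm_triangle3[of x l "v n"] real_less_rsqrt[OF vd[of n]] by linarith
  ultimately have "nrm (x - l) \<le> sqrt d" by (auto intro: LIMSEQ_le_const)
  moreover have "d \<ge> 0" unfolding d_def by (rule cInf_greatest[OF ne]) (auto simp: D_def)
  ultimately have ld: "(nrm (x - l))\<^sup>2 \<le> d" by (metis nrm_nonneg power_mono real_sqrt_pow2)
  have "ip (x - l) u = 0" if u: "u \<in> V" for u
  proof (cases "u = 0")
    case False
    \<comment> \<open>If the product with u were nonzero, the competitor l + c u would be strictly
      closer to x than l.\<close>
    let ?c = "ip (x - l) u / ip u u"
    have "l + sc ?c u \<in> V" by (intro csubspaceD[OF V] lV u)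
    from dle[OF this] have "d \<le> (nrm (x - l - sc ?c u))\<^sup>2" by (simp add: diff_diff_eq)
    with ld have "(cmod (ip (x - l) u) / nrm u)\<^sup>2 \<le> 0" unfolding nrm_orthogonalize[OF False] by linarith
    thus ?thesis using False by simp
  qed simp
  thus ?thesis using lV by blast
qed

text \<open>The representing vector is a multiple of a vector orthogonal to the kernel of f.
  Boundedness makes that kernel closed, so the projection theorem supplies such a vector.\<close>

theorem riesz_representation:
  assumes add: "\<And>x y. f (x + y) = f x + f y" and scale: "\<And>c x. f (sc c x) = c * f x"
    and bd: "\<And>x. cmod (f x) \<le> C * nrm x"
  shows "\<exists>y. \<forall>x. f x = ip x y"
proof (cases "\<forall>x. f x = 0")
  case False
  then obtain x where x: "f x \<noteq> 0" by auto
  let ?V = "{x. f x = 0}"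
  have f0: "f 0 = 0" using scale[of 0 0] by simp
  have diff: "f (x - y) = f x - f y" for x y
    using add[of "x - y" y] by simp
  have V: "csubspace sc ?V" by (auto simp: csubspace_def add scale f0)
  have "clos ?V \<subseteq> ?V"
  proof
    fix z assume z: "z \<in> clos ?V"
    have "cmod (f z) \<le> e" if e: "e > 0" for e
    proof -
      have "e / (\<bar>C\<bar> + 1) > 0" using e by (simp add: add_nonneg_pos)
      then obtain y where y: "f y = 0" "nrm (z - y) < e / (\<bar>C\<bar> + 1)" using z unfolding clos_def by blast
      have "cmod (f z) = cmod (f (z - y))" using y by (simp add: diff)
      also have "\<dots> \<le> C * nrm (z - y)" by (rule bd)
      also have "\<dots> \<le> (\<bar>C\<bar> + 1) * nrm (z - y)" by (intro mult_right_mono) auto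
      also have "\<dots> \<le> e"
        using y(2) pos_less_divide_eq[of "\<bar>C\<bar> + 1" "nrm (z - y)" e] by (simp add: add_nonneg_pos mult.commute)
      finally show ?thesis .
    qed
    hence "cmod (f z) \<le> 0" using field_le_epsilon[of "cmod (f z)" 0] by auto
    thus "z \<in> ?V" by simp
  qed
  from orthogonal_projection[OF V this, of x] obtain v where
    v: "f v = 0" "\<And>u. f u = 0 \<Longrightarrow> ip (x - v) u = 0" by auto
  define z where "z = x - v"
  have fz: "f z \<noteq> 0" using x v(1) by (simp add: z_def diff)
  hence "z \<noteq> 0" using f0 by auto
  hence zz: "ip z z \<noteq> 0" using ip_self_eq_0 by blast
  have "f y = ip y (sc (cnj (f z) / cnj (ip z z)) z)" for y
  proof -
    have "f (y - sc (f y / f z) z) = 0" using fz by (simp add: diff scale)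
    hence "ip z (y - sc (f y / f z) z) = 0" using v(2) unfolding z_def by blast
    hence "ip (y - sc (f y / f z) z) z = 0" using ip_cnj[of z "y - sc (f y / f z) z"] by simp
    hence "ip y z = f y / f z * ip z z" by (simp add: ip_simps)
    thus ?thesis using fz zz by (simp add: ip_simps field_simps)
  qed
  thus ?thesis by blast
qed (auto intro!: exI[of _ 0])

lemma dense_if_trivial_complement:
  assumes S: "csubspace sc S" and o: "\<And>x. (\<And>s. s \<in> S \<Longrightarrow> ip x s = 0) \<Longrightarrow> x = 0"
  shows "clos S = UNIV"
proof -
  have "x \<in> clos S" for x
  proof -
    from orthogonal_projection[OF csubspace_clos[OF S] clos_idem, of x] obtain v where
      v: "v \<in> clos S" "\<And>u. u \<in> clos S \<Longrightarrow> ip (x - v) u = 0" by auto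
    have "x - v = 0" by (rule o) (use v(2) clos_superset in blast)
    with v(1) show ?thesis by simp
  qed
  thus ?thesis by blast
qed

section \<open>Geometric convergence, with the Hellinger-Toeplitz theorem and the Neumann
  series\<close>

lemma le_nrm_diff_limit:
  assumes l: "(\<lambda>n. nrm (s n - l)) \<longlonglongrightarrow> 0" and b: "\<And>m. m \<ge> n \<Longrightarrow> nrm (s m - y) \<le> r"
  shows "nrm (l - y) \<le> r"
proof -
  have "(\<lambda>m. nrm (s m - l) + r) \<longlonglongrightarrow> 0 + r" by (intro tendsto_intros l)
  moreover have "nrm (l - y) \<le> nrm (s m - l) + r" if "m \<ge> n" for m
    using nrm_triangle3[of l y "s m"] b[OF that] nrm_minus_commute[of l "s m"] by linarith
  ultimately show ?thesis by (auto intro!: LIMSEQ_le_const)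
qed

text \<open>The step bounds telescope to c / (1 - q) times a difference of powers of q. The explicit
  tail estimate is for the gliding hump; \<open>neumann\<close> takes only the limit from
  here.\<close>

lemma geometric_limit:
  assumes q: "0 \<le> q" "q < 1" and step: "\<And>n. nrm (s (Suc n) - s n) \<le> c * q ^ n"
  shows "\<exists>l. (\<lambda>n. nrm (s n - l)) \<longlonglongrightarrow> 0 \<and> (\<forall>n. nrm (l - s n) \<le> c / (1 - q) * q ^ n)"
proof -
  have c: "c \<ge> 0" using step[of 0] order_trans[OF nrm_nonneg step[of 0]] by simp
  have cau: "nrm (s m - s n) \<le> c / (1 - q) * q ^ n" if "m \<ge> n" for m n
  proof -
    have "nrm (s m - s n) \<le> c / (1 - q) * (q ^ n - q ^ m)" using that
    proof (induction m rule: dec_induct)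
      case (step k)
      have "nrm (s (Suc k) - s n) \<le> nrm (s (Suc k) - s k) + nrm (s k - s n)" by (rule nrm_triangle3)
      also have "\<dots> \<le> c * q ^ k + c / (1 - q) * (q ^ n - q ^ k)" using assms(3)[of k] step.IH by linarith
      also have "\<dots> = c / (1 - q) * (q ^ n - q ^ Suc k)" using q by (simp add: field_simps)
      finally show ?case .
    qed simp
    also have "\<dots> \<le> c / (1 - q) * q ^ n" using q c by (intro mult_left_mono) auto
    finally show ?thesis .
  qed
  have "\<exists>N. \<forall>m\<ge>N. \<forall>n\<ge>N. nrm (s m - s n) < e" if e: "e > 0" for e
  proof -
    have "(\<lambda>n. c / (1 - q) * q ^ n) \<longlonglongrightarrow> c / (1 - q) * 0"
      using q by (intro tendsto_intros LIMSEQ_realpow_zero) auto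
    hence "(\<lambda>n. c / (1 - q) * q ^ n) \<longlonglongrightarrow> 0" by simp
    from LIMSEQ_D[OF this e] obtain N where N: "\<And>n. n \<ge> N \<Longrightarrow> \<bar>c / (1 - q) * q ^ n\<bar> < e" by auto
    have "nrm (s m - s n) < e" if "m \<ge> N" "n \<ge> N" for m n
    proof (cases "m \<ge> n")
      case True
      thus ?thesis using cau[OF True] N[OF that(2)] by linarith
    next
      case False
      hence "n \<ge> m" by simp
      from cau[OF this] N[OF that(1)] nrm_minus_commute[of "s m" "s n"] show ?thesis by linarith
    qed
    thus ?thesis by blast
  qed
  from nrm_complete[OF this] obtain l where l: "(\<lambda>n. nrm (s n - l)) \<longlonglongrightarrow> 0" by blast
  moreover have "nrm (l - s n) \<le> c / (1 - q) * q ^ n" for n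
    by (rule le_nrm_diff_limit[OF l cau])
  ultimately show ?thesis by blast
qed

text \<open>A gliding hump: the steps \<open>\<plusminus> t n / 3 ^ n\<close> are chosen so that the functional
  \<open>ip (_) (T' (y n))\<close> is large at the limit of the partial sums.\<close>

lemma hellinger_toeplitz_adjoint:
  assumes adj: "\<And>x y. ip (T x) y = ip x (T' y)"
  shows "\<exists>C. \<forall>y. nrm (T' y) \<le> C * nrm y"
proof (rule ccontr)
  assume "\<not> ?thesis"
  hence "\<forall>n::nat. \<exists>y. 4 ^ n * nrm y < nrm (T' y)" by (meson not_le)
  then obtain y where y: "\<And>n. 4 ^ n * nrm (y n) < nrm (T' (y n))" by metis
  have pos: "nrm (T' (y n)) > 0" for n
    by (rule le_less_trans[OF _ y[of n]]) simp
  have nz: "T' (y n) \<noteq> 0" for n using pos[of n] by auto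
  define t where "t n = sc (of_real (1 / (3 ^ n * nrm (T' (y n))))) (T' (y n))" for n
  have nt: "nrm (t n) = 1 / 3 ^ n" for n
    using pos[of n] nz[of n] by (simp add: t_def nrm_scale norm_divide norm_mult norm_power)
  define x where "x = rec_nat 0 (\<lambda>n v. if cmod (ip (v + t n) (T' (y n))) \<ge> nrm (T' (y n)) / 3 ^ n
      then v + t n else v - t n)"
  have x0: "x 0 = 0" and xS: "x (Suc n) = (if cmod (ip (x n + t n) (T' (y n))) \<ge> nrm (T' (y n)) / 3 ^ n
      then x n + t n else x n - t n)" for n
    by (auto simp: x_def)
  have big: "cmod (ip (x (Suc n)) (T' (y n))) \<ge> nrm (T' (y n)) / 3 ^ n" for n
  proof (cases "cmod (ip (x n + t n) (T' (y n))) \<ge> nrm (T' (y n)) / 3 ^ n")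
    case False
    have "ip (t n) (T' (y n)) = of_real (nrm (T' (y n)) / 3 ^ n)"
      using pos[of n] nz[of n] by (simp add: t_def ip_simps ip_self power2_eq_square)
    hence "cmod (ip (t n) (T' (y n))) = nrm (T' (y n)) / 3 ^ n" using pos[of n] by (simp only: norm_of_real) simp
    moreover have "2 * ip (t n) (T' (y n)) = ip (x n + t n) (T' (y n)) - ip (x n - t n) (T' (y n))"
      by (simp add: ip_simps)
    hence "2 * cmod (ip (t n) (T' (y n))) \<le> cmod (ip (x n + t n) (T' (y n))) + cmod (ip (x n - t n) (T' (y n)))"
      by (metis norm_mult norm_numeral norm_triangle_ineq4)
    ultimately show ?thesis using False by (simp add: xS)
  qed (simp add: xS)
  have step: "nrm (x (Suc n) - x n) = 1 / 3 ^ n" for n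
    by (simp add: xS nt)
  have "\<exists>l. (\<lambda>n. nrm (x n - l)) \<longlonglongrightarrow> 0 \<and> (\<forall>n. nrm (l - x n) \<le> 1 / (1 - 1/3) * (1/3) ^ n)"
    by (rule geometric_limit) (simp_all add: step power_one_over)
  then obtain l where lx: "\<And>n. nrm (l - x n) \<le> 3/2 * (1 / 3 ^ n)" by (auto simp: power_one_over)
  have "(4/3) ^ n \<le> 2 * nrm (T l)" for n
  proof -
    have "nrm (T' (y n)) / 3 ^ n \<le> cmod (ip (x (Suc n)) (T' (y n)))" by (rule big)
    also have "ip (x (Suc n)) (T' (y n)) = ip l (T' (y n)) - ip (l - x (Suc n)) (T' (y n))"
      by (simp add: ip_simps)
    also have "cmod \<dots> \<le> cmod (ip l (T' (y n))) + cmod (ip (l - x (Suc n)) (T' (y n)))"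
      by (rule norm_triangle_ineq4)
    also have "cmod (ip (l - x (Suc n)) (T' (y n))) \<le> nrm (l - x (Suc n)) * nrm (T' (y n))"
      by (rule cauchy_schwarz)
    \<comment> \<open>The tail after step n is at most (3/2) 3^-(n+1), which is half of 3^-n, so
      half of the hump survives in the limit l.\<close>
    also have "\<dots> \<le> 3/2 * (1 / 3 ^ Suc n) * nrm (T' (y n))" by (intro mult_right_mono lx) simp
    also have "ip l (T' (y n)) = ip (T l) (y n)" by (simp add: adj)
    also have "cmod (ip (T l) (y n)) \<le> nrm (T l) * nrm (y n)" by (rule cauchy_schwarz)
    also have "\<dots> \<le> nrm (T l) * (nrm (T' (y n)) / 4 ^ n)"
      using y[of n] by (intro mult_left_mono) (auto simp: field_simps)
    finally have "nrm (T' (y n)) * (1 / (2 * 3 ^ n)) \<le> nrm (T' (y n)) * (nrm (T l) / 4 ^ n)"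
      by (simp add: field_simps)
    hence "1 / (2 * 3 ^ n) \<le> nrm (T l) / 4 ^ n" using pos[of n] mult_le_cancel_left_pos by blast
    thus ?thesis by (simp add: field_simps power_divide)
  qed
  moreover obtain n where "2 * nrm (T l) < (4/3) ^ n" using real_arch_pow[of "4/3" "2 * nrm (T l)"] by auto
  ultimately show False by (meson not_le)
qed

text \<open>If T' is an adjoint of T, then T is an adjoint of T', so the preceding bound on adjoints
  applies to T itself.\<close>

theorem hellinger_toeplitz:
  assumes adj: "\<And>x y. ip (T x) y = ip x (T' y)"
  shows "\<exists>C\<ge>0. \<forall>y. nrm (T y) \<le> C * nrm y"
proof -
  have "ip (T' x) y = ip x (T y)" for x y
    by (metis adj ip_cnj)
  from hellinger_toeplitz_adjoint[OF this] obtain C where C: "\<And>y. nrm (T y) \<le> C * nrm y" by auto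
  have "nrm (T y) \<le> \<bar>C\<bar> * nrm y" for y
    using C[of y] mult_right_mono[OF abs_ge_self[of C] nrm_nonneg[of y]] by linarith
  thus ?thesis by (intro exI[of _ "\<bar>C\<bar>"]) auto
qed

text \<open>The equation is solved by iterating s (n+1) = y + B (s n) inside the closed subspace V,
  because B is controlled on V only. Openness of the resolvent set rests on it.\<close>

theorem neumann:
  assumes V: "csubspace sc V" "clos V \<subseteq> V" and BV: "\<And>x. x \<in> V \<Longrightarrow> B x \<in> V"
    and lin: "\<And>x y. x \<in> V \<Longrightarrow> y \<in> V \<Longrightarrow> B (x - y) = B x - B y"
    and bd: "\<And>x. x \<in> V \<Longrightarrow> nrm (B x) \<le> q * nrm x" and q: "0 \<le> q" "q < 1" and y: "y \<in> V"
  shows "\<exists>x\<in>V. x - B x = y"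
proof -
  define s where "s = rec_nat y (\<lambda>_ v. y + B v)"
  have s0: "s 0 = y" and sS: "s (Suc n) = y + B (s n)" for n by (auto simp: s_def)
  have sV: "s n \<in> V" for n by (induction n) (auto simp: s0 sS y BV csubspaceD[OF V(1)])
  have dV: "s m - s n \<in> V" for m n by (rule csubspace_diff[OF V(1) sV sV])
  let ?c = "nrm (B y)"
  have st: "nrm (s (Suc n) - s n) \<le> q ^ n * ?c" for n
  proof (induction n)
    case (Suc n)
    have "s (Suc (Suc n)) - s (Suc n) = (y + B (s (Suc n))) - (y + B (s n))"
      by (simp only: sS[of "Suc n"] sS[of n])
    also have "\<dots> = B (s (Suc n) - s n)" using lin[OF sV sV] by simp
    finally have "nrm (s (Suc (Suc n)) - s (Suc n)) = nrm (B (s (Suc n) - s n))" by simp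
    also have "\<dots> \<le> q * nrm (s (Suc n) - s n)" by (rule bd[OF dV])
    also have "\<dots> \<le> q ^ Suc n * ?c" using mult_left_mono[OF Suc.IH q(1)] by (simp add: mult.assoc)
    finally show ?case .
  qed (simp add: s0 sS)
  obtain l where l: "(\<lambda>n. nrm (s n - l)) \<longlonglongrightarrow> 0"
    using geometric_limit[OF q, of s ?c] st by (auto simp: mult.commute)
  have lV: "l \<in> V" using limit_in_clos[OF sV l] V(2) by blast
  have "nrm (l - (y + B l)) \<le> 0"
  proof (rule LIMSEQ_le_const)
    show "(\<lambda>n. nrm (s (Suc n) - l) + q * nrm (s n - l)) \<longlonglongrightarrow> 0"
      using tendsto_add[OF LIMSEQ_Suc[OF l] tendsto_mult_left[OF l, of q]] by simp
    have "nrm (l - (y + B l)) \<le> nrm (s (Suc n) - l) + q * nrm (s n - l)" for n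
    proof -
      have "nrm (l - (y + B l)) \<le> nrm (l - s (Suc n)) + nrm (s (Suc n) - (y + B l))" by (rule nrm_triangle3)
      also have "s (Suc n) - (y + B l) = B (s n - l)" by (simp add: sS lin sV lV)
      also have "nrm (B (s n - l)) \<le> q * nrm (s n - l)" by (rule bd[OF csubspace_diff[OF V(1) sV lV]])
      finally show ?thesis by (simp add: nrm_minus_commute)
    qed
    thus "\<exists>N. \<forall>n\<ge>N. nrm (l - (y + B l)) \<le> nrm (s (Suc n) - l) + q * nrm (s n - l)" by blast
  qed
  hence "l - (y + B l) = 0" using nrm_eq_0 nrm_nonneg by (metis antisym)
  hence "l - B l = y" by (simp add: algebra_simps)
  thus ?thesis using lV by blast
qed

end

section \<open>Bounded operators, the operator norm and adjoints\<close>

context hilb begin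

lemma opnorm_bdd:
  assumes "bop sc ip T"
  shows "bdd_above {nrm (T h) | h. nrm h \<le> 1}"
proof -
  obtain C where C: "\<And>h. nrm (T h) \<le> C * nrm h" using assms by (auto simp: bop_def)
  have "nrm (T h) \<le> \<bar>C\<bar>" if "nrm h \<le> 1" for h
  proof -
    have "nrm (T h) \<le> C * nrm h" by (rule C)
    also have "\<dots> \<le> \<bar>C\<bar> * nrm h" by (intro mult_right_mono) auto
    also have "\<dots> \<le> \<bar>C\<bar> * 1" using that by (intro mult_left_mono) auto
    finally show ?thesis by simp
  qed
  thus ?thesis by (intro bdd_aboveI[of _ "\<bar>C\<bar>"]) auto
qed

lemma opnorm_nonneg:
  assumes "bop sc ip T"
  shows "opnorm ip T \<ge> 0"
proof -
  have "nrm (T 0) \<le> opnorm ip T"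
    unfolding opnorm_def by (rule cSup_upper[OF _ opnorm_bdd[OF assms]]) (auto intro!: exI[of _ 0])
  thus ?thesis using nrm_nonneg[of "T 0"] by linarith
qed

lemma opnorm_apply:
  assumes T: "bop sc ip T"
  shows "nrm (T h) \<le> opnorm ip T * nrm h"
proof (cases "h = 0")
  case True
  have "T 0 = 0" using T unfolding bop_def clinear_def by (metis vs.scale_zero_left)
  with True show ?thesis by simp
next
  case False
  hence p: "nrm h > 0" using nrm_eq_0[of h] nrm_nonneg[of h] by linarith
  let ?c = "of_real (1 / nrm h) :: complex"
  have n1: "nrm (sc ?c h) \<le> 1" using p by (simp add: nrm_scale norm_divide)
  have "nrm (T (sc ?c h)) \<le> opnorm ip T"
    unfolding opnorm_def by (rule cSup_upper[OF _ opnorm_bdd[OF T]]) (use n1 in blast)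
  moreover have "T (sc ?c h) = sc ?c (T h)" using T unfolding bop_def clinear_def by blast
  ultimately have "1 / nrm h * nrm (T h) \<le> opnorm ip T" using p by (simp add: nrm_scale norm_divide)
  thus ?thesis using p by (simp add: field_simps)
qed

lemma opnorm_le:
  assumes "\<And>h. nrm (T h) \<le> C * nrm h" "C \<ge> 0"
  shows "opnorm ip T \<le> C"
  unfolding opnorm_def
proof (rule cSup_least)
  show "{nrm (T h) | h. nrm h \<le> 1} \<noteq> {}" by (auto intro!: exI[of _ 0])
  fix x assume "x \<in> {nrm (T h) | h. nrm h \<le> 1}"
  then obtain h where h: "x = nrm (T h)" "nrm h \<le> 1" by auto
  have "x \<le> C * nrm h" using assms h by auto
  also have "\<dots> \<le> C * 1" using h assms by (intro mult_left_mono) auto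
  finally show "x \<le> C" by simp
qed

lemma bopI:
  assumes "\<And>x y. T (x + y) = T x + T y" "\<And>c x. T (sc c x) = sc c (T x)" "\<And>h. nrm (T h) \<le> C * nrm h"
  shows "bop sc ip T"
  using assms unfolding bop_def clinear_def by blast

lemma bopD:
  assumes "bop sc ip T"
  shows "T (x + y) = T x + T y" "T (sc c x) = sc c (T x)" "T (x - y) = T x - T y" "T 0 = 0"
proof -
  show a: "T (x + y) = T x + T y" "T (sc c x) = sc c (T x)" for x y c
    using assms unfolding bop_def clinear_def by blast+
  show "T (x - y) = T x - T y" using a(1)[of "x - y" y] by simp
  show "T 0 = 0" using a(1)[of 0 0] by simp
qed

lemma bop_scale: "bop sc ip T \<Longrightarrow> bop sc ip (\<lambda>h. sc c (T h))"
proof (rule bopI[of _ "cmod c * opnorm ip T"])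
  fix h assume T: "bop sc ip T"
  show "nrm (sc c (T h)) \<le> cmod c * opnorm ip T * nrm h"
    using mult_left_mono[OF opnorm_apply[OF T, of h], of "cmod c"] by (simp add: nrm_scale mult.assoc)
qed (auto simp: bopD vs.scale_right_distrib mult.commute)

lemma bop_add:
  assumes S: "bop sc ip S" and T: "bop sc ip T"
  shows "bop sc ip (\<lambda>h. S h + T h)"
proof (rule bopI[of _ "opnorm ip S + opnorm ip T"])
  fix h
  show "nrm (S h + T h) \<le> (opnorm ip S + opnorm ip T) * nrm h"
    using nrm_triangle[of "S h" "T h"] opnorm_apply[OF S, of h] opnorm_apply[OF T, of h]
    by (simp add: distrib_right)
qed (use bopD[OF S] bopD[OF T] in \<open>auto simp: vs.scale_right_distrib\<close>)

lemma bop_diff: "bop sc ip S \<Longrightarrow> bop sc ip T \<Longrightarrow> bop sc ip (\<lambda>h. S h - T h)"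
  using bop_add[of S "\<lambda>h. sc (-1) (T h)"] bop_scale[of T "-1"] by simp

text \<open>The limits in \<open>holo_at\<close> and \<open>pole_at\<close> concern a supremum. A
  pointwise bound by g settles them, with \<open>bop\<close> ensuring that the supremum is taken
  over a set that is bounded above.\<close>

lemma opnorm_tendsto_0I:
  assumes ev: "eventually (\<lambda>w. bop sc ip (T w) \<and> (\<forall>h. nrm (T w h) \<le> g w * nrm h) \<and> g w \<ge> 0) F"
    and g: "(g \<longlongrightarrow> 0) F"
  shows "((\<lambda>w. opnorm ip (T w)) \<longlongrightarrow> 0) F"
  by (rule tendsto_sandwich[OF _ _ tendsto_const g])
     (rule eventually_mono[OF ev], force intro: opnorm_nonneg opnorm_le)+

lemma ip_cong_left: "(\<And>y. ip x y = ip x' y) \<Longrightarrow> x = x'"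
  using ip_self_eq_0[of "x - x'"] by (simp add: ip_diff_left)

lemma ip_cong_right: "(\<And>x. ip x y = ip x y') \<Longrightarrow> y = y'"
  using ip_self_eq_0[of "y - y'"] by (simp add: ip_diff_right)

lemma hadj_eqI:
  assumes "\<And>x y. ip (T x) y = ip x (T' y)"
  shows "hadj ip T = T'"
proof
  fix h show "hadj ip T h = T' h"
    unfolding hadj_def
    by (rule the_equality) (auto simp: assms intro: ip_cong_right)
qed

lemma hadj_eq:
  assumes T: "bop sc ip T"
  shows "ip x (hadj ip T h) = ip (T x) h"
proof -
  have "\<exists>y. \<forall>x. ip (T x) h = ip x y"
  proof (rule riesz_representation)
    fix x
    have "cmod (ip (T x) h) \<le> nrm (T x) * nrm h" by (rule cauchy_schwarz)
    also have "\<dots> \<le> opnorm ip T * nrm x * nrm h" by (intro mult_right_mono opnorm_apply[OF T]) simp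
    finally show "cmod (ip (T x) h) \<le> opnorm ip T * nrm h * nrm x" by (simp add: mult_ac)
  qed (auto simp: bopD[OF T] ip_simps)
  then obtain y where y: "\<And>x. ip (T x) h = ip x y" by auto
  have "hadj ip T h = y"
    unfolding hadj_def by (rule the_equality) (auto simp: y intro: ip_cong_right)
  thus ?thesis by (simp add: y)
qed

end

section \<open>Krein spaces\<close>

locale krein_space =
  fixes sc :: "complex \<Rightarrow> 'a::ab_group_add \<Rightarrow> 'a" and ip :: "'a \<Rightarrow> 'a \<Rightarrow> complex"
  assumes krein: "krein sc ip"
begin

sublocale herm_space sc ip
  using krein by unfold_locales (simp add: krein_def)

text \<open>The same choice term as inside \<open>knorm\<close>, so that \<open>knorm\<close> is by
  definition the norm of the Hilbert product \<open>hip\<close>.\<close>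

definition J :: "'a \<Rightarrow> 'a" where "J = (SOME J. fund_sym sc ip J)"

lemma fund_sym_J: "fund_sym sc ip J"
proof -
  obtain J' where "fund_sym sc ip J'" using krein by (auto simp: krein_def)
  thus ?thesis unfolding J_def by (rule someI[of "fund_sym sc ip"])
qed

definition hip :: "'a \<Rightarrow> 'a \<Rightarrow> complex" where "hip x y = ip (J x) y"

sublocale H: hilb sc hip
  using fund_sym_J unfolding fund_sym_def hip_def[abs_def] by unfold_locales blast

abbreviation kn :: "'a \<Rightarrow> real" where "kn \<equiv> knorm sc ip"

lemma knorm_eq: "knorm sc ip = ipnorm hip"
  unfolding knorm_def[abs_def] hip_def[abs_def] J_def ..

lemma kclosure_eq: "kclosure sc ip S = H.clos S"
  by (simp add: kclosure_def H.clos_def knorm_eq)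

lemma J_J [simp]: "J (J x) = x" and J_sym: "ip (J x) y = ip x (J y)"
  using fund_sym_J by (auto simp: fund_sym_def)

lemma hip_J: "hip (J x) y = ip x y"
  by (simp add: hip_def)

lemma hip_J_right: "hip x (J y) = ip x y"
  by (simp add: hip_def J_sym)

lemma kn_J [simp]: "kn (J x) = kn x"
  by (simp add: knorm_eq ipnorm_def hip_J) (simp add: hip_def J_sym)

lemma ip_bound: "cmod (ip x y) \<le> kn x * kn y"
  using H.cauchy_schwarz[of "J x" y] kn_J[of x] by (simp add: hip_J knorm_eq)

lemma nondegenerate:
  assumes "\<And>y. ip x y = 0"
  shows "x = 0"
  using assms[of "J x"] H.ip_self_eq_0[of x] by (simp flip: hip_J_right)

lemmas kn_nonneg = H.nrm_nonneg[folded knorm_eq]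
  and kn_zero = H.nrm_zero[folded knorm_eq]
  and kn_eq_0 = H.nrm_eq_0[folded knorm_eq]
  and kn_scale = H.nrm_scale[folded knorm_eq]
  and kn_triangle = H.nrm_triangle[folded knorm_eq]
  and kn_minus_commute = H.nrm_minus_commute[folded knorm_eq]
  and kn_triangle_rev = H.nrm_triangle_rev[folded knorm_eq]

lemma riesz:
  assumes "\<And>x y. f (x + y) = f x + f y" "\<And>c x. f (sc c x) = c * f x" "\<And>x. cmod (f x) \<le> C * kn x"
  shows "\<exists>y. \<forall>x. f x = ip x y"
  using H.riesz_representation[of f C] assms unfolding knorm_eq by (metis hip_def J_sym)

text \<open>With respect to \<open>hip\<close> the adjoint of T is J T' J, so Hellinger-Toeplitz
  applies. The bounds on projections and on adjoints of resolvents come from here.\<close>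

lemma adjoint_bounded:
  assumes "\<And>x y. ip (T x) y = ip x (T' y)"
  shows "\<exists>C\<ge>0. \<forall>x. kn (T x) \<le> C * kn x"
  unfolding knorm_eq
proof (rule H.hellinger_toeplitz)
  fix x y
  have "hip (T x) y = ip (T x) (J y)" by (simp add: hip_def J_sym)
  also have "\<dots> = hip x (J (T' (J y)))" by (simp add: assms hip_J_right)
  finally show "hip (T x) y = hip x (J (T' (J y)))" .
qed

lemma dense_if_trivial_complement:
  assumes "csubspace sc S" "\<And>x. (\<And>s. s \<in> S \<Longrightarrow> ip x s = 0) \<Longrightarrow> x = 0"
  shows "kclosure sc ip S = UNIV"
  unfolding kclosure_eq
proof (rule H.dense_if_trivial_complement[OF assms(1)])
  fix x assume "\<And>s. s \<in> S \<Longrightarrow> hip x s = 0"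
  hence "J x = 0" using assms(2)[of "J x"] by (simp add: hip_def)
  thus "x = 0" by (metis kn_J kn_eq_0)
qed

lemma cnj_ip_zero: "ip x y = 0 \<longleftrightarrow> ip y x = 0"
  using ip_cnj[of x y] by auto

lemma kn_diff_abs: "\<bar>kn x - kn y\<bar> \<le> kn (x - y)"
  using kn_triangle_rev[of x y] kn_triangle_rev[of y x] kn_minus_commute[of x y] by linarith

lemma ip_diff_bound: "cmod (ip x' y' - ip x y) \<le> kn (x' - x) * (kn y + kn (y' - y)) + kn x * kn (y' - y)"
proof -
  have "ip x' y' - ip x y = ip (x' - x) y' + ip x (y' - y)" by (simp add: ip_simps)
  also have "cmod \<dots> \<le> kn (x' - x) * kn y' + kn x * kn (y' - y)"
    by (intro order_trans[OF norm_triangle_ineq] add_mono ip_bound)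
  also have "\<dots> \<le> kn (x' - x) * (kn y + kn (y' - y)) + kn x * kn (y' - y)"
    by (intro add_mono mult_left_mono kn_triangle_rev kn_nonneg order_refl)
  finally show ?thesis .
qed

text \<open>Negative definiteness of finitely many vectors is an open condition, so the vectors can
  be moved into S. In part (ii) this detects the full negative index on ran Gamma.\<close>

lemma negdef_in_dense:
  assumes on: "negon ip ys" and d: "set ys \<subseteq> kclosure sc ip S"
  shows "\<exists>zs. negdef ip zs \<and> set zs \<subseteq> S \<and> length zs = length ys"
proof -
  let ?n = "length ys" and ?e = "1 / (2 * (real (length ys) + 1))"
  define M where "M = (\<Sum>y\<leftarrow>ys. kn y)"
  have M: "kn y \<le> M" if "y \<in> set ys" for y
    unfolding M_def using that by (intro member_le_sum_list) (auto simp: kn_nonneg)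
  have M0: "M \<ge> 0" unfolding M_def by (intro sum_list_nonneg) (auto simp: kn_nonneg)
  \<comment> \<open>If the norms in the list are at most M, errors of size \<delta> \<le> 1 change a
    product by at most \<delta> (M + 1) + M \<delta>; this has to stay within the tolerance of
    \<open>negdef_perturbation\<close>.\<close>
  define \<delta> where "\<delta> = min 1 (?e / (2 * M + 1))"
  have \<delta>: "\<delta> > 0" "\<delta> \<le> 1" "\<delta> * (2 * M + 1) \<le> ?e"
  proof -
    have p: "2 * M + 1 > 0" using M0 by simp
    show "\<delta> > 0" unfolding \<delta>_def using p by simp
    show "\<delta> \<le> 1" unfolding \<delta>_def by simp
    have "\<delta> \<le> ?e / (2 * M + 1)" unfolding \<delta>_def by (rule min.cobounded2)
    thus "\<delta> * (2 * M + 1) \<le> ?e" using p by (subst (asm) pos_le_divide_eq) auto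
  qed
  have "\<forall>i<?n. \<exists>z\<in>S. kn (ys ! i - z) < \<delta>"
    using d \<delta>(1) unfolding kclosure_def by (force dest: nth_mem)
  then obtain z where z: "\<And>i. i < ?n \<Longrightarrow> z i \<in> S" "\<And>i. i < ?n \<Longrightarrow> kn (ys ! i - z i) < \<delta>" by metis
  define zs where "zs = map z [0..<?n]"
  have "negdef ip zs"
  proof (rule negdef_perturbation[OF on])
    fix i j assume i: "i < ?n" and j: "j < ?n"
    have a: "kn (z i - ys ! i) \<le> \<delta>" "kn (z j - ys ! j) \<le> \<delta>"
      using z(2)[OF i] z(2)[OF j] by (auto simp: kn_minus_commute)
    have "cmod (ip (z i) (z j) - ip (ys ! i) (ys ! j))
      \<le> kn (z i - ys ! i) * (kn (ys ! j) + kn (z j - ys ! j)) + kn (ys ! i) * kn (z j - ys ! j)"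
      by (rule ip_diff_bound)
    also have "\<dots> \<le> \<delta> * (M + 1) + M * \<delta>"
      using a \<delta> M0 M[of "ys ! i"] M[of "ys ! j"] i j
      by (intro add_mono mult_mono) (auto simp: kn_nonneg)
    also have "\<dots> = \<delta> * (2 * M + 1)" by (simp add: algebra_simps)
    also note \<delta>(3)
    finally show "cmod (ip (zs ! i) (zs ! j) - ip (ys ! i) (ys ! j)) \<le> ?e" using i j by (simp add: zs_def)
  qed (simp add: zs_def)
  thus ?thesis using z(1) by (intro exI[of _ zs]) (auto simp: zs_def)
qed

end

text \<open>The map taking x to \<open>J2 (J1 x)\<close> expresses the first Hilbert product by the
  second and is symmetric for the latter, hence bounded by Hellinger-Toeplitz. Cauchy-Schwarz then
  bounds the squared first norm, whence the square root of C.\<close>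

lemma fund_sym_norm_equiv:
  assumes k: "hermitian_form sc ip" and 1: "fund_sym sc ip J1" and 2: "fund_sym sc ip J2"
  shows "\<exists>C\<ge>0. \<forall>x. ipnorm (\<lambda>x y. ip (J1 x) y) x \<le> C * ipnorm (\<lambda>x y. ip (J2 x) y) x"
proof -
  interpret H1: hilb sc "\<lambda>x y. ip (J1 x) y" using 1 unfolding fund_sym_def by unfold_locales blast
  interpret H2: hilb sc "\<lambda>x y. ip (J2 x) y" using 2 unfolding fund_sym_def by unfold_locales blast
  have s1: "ip (J1 x) y = ip x (J1 y)" for x y using 1 by (auto simp: fund_sym_def)
  have s2: "ip (J2 x) y = ip x (J2 y)" and j2: "J2 (J2 x) = x" for x y using 2 by (auto simp: fund_sym_def)
  have "ip (J2 (J2 (J1 x))) y = ip (J2 x) (J2 (J1 y))" for x y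
    by (metis s1 s2 j2)
  from H2.hellinger_toeplitz[of "\<lambda>x. J2 (J1 x)", OF this]
  obtain C where C: "C \<ge> 0" "\<And>x. H2.nrm (J2 (J1 x)) \<le> C * H2.nrm x" by auto
  have "H1.nrm x \<le> sqrt C * H2.nrm x" for x
  proof (rule power2_le_imp_le)
    have "(H1.nrm x)\<^sup>2 = Re (ip (J2 (J2 (J1 x))) x)" by (simp add: H1.nrm_power2 j2)
    also have "\<dots> \<le> H2.nrm (J2 (J1 x)) * H2.nrm x"
      using H2.cauchy_schwarz[of "J2 (J1 x)" x] complex_Re_le_cmod order_trans by blast
    also have "\<dots> \<le> C * H2.nrm x * H2.nrm x" by (intro mult_right_mono C) simp
    also have "\<dots> = (sqrt C * H2.nrm x)\<^sup>2" using C(1) by (simp add: power_mult_distrib power2_eq_square)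
    finally show "(H1.nrm x)\<^sup>2 \<le> (sqrt C * H2.nrm x)\<^sup>2" .
  qed (use C in simp)
  thus ?thesis using C(1) by (intro exI[of _ "sqrt C"]) auto
qed

text \<open>Existence of the orthogonal projection is part of the locale. It is trivial for the
  whole space, and for K_1 and K_2 it comes from the given decomposition of K.\<close>

locale krein_subspace = krein_space +
  fixes V :: "'a set"
  assumes closed_nondeg: "closed_nondeg_subspace sc ip V"
    and complemented: "\<And>k. \<exists>v\<in>V. \<forall>u\<in>V. ip (k - v) u = 0"
begin

lemma subspace_V: "csubspace sc V" and closed_V: "kclosure sc ip V = V"
  and nondeg_V: "x \<in> V \<Longrightarrow> (\<And>y. y \<in> V \<Longrightarrow> ip x y = 0) \<Longrightarrow> x = 0"
  using closed_nondeg by (auto simp: closed_nondeg_subspace_def)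

lemmas V_zero = csubspaceD(1)[OF subspace_V] and V_add = csubspaceD(2)[OF subspace_V]
  and V_scale = csubspaceD(3)[OF subspace_V] and V_diff = csubspace_diff[OF subspace_V]

abbreviation E :: "'a \<Rightarrow> 'a" where "E \<equiv> oproj ip V"

lemma oproj_eqI:
  assumes "v \<in> V" "\<And>u. u \<in> V \<Longrightarrow> ip (k - v) u = 0"
  shows "E k = v"
  unfolding oproj_def
proof (rule the_equality)
  fix w assume w: "w \<in> V \<and> (\<forall>u\<in>V. ip (k - w) u = 0)"
  have "w - v = 0"
  proof (rule nondeg_V)
    show "w - v \<in> V" using w assms by (auto intro: V_diff)
    fix u assume u: "u \<in> V"
    have "ip (w - v) u = ip (k - v) u - ip (k - w) u" by (simp add: ip_simps)
    thus "ip (w - v) u = 0" using w assms u by auto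
  qed
  thus "w = v" by simp
qed (use assms in auto)

lemma E_in_V: "E k \<in> V" and E_orth: "u \<in> V \<Longrightarrow> ip (k - E k) u = 0"
proof -
  obtain v where v: "v \<in> V" "\<And>u. u \<in> V \<Longrightarrow> ip (k - v) u = 0" using complemented by blast
  with oproj_eqI[OF v] show "E k \<in> V" "u \<in> V \<Longrightarrow> ip (k - E k) u = 0" by auto
qed

lemma E_id: "v \<in> V \<Longrightarrow> E v = v"
  by (rule oproj_eqI) auto

lemma ip_E_right: "u \<in> V \<Longrightarrow> ip u (E k) = ip u k"
  using E_orth[of u k] cnj_ip_zero[of "k - E k" u] by (simp add: ip_simps)

lemma ip_E_left: "u \<in> V \<Longrightarrow> ip (E k) u = ip k u"
  using E_orth[of u k] by (simp add: ip_simps)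

lemma E_add: "E (x + y) = E x + E y"
  by (rule oproj_eqI) (auto intro: V_add E_in_V simp: ip_simps ip_E_left)

lemma E_scale: "E (sc c x) = sc c (E x)"
  by (rule oproj_eqI) (auto intro: V_scale E_in_V simp: ip_simps ip_E_left)

lemma E_diff: "E (x - y) = E x - E y"
  using E_add[of "x - y" y] by simp

lemma E_sym: "ip (E x) y = ip x (E y)"
  using ip_E_right[OF E_in_V, of x y] ip_E_left[OF E_in_V, of x y] by simp

lemma E_bounded: "\<exists>C\<ge>0. \<forall>x. kn (E x) \<le> C * kn x"
  by (rule adjoint_bounded) (rule E_sym)

end

section \<open>Resolvents of self-adjoint relations\<close>

locale sa_relation = krein_subspace +
  fixes A :: "('a \<times> 'a) set"
  assumes selfadj: "selfadj_rel ip V A"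
begin

lemma A_iff: "(f, g) \<in> A \<longleftrightarrow> f \<in> V \<and> g \<in> V \<and> (\<forall>u v. (u, v) \<in> A \<longrightarrow> ip v f = ip u g)"
proof -
  have "A = {(f, g). f \<in> V \<and> g \<in> V \<and> (\<forall>(u, v) \<in> A. ip v f = ip u g)}"
    using selfadj by (simp only: selfadj_rel_def)
  hence "(f, g) \<in> A \<longleftrightarrow> (f, g) \<in> {(f, g). f \<in> V \<and> g \<in> V \<and> (\<forall>(u, v) \<in> A. ip v f = ip u g)}" by metis
  thus ?thesis by blast
qed

lemma A_in_V: "(f, g) \<in> A \<Longrightarrow> f \<in> V \<and> g \<in> V"
  using A_iff by blast

lemma A_sym: "(u, v) \<in> A \<Longrightarrow> (f, g) \<in> A \<Longrightarrow> ip v f = ip u g"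
  using A_iff[of f g] by blast

lemma A_memI: "f \<in> V \<Longrightarrow> g \<in> V \<Longrightarrow> (\<And>u v. (u, v) \<in> A \<Longrightarrow> ip v f = ip u g) \<Longrightarrow> (f, g) \<in> A"
  using A_iff[of f g] by blast

text \<open>\<open>selfadj_rel\<close> does not mention linearity. It follows because the adjoint of
  any set of pairs is linear and A equals its own adjoint.\<close>

lemma A_add:
  assumes "(f, g) \<in> A" "(f', g') \<in> A"
  shows "(f + f', g + g') \<in> A"
  using assms[THEN A_in_V] A_sym assms
  by (intro A_memI) (auto intro: V_add simp: ip_simps)

lemma A_scale:
  assumes "(f, g) \<in> A"
  shows "(sc c f, sc c g) \<in> A"
  using assms[THEN A_in_V] A_sym assms
  by (intro A_memI) (auto intro: V_scale simp: ip_simps)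

lemma A_diff: "(f, g) \<in> A \<Longrightarrow> (f', g') \<in> A \<Longrightarrow> (f - f', g - g') \<in> A"
  using A_add[of f g "sc (-1) f'" "sc (-1) g'"] A_scale[of f' g' "-1"] by simp

abbreviation \<rho> :: "complex set" where "\<rho> \<equiv> rho sc ip V A"
abbreviation R :: "complex \<Rightarrow> 'a \<Rightarrow> 'a" where "R \<equiv> resolv sc V A"

lemma rho_ex1: "z \<in> \<rho> \<Longrightarrow> y \<in> V \<Longrightarrow> \<exists>!f. f \<in> V \<and> (f, y + sc z f) \<in> A"
  unfolding rho_def by blast

lemma R_props:
  assumes "z \<in> \<rho>" "y \<in> V"
  shows "R z y \<in> V" "(R z y, y + sc z (R z y)) \<in> A"
  using theI'[OF rho_ex1[OF assms]] by (auto simp: resolv_def)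

lemma R_eqI:
  assumes "z \<in> \<rho>" "y \<in> V" "(f, y + sc z f) \<in> A"
  shows "R z y = f"
  unfolding resolv_def
  by (rule the1_equality[OF rho_ex1[OF assms(1,2)]]) (use assms(3) A_in_V in auto)

lemma R_add:
  assumes z: "z \<in> \<rho>" and x: "x \<in> V" and y: "y \<in> V"
  shows "R z (x + y) = R z x + R z y"
proof (rule R_eqI[OF z V_add[OF x y]])
  show "(R z x + R z y, x + y + sc z (R z x + R z y)) \<in> A"
    using A_add[OF R_props(2)[OF z x] R_props(2)[OF z y]] by (simp add: vs.scale_right_distrib algebra_simps)
qed

lemma R_scale:
  assumes z: "z \<in> \<rho>" and x: "x \<in> V"
  shows "R z (sc c x) = sc c (R z x)"
proof (rule R_eqI[OF z V_scale[OF x]])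
  show "(sc c (R z x), sc c x + sc z (sc c (R z x))) \<in> A"
    using A_scale[OF R_props(2)[OF z x], of c] by (simp add: vs.scale_right_distrib mult.commute)
qed

lemma R_diff: "z \<in> \<rho> \<Longrightarrow> x \<in> V \<Longrightarrow> y \<in> V \<Longrightarrow> R z (x - y) = R z x - R z y"
  using R_add[of z "x - y" y] V_diff[of x y] by simp

lemma R_bounded:
  assumes "z \<in> \<rho>"
  shows "\<exists>C>0. \<forall>y\<in>V. kn (R z y) \<le> C * kn y"
proof -
  obtain C where C: "\<And>y. y \<in> V \<Longrightarrow> kn (R z y) \<le> C * kn y" using assms unfolding rho_def by blast
  have "kn (R z y) \<le> (\<bar>C\<bar> + 1) * kn y" if "y \<in> V" for y
    by (rule order_trans[OF C[OF that]]) (intro mult_right_mono kn_nonneg, auto)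
  thus ?thesis by (intro exI[of _ "\<bar>C\<bar> + 1"]) auto
qed

text \<open>An explicit right inverse f, a trivial eigenspace and a bound identify both the
  resolvent set and the resolvent. Conjugate points, nearby points, restrictions and direct sums are
  all treated through this rule.\<close>

lemma rhoI:
  assumes "\<And>y. y \<in> V \<Longrightarrow> f y \<in> V \<and> (f y, y + sc z (f y)) \<in> A"
    and uniq: "\<And>d. (d, sc z d) \<in> A \<Longrightarrow> d = 0"
    and bd: "\<And>y. y \<in> V \<Longrightarrow> kn (f y) \<le> C * kn y"
  shows "z \<in> \<rho>" "\<And>y. y \<in> V \<Longrightarrow> R z y = f y"
proof -
  have ex1: "\<exists>!f. f \<in> V \<and> (f, y + sc z f) \<in> A" if y: "y \<in> V" for y
  proof (rule ex1I[of _ "f y"])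
    fix g assume g: "g \<in> V \<and> (g, y + sc z g) \<in> A"
    have "(g - f y, sc z (g - f y)) \<in> A"
      using A_diff[of g "y + sc z g" "f y" "y + sc z (f y)"] g assms(1)[OF y]
      by (simp add: vs.scale_right_diff_distrib)
    thus "g = f y" using uniq by fastforce
  qed (use assms(1)[OF y] in auto)
  have eq: "R z y = f y" if y: "y \<in> V" for y
    unfolding resolv_def by (rule the1_equality[OF ex1[OF y]]) (rule assms(1)[OF y])
  show "\<And>y. y \<in> V \<Longrightarrow> R z y = f y" by (rule eq)
  show "z \<in> \<rho>" unfolding rho_def mem_Collect_eq
  proof (intro conjI ballI exI)
    fix y assume "y \<in> V"
    thus "\<exists>!f. f \<in> V \<and> (f, y + sc z f) \<in> A" "kn (R z y) \<le> C * kn y"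
      using ex1 bd by (simp_all add: eq)
  qed
qed

text \<open>\<open>R w\<close> sends y + (z - w) \<open>R z y\<close> to \<open>R z y\<close>,
  because the pair in A that witnesses this is the one belonging to z.\<close>

lemma resolvent_identity:
  assumes z: "z \<in> \<rho>" and w: "w \<in> \<rho>" and y: "y \<in> V"
  shows "sc (z - w) (R w (R z y)) = R z y - R w y"
proof -
  let ?f = "R z y"
  have f: "?f \<in> V" by (rule R_props(1)[OF z y])
  have "R w (y + sc (z - w) ?f) = ?f"
  proof (rule R_eqI[OF w])
    show "y + sc (z - w) ?f \<in> V" by (intro V_add V_scale y f)
    show "(?f, y + sc (z - w) ?f + sc w ?f) \<in> A"
      using R_props(2)[OF z y] by (simp add: vs.scale_left_diff_distrib)
  qed
  moreover have "R w (y + sc (z - w) ?f) = R w y + sc (z - w) (R w ?f)"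
    using w y f by (simp only: R_add R_scale V_scale)
  ultimately show ?thesis by (simp add: algebra_simps)
qed

text \<open>The adjoint S of the resolvent at z comes from the Riesz theorem, with \<open>E\<close>
  extending \<open>R z\<close> to the whole space, and S turns out to be the resolvent at the
  conjugate point. Every (u, v) in A satisfies u = \<open>R z (v - sc z u)\<close>, so the adjoint
  relation tests membership in A.\<close>

lemma
  assumes z: "z \<in> \<rho>"
  shows cnj_in_rho: "cnj z \<in> \<rho>"
    and R_adjoint: "x \<in> V \<Longrightarrow> y \<in> V \<Longrightarrow> ip (R z x) y = ip x (R (cnj z) y)"
proof -
  obtain C where C: "C > 0" "\<And>y. y \<in> V \<Longrightarrow> kn (R z y) \<le> C * kn y" using R_bounded[OF z] by auto
  obtain D where D: "D \<ge> 0" "\<And>x. kn (E x) \<le> D * kn x" using E_bounded by auto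
  have "\<exists>k. \<forall>x. ip (R z (E x)) y = ip x k" for y
  proof (rule riesz[where C = "C * D * kn y"])
    fix x
    have "cmod (ip (R z (E x)) y) \<le> kn (R z (E x)) * kn y" by (rule ip_bound)
    also have "\<dots> \<le> (C * (D * kn x)) * kn y"
      by (intro mult_right_mono kn_nonneg order_trans[OF C(2)[OF E_in_V]] mult_left_mono D less_imp_le[OF C(1)])
    finally show "cmod (ip (R z (E x)) y) \<le> C * D * kn y * kn x" by (simp add: mult_ac)
  qed (auto simp: E_add E_scale R_add[OF z] R_scale[OF z] E_in_V ip_simps)
  then obtain k where k: "\<And>x y. ip (R z (E x)) y = ip x (k y)" by metis
  define S where "S y = E (k y)" for y
  have SV: "S y \<in> V" for y by (simp add: S_def E_in_V)
  have S: "ip (R z x) y = ip x (S y)" if "x \<in> V" for x y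
    using k[of x y] that by (simp add: S_def E_id ip_E_right)
  have SA: "(S y, y + sc (cnj z) (S y)) \<in> A" if y: "y \<in> V" for y
  proof (rule A_memI)
    fix u v assume uv: "(u, v) \<in> A"
    note uvV = A_in_V[OF uv]
    have vz: "v - sc z u \<in> V" using uvV by (intro V_diff V_scale) auto
    have "R z (v - sc z u) = u" by (rule R_eqI[OF z vz]) (use uv in simp)
    hence "ip u y = ip (v - sc z u) (S y)" using S[OF vz, of y] by simp
    thus "ip v (S y) = ip u (y + sc (cnj z) (S y))" by (simp add: ip_simps)
  qed (auto intro: V_add V_scale y SV)
  have uniq: "d = 0" if d: "(d, sc (cnj z) d) \<in> A" for d
  proof (rule nondeg_V)
    show "d \<in> V" using A_in_V[OF d] by simp
    fix x assume x: "x \<in> V"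
    have "ip (x + sc z (R z x)) d = ip (R z x) (sc (cnj z) d)" by (rule A_sym[OF R_props(2)[OF z x] d])
    hence "ip x d = 0" by (simp add: ip_simps)
    thus "ip d x = 0" by (simp add: cnj_ip_zero)
  qed
  \<comment> \<open>Preceded by \<open>E\<close>, the operator S has an adjoint on the whole space,
    so \<open>adjoint_bounded\<close> supplies its bound.\<close>
  have "ip (S (E y)) x = ip y (R z (E x))" for x y
  proof -
    have "ip (S (E y)) x = ip (S (E y)) (E x)" by (simp add: ip_E_right SV)
    also have "\<dots> = cnj (ip (E x) (S (E y)))" by (rule ip_cnj)
    also have "ip (E x) (S (E y)) = ip (R z (E x)) (E y)" by (simp add: S E_in_V)
    also have "\<dots> = ip (R z (E x)) y" by (rule ip_E_right) (rule R_props(1)[OF z E_in_V])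
    also have "cnj \<dots> = ip y (R z (E x))" by (rule ip_cnj[symmetric])
    finally show ?thesis .
  qed
  from adjoint_bounded[OF this] obtain B where "B \<ge> 0" "\<And>x. kn (S (E x)) \<le> B * kn x" by auto
  hence B: "kn (S y) \<le> B * kn y" if "y \<in> V" for y using E_id[OF that] by metis
  have SA': "S y \<in> V \<and> (S y, y + sc (cnj z) (S y)) \<in> A" if "y \<in> V" for y using SV SA[OF that] by auto
  show "cnj z \<in> \<rho>" by (rule rhoI(1)[OF SA' uniq B])
  show "x \<in> V \<Longrightarrow> y \<in> V \<Longrightarrow> ip (R z x) y = ip x (R (cnj z) y)"
    using rhoI(2)[OF SA' uniq B] S by auto
qed

text \<open>A single M serves a whole disc, as the continuity and compactness arguments require. The
  radius 1/(2C) makes (w - z) R z a contraction with factor 1/2, which at most doubles the bound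
  C.\<close>

lemma rho_ball:
  assumes z: "z \<in> \<rho>"
  shows "\<exists>r>0. \<exists>M>0. \<forall>w. cmod (w - z) < r \<longrightarrow> w \<in> \<rho> \<and> (\<forall>y\<in>V. kn (R w y) \<le> M * kn y)"
proof -
  obtain C where C: "C > 0" "\<And>y. y \<in> V \<Longrightarrow> kn (R z y) \<le> C * kn y" using R_bounded[OF z] by auto
  have main: "w \<in> \<rho> \<and> (\<forall>y\<in>V. kn (R w y) \<le> 2 * C * kn y)" if w: "cmod (w - z) < 1 / (2 * C)" for w
  proof -
    define B where "B x = sc (w - z) (R z x)" for x
    have BV: "B x \<in> V" if "x \<in> V" for x unfolding B_def by (intro V_scale R_props(1)[OF z that])
    have Bd: "kn (B x) \<le> 1/2 * kn x" if "x \<in> V" for x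
    proof -
      have "kn (B x) = cmod (w - z) * kn (R z x)" by (simp add: B_def kn_scale)
      also have "\<dots> \<le> 1 / (2 * C) * (C * kn x)"
        using w C that by (intro mult_mono) (auto simp: kn_nonneg)
      also have "\<dots> = 1/2 * kn x" using C by simp
      finally show ?thesis .
    qed
    have "\<exists>x\<in>V. x - B x = R z y" if y: "y \<in> V" for y
    proof (rule H.neumann[where q = "1/2"])
      show "H.clos V \<subseteq> V" using closed_V by (simp add: kclosure_eq)
      show "B (x - y) = B x - B y" if "x \<in> V" "y \<in> V" for x y
        using that by (simp add: B_def R_diff[OF z] vs.scale_right_diff_distrib)
    qed (use subspace_V BV Bd y R_props(1)[OF z] in \<open>auto simp: knorm_eq\<close>)
    then obtain f where fV: "\<And>y. y \<in> V \<Longrightarrow> f y \<in> V" and f: "\<And>y. y \<in> V \<Longrightarrow> f y - B (f y) = R z y" by metis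
    have fA: "f y \<in> V \<and> (f y, y + sc w (f y)) \<in> A" if y: "y \<in> V" for y
    proof -
      have v: "y + sc (w - z) (f y) \<in> V" by (intro V_add V_scale y fV)
      have "R z (y + sc (w - z) (f y)) = R z y + B (f y)"
        unfolding B_def using y fV[OF y] by (simp add: R_add[OF z] R_scale[OF z] V_scale)
      also have "\<dots> = f y" using f[OF y] by (simp add: algebra_simps)
      finally have "(f y, (y + sc (w - z) (f y)) + sc z (f y)) \<in> A" using R_props(2)[OF z v] by simp
      thus ?thesis using fV[OF y] by (simp add: vs.scale_left_diff_distrib)
    qed
    have uniq: "d = 0" if d: "(d, sc w d) \<in> A" for d
    proof -
      have dV: "d \<in> V" using A_in_V[OF d] by simp
      have "R z (sc (w - z) d) = d"
        by (rule R_eqI[OF z V_scale[OF dV]]) (use d in \<open>simp add: vs.scale_left_diff_distrib\<close>)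
      hence "d = B d" unfolding B_def using R_scale[OF z dV] by simp
      hence "kn d \<le> 1/2 * kn d" using Bd[OF dV] by simp
      hence "kn d = 0" using kn_nonneg[of d] by linarith
      thus "d = 0" by (simp add: kn_eq_0)
    qed
    have bd: "kn (f y) \<le> 2 * C * kn y" if y: "y \<in> V" for y
    proof -
      have "kn (f y) \<le> kn (B (f y)) + kn (f y - B (f y))" by (rule kn_triangle_rev)
      also have "\<dots> \<le> 1/2 * kn (f y) + C * kn y"
        unfolding f[OF y] by (intro add_mono Bd fV C y)
      finally show ?thesis by simp
    qed
    show ?thesis using rhoI[OF fA uniq bd] bd by auto
  qed
  show ?thesis
  proof (intro exI conjI allI impI)
    show "1 / (2 * C) > 0" "2 * C > 0" using C by auto
  qed (use main in auto)
qed

lemma open_rho: "open \<rho>"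
  unfolding open_dist
proof
  fix z assume "z \<in> \<rho>"
  from rho_ball[OF this] show "\<exists>e>0. \<forall>w. dist w z < e \<longrightarrow> w \<in> \<rho>" by (auto simp: dist_norm)
qed

end

section \<open>Functions represented by a triplet\<close>

locale rep_triplet = sa_relation sc ip V A + Hs: hilb sch iph
  for sc :: "complex \<Rightarrow> 'a::ab_group_add \<Rightarrow> 'a" and ip :: "'a \<Rightarrow> 'a \<Rightarrow> complex" and V A
    and sch :: "complex \<Rightarrow> 'h::ab_group_add \<Rightarrow> 'h" and iph :: "'h \<Rightarrow> 'h \<Rightarrow> complex" +
  fixes G :: "'h \<Rightarrow> 'a" and z0 :: complex
  assumes G_bounded: "bop_HK sch iph sc ip G" and G_in_V: "G h \<in> V" and z0_rho: "z0 \<in> \<rho>"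
begin

lemma G_add: "G (x + y) = G x + G y" and G_scale: "G (sch c x) = sc c (G x)"
  using G_bounded by (auto simp: bop_HK_def clinear_def)

lemma G_bound: "\<exists>C>0. \<forall>h. kn (G h) \<le> C * Hs.nrm h"
proof -
  obtain C where C: "\<And>h. kn (G h) \<le> C * Hs.nrm h" using G_bounded by (auto simp: bop_HK_def)
  have "kn (G h) \<le> (\<bar>C\<bar> + 1) * Hs.nrm h" for h
    by (rule order_trans[OF C]) (intro mult_right_mono Hs.nrm_nonneg, auto)
  thus ?thesis by (intro exI[of _ "\<bar>C\<bar> + 1"]) auto
qed

abbreviation Gs :: "'a \<Rightarrow> 'h" where "Gs \<equiv> gadj iph ip G"

lemma Gs_right: "iph h (Gs k) = ip (G h) k"
proof -
  obtain C where C: "C > 0" "\<And>h. kn (G h) \<le> C * Hs.nrm h" using G_bound by auto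
  have "\<exists>y. \<forall>h. ip (G h) k = iph h y"
  proof (rule Hs.riesz_representation)
    fix x
    have "cmod (ip (G x) k) \<le> kn (G x) * kn k" by (rule ip_bound)
    also have "\<dots> \<le> C * Hs.nrm x * kn k" by (intro mult_right_mono C kn_nonneg)
    finally show "cmod (ip (G x) k) \<le> C * kn k * Hs.nrm x" by (simp add: mult_ac)
  qed (auto simp: G_add G_scale ip_simps)
  then obtain y where y: "\<And>h. ip (G h) k = iph h y" by auto
  have "Gs k = y"
    unfolding gadj_def by (rule the_equality) (auto simp: y intro: Hs.ip_cong_right)
  thus ?thesis by (simp add: y)
qed

lemma Gs_left: "iph (Gs k) h = ip k (G h)"
  by (metis Gs_right Hs.ip_cnj ip_cnj)

lemma Gs_add: "Gs (x + y) = Gs x + Gs y"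
  by (rule Hs.ip_cong_right) (simp add: Gs_right Hs.ip_simps ip_simps)

lemma Gs_scale: "Gs (sc c x) = sch c (Gs x)"
  by (rule Hs.ip_cong_right) (simp add: Gs_right Hs.ip_simps ip_simps)

lemma Gs_diff: "Gs (x - y) = Gs x - Gs y"
  using Gs_add[of "x - y" y] by simp

lemma Gs_bound: "\<exists>C>0. \<forall>k. Hs.nrm (Gs k) \<le> C * kn k"
proof -
  obtain C where C: "C > 0" "\<And>h. kn (G h) \<le> C * Hs.nrm h" using G_bound by auto
  have "Hs.nrm (Gs k) \<le> C * kn k" for k
  proof (cases "Gs k = 0")
    case False
    hence p: "Hs.nrm (Gs k) > 0" using Hs.nrm_eq_0 Hs.nrm_nonneg less_eq_real_def by metis
    have "(Hs.nrm (Gs k))\<^sup>2 = Re (ip (G (Gs k)) k)" by (simp add: Hs.nrm_power2 Gs_right)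
    also have "\<dots> \<le> kn (G (Gs k)) * kn k" using ip_bound complex_Re_le_cmod order_trans by blast
    also have "\<dots> \<le> C * Hs.nrm (Gs k) * kn k" by (intro mult_right_mono C kn_nonneg)
    finally have "Hs.nrm (Gs k) * Hs.nrm (Gs k) \<le> Hs.nrm (Gs k) * (C * kn k)"
      by (simp add: power2_eq_square mult_ac)
    thus ?thesis using p by simp
  qed (use C in \<open>auto simp: kn_nonneg\<close>)
  thus ?thesis using C(1) by blast
qed

definition \<gamma> :: "complex \<Rightarrow> 'h \<Rightarrow> 'a" where
  "\<gamma> z h = G h + sc (z - z0) (R z (G h))"

lemma \<gamma>_in_V: "z \<in> \<rho> \<Longrightarrow> \<gamma> z h \<in> V"
  unfolding \<gamma>_def by (intro V_add V_scale G_in_V R_props(1))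

lemma \<gamma>_add: "z \<in> \<rho> \<Longrightarrow> \<gamma> z (x + y) = \<gamma> z x + \<gamma> z y"
  unfolding \<gamma>_def by (simp add: G_add R_add G_in_V vs.scale_right_distrib)

lemma \<gamma>_scale: "z \<in> \<rho> \<Longrightarrow> \<gamma> z (sch c x) = sc c (\<gamma> z x)"
  unfolding \<gamma>_def by (simp add: G_scale R_scale G_in_V vs.scale_right_distrib mult.commute)

lemma \<gamma>_z0: "\<gamma> z0 h = G h"
  by (simp add: \<gamma>_def)

text \<open>The resolvent identity for the vectors gamma: it compares two arbitrary points of the
  resolvent set without reference to the base point z0.\<close>

lemma \<gamma>_shift:
  assumes z: "z \<in> \<rho>" and w: "w \<in> \<rho>"
  shows "sc (z - w) (R w (\<gamma> z h)) = \<gamma> z h - \<gamma> w h"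
proof -
  let ?g = "G h"
  have g: "?g \<in> V" by (rule G_in_V)
  note Rz = R_props(1)[OF z g]
  have "sc (z - w) (R w (\<gamma> z h)) = sc (z - w) (R w ?g) + sc (z - z0) (sc (z - w) (R w (R z ?g)))"
    unfolding \<gamma>_def by (simp add: R_add[OF w] R_scale[OF w] g Rz V_scale vs.scale_right_distrib mult.commute)
  also have "\<dots> = sc (z - w) (R w ?g) + sc (z - z0) (R z ?g - R w ?g)"
    by (simp add: resolvent_identity[OF z w g])
  also have "\<dots> = sc (z - z0) (R z ?g) - sc (w - z0) (R w ?g)"
    by (simp add: vs.scale_right_diff_distrib vs.scale_left_diff_distrib algebra_simps)
  also have "\<dots> = \<gamma> z h - \<gamma> w h" by (simp add: \<gamma>_def)
  finally show ?thesis .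
qed

lemma \<gamma>_bound:
  assumes z: "z \<in> \<rho>"
  shows "\<exists>r>0. \<exists>M>0. \<forall>w. cmod (w - z) < r \<longrightarrow> w \<in> \<rho> \<and> (\<forall>h. kn (\<gamma> w h) \<le> M * Hs.nrm h)"
proof -
  obtain r M where r: "r > 0" and M: "M > 0"
    and rM: "\<And>w. cmod (w - z) < r \<Longrightarrow> w \<in> \<rho>" "\<And>w y. cmod (w - z) < r \<Longrightarrow> y \<in> V \<Longrightarrow> kn (R w y) \<le> M * kn y"
    using rho_ball[OF z] by meson
  obtain C where C: "C > 0" "\<And>h. kn (G h) \<le> C * Hs.nrm h" using G_bound by auto
  let ?N = "C + (cmod (z - z0) + r) * (M * C)"
  have "kn (\<gamma> w h) \<le> ?N * Hs.nrm h" if w: "cmod (w - z) < r" for w h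
  proof -
    have "kn (\<gamma> w h) \<le> kn (G h) + cmod (w - z0) * kn (R w (G h))"
      unfolding \<gamma>_def by (rule order_trans[OF kn_triangle]) (simp add: kn_scale)
    also have "cmod (w - z0) \<le> cmod (w - z) + cmod (z - z0)"
      using norm_triangle_ineq[of "w - z" "z - z0"] by simp
    hence "cmod (w - z0) * kn (R w (G h)) \<le> (cmod (z - z0) + r) * (M * (C * Hs.nrm h))"
      using w M r by (intro mult_mono order_trans[OF rM(2)[OF w G_in_V]] mult_left_mono C) (auto simp: kn_nonneg)
    finally show ?thesis using C(2)[of h] by (simp add: algebra_simps)
  qed
  moreover have "?N > 0" using C M r by (intro add_pos_nonneg) auto
  ultimately show ?thesis using r rM(1) by blast
qed

text \<open>Multiplied out by z - cnj w, so that it holds on the whole resolvent set, z = cnj w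
  included. The right side is the difference of Q at z and at cnj w, the constant term having
  cancelled.\<close>

lemma \<gamma>_kernel:
  assumes z: "z \<in> \<rho>" and w: "w \<in> \<rho>"
  shows "(z - cnj w) * ip (\<gamma> z h) (\<gamma> w g) =
    (z - cnj z0) * ip (\<gamma> z h) (G g) - (cnj w - cnj z0) * ip (\<gamma> (cnj w) h) (G g)"
proof -
  note w' = cnj_in_rho[OF w]
  have "ip (\<gamma> z h) (R w (G g)) = ip (R (cnj w) (\<gamma> z h)) (G g)"
    using R_adjoint[OF w', of "\<gamma> z h" "G g"] \<gamma>_in_V[OF z] G_in_V by simp
  hence "(z - cnj w) * ip (\<gamma> z h) (R w (G g)) = ip (sc (z - cnj w) (R (cnj w) (\<gamma> z h))) (G g)"
    by (simp add: ip_simps)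
  also have "\<dots> = ip (\<gamma> z h) (G g) - ip (\<gamma> (cnj w) h) (G g)"
    by (simp add: \<gamma>_shift[OF z w'] ip_simps)
  finally have *: "(z - cnj w) * ip (\<gamma> z h) (R w (G g)) = ip (\<gamma> z h) (G g) - ip (\<gamma> (cnj w) h) (G g)" .
  have "(z - cnj w) * ip (\<gamma> z h) (\<gamma> w g) = (z - cnj w) * ip (\<gamma> z h) (G g)
    + (cnj w - cnj z0) * ((z - cnj w) * ip (\<gamma> z h) (R w (G g)))"
    by (subst (2) \<gamma>_def) (simp add: ip_simps algebra_simps)
  thus ?thesis unfolding * by (simp add: algebra_simps)
qed

definition \<Gamma>_set :: "complex set \<Rightarrow> 'a set" where
  "\<Gamma>_set S = {y. \<exists>z\<in>S. \<exists>h. y = \<gamma> z h}"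

end

text \<open>The constant term is left general: it will be the adjoint of Q(z0), the operator built
  from S_i, or a sum of two such terms. \<open>C_adj\<close> says that the adjoint of C minus C is
  (z0 - cnj z0) times Gamma^+ Gamma, which is what the symmetry of Q requires.\<close>

locale rep_function = rep_triplet sc ip V A sch iph G z0
  for sc :: "complex \<Rightarrow> 'a::ab_group_add \<Rightarrow> 'a" and ip :: "'a \<Rightarrow> 'a \<Rightarrow> complex" and V A
    and sch :: "complex \<Rightarrow> 'h::ab_group_add \<Rightarrow> 'h" and iph :: "'h \<Rightarrow> 'h \<Rightarrow> complex" and G z0 +
  fixes C :: "'h \<Rightarrow> 'h" and Q :: "complex \<Rightarrow> 'h \<Rightarrow> 'h"
  assumes C_bop: "bop sch iph C"
    and C_adj: "cnj (iph (C g) h) - iph (C h) g = (z0 - cnj z0) * ip (G h) (G g)"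
    and Q_rep: "z \<in> \<rho> \<Longrightarrow> Q z h = rep_fun sch iph sc ip V A G z0 C z h"
begin

lemma Q_eq: "z \<in> \<rho> \<Longrightarrow> Q z h = C h + sch (z - cnj z0) (Gs (\<gamma> z h))"
  by (simp add: Q_rep rep_fun_def \<gamma>_def)

lemma iph_Q: "z \<in> \<rho> \<Longrightarrow> iph (Q z h) g = iph (C h) g + (z - cnj z0) * ip (\<gamma> z h) (G g)"
  by (simp add: Q_eq Hs.ip_simps Gs_left)

lemma bop_Q:
  assumes z: "z \<in> \<rho>"
  shows "bop sch iph (Q z)"
proof -
  obtain D where D: "D > 0" "\<And>k. Hs.nrm (Gs k) \<le> D * kn k" using Gs_bound by auto
  obtain M where M: "M > 0" "\<And>h. kn (\<gamma> z h) \<le> M * Hs.nrm h" using \<gamma>_bound[OF z] by force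
  have b: "bop sch iph (\<lambda>h. Gs (\<gamma> z h))"
  proof (rule Hs.bopI[of _ "D * M"])
    show "Hs.nrm (Gs (\<gamma> z h)) \<le> D * M * Hs.nrm h" for h
      using order_trans[OF D(2) mult_left_mono[OF M(2)]] D(1) by (simp add: mult.assoc)
  qed (auto simp: \<gamma>_add[OF z] \<gamma>_scale[OF z] Gs_add Gs_scale)
  have "bop sch iph (\<lambda>h. C h + sch (z - cnj z0) (Gs (\<gamma> z h)))"
    by (intro Hs.bop_add Hs.bop_scale C_bop b)
  thus ?thesis by (simp add: Q_eq[OF z, abs_def])
qed

text \<open>Both sides contain the same multiple of [R z G h, G g]; the remaining terms agree by
  \<open>C_adj\<close>.\<close>

lemma Q_adj:
  assumes z: "z \<in> \<rho>"
  shows "iph (Q z h) g = iph h (Q (cnj z) g)"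
proof -
  note z' = cnj_in_rho[OF z]
  have "iph h (Q (cnj z) g) = cnj (iph (Q (cnj z) g) h)" by (rule Hs.ip_cnj)
  also have "\<dots> = cnj (iph (C g) h) + (z - z0) * cnj (ip (\<gamma> (cnj z) g) (G h))"
    by (simp add: iph_Q[OF z'])
  also have "cnj (ip (\<gamma> (cnj z) g) (G h)) = ip (G h) (\<gamma> (cnj z) g)" by (rule ip_cnj[symmetric])
  also have "\<dots> = ip (G h) (G g) + (z - cnj z0) * ip (R z (G h)) (G g)"
    using R_adjoint[OF z G_in_V G_in_V, of h g] by (simp add: \<gamma>_def ip_simps)
  finally have 1: "iph h (Q (cnj z) g) =
    cnj (iph (C g) h) + (z - z0) * (ip (G h) (G g) + (z - cnj z0) * ip (R z (G h)) (G g))" .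
  have 2: "iph (Q z h) g = iph (C h) g + (z - cnj z0) * (ip (G h) (G g) + (z - z0) * ip (R z (G h)) (G g))"
    by (simp add: iph_Q[OF z] \<gamma>_def ip_simps)
  have 3: "cnj (iph (C g) h) = iph (C h) g + (z0 - cnj z0) * ip (G h) (G g)"
    using C_adj[of g h] by (simp add: algebra_simps)
  show ?thesis unfolding 1 2 3 by (simp add: algebra_simps)
qed

lemma hadj_Q:
  assumes z: "z \<in> \<rho>"
  shows "hadj iph (Q z) = Q (cnj z)"
  by (rule Hs.hadj_eqI) (rule Q_adj[OF z])

text \<open>The factor z - cnj z0 vanishes at cnj z0, so C can only be the adjoint of Q(z0). This
  connects a general constant term with \<open>represents\<close>.\<close>

lemma hadj_Q_z0: "hadj iph (Q z0) = C"
proof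
  fix h show "hadj iph (Q z0) h = C h"
    unfolding hadj_Q[OF z0_rho] using Q_eq[OF cnj_in_rho[OF z0_rho]] by simp
qed

lemma Q_kernel:
  assumes z: "z \<in> \<rho>" "Im z > 0" and w: "w \<in> \<rho>" "Im w > 0"
  shows "iph (NQ iph sch Q z w h) g = ip (\<gamma> z h) (\<gamma> w g)"
proof -
  have ne: "z - cnj w \<noteq> 0"
  proof
    assume "z - cnj w = 0"
    hence "Im (z - cnj w) = 0" by simp
    thus False using z w by simp
  qed
  have "(z - cnj w) * iph (NQ iph sch Q z w h) g = iph (Q z h) g - iph (Q (cnj w) h) g"
    using ne by (simp add: NQ_def hadj_Q[OF w(1)] Hs.ip_simps)
  also have "\<dots> = (z - cnj w) * ip (\<gamma> z h) (\<gamma> w g)"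
    unfolding \<gamma>_kernel[OF z(1) w(1)] by (simp add: iph_Q[OF z(1)] iph_Q[OF cnj_in_rho[OF w(1)]])
  finally show ?thesis using ne by simp
qed

lemma neg_squares_kernel:
  "neg_squares (\<lambda>(z, h) (w, g). iph (NQ iph sch Q z w h) g) ((\<rho> \<inter> {z. Im z > 0}) \<times> UNIV) k
   \<longleftrightarrow> neg_squares ip (\<Gamma>_set (\<rho> \<inter> {z. Im z > 0})) k"
proof -
  have "neg_squares (\<lambda>(z, h) (w, g). iph (NQ iph sch Q z w h) g) ((\<rho> \<inter> {z. Im z > 0}) \<times> UNIV) k
    \<longleftrightarrow> neg_squares ip ((\<lambda>(z, h). \<gamma> z h) ` ((\<rho> \<inter> {z. Im z > 0}) \<times> UNIV)) k"
    by (rule neg_squares_pullback) (auto simp: Q_kernel)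
  also have "(\<lambda>(z, h). \<gamma> z h) ` ((\<rho> \<inter> {z. Im z > 0}) \<times> UNIV) = \<Gamma>_set (\<rho> \<inter> {z. Im z > 0})"
    unfolding \<Gamma>_set_def by force
  finally show ?thesis .
qed

text \<open>By \<open>\<gamma>_shift\<close> the difference quotient is exactly S gamma(w), with a
  fixed S that is bounded on V. The derivative is therefore S gamma(z), and a second shift makes the
  error proportional to w - z.\<close>

lemma holo_Q:
  assumes z: "z \<in> \<rho>"
  shows "holo_at sch iph Q z"
proof -
  obtain D where D: "D > 0" "\<And>k. Hs.nrm (Gs k) \<le> D * kn k" using Gs_bound by auto
  obtain r M where r: "r > 0" and M: "M > 0" and rho: "\<And>w. cmod (w - z) < r \<Longrightarrow> w \<in> \<rho>"
    and Mb: "\<And>w h. cmod (w - z) < r \<Longrightarrow> kn (\<gamma> w h) \<le> M * Hs.nrm h"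
    using \<gamma>_bound[OF z] by meson
  obtain B where B: "B > 0" "\<And>y. y \<in> V \<Longrightarrow> kn (R z y) \<le> B * kn y" using R_bounded[OF z] by auto
  define S where "S x = Gs (x + sc (z - cnj z0) (R z x))" for x
  have S_diff: "S (x - y) = S x - S y" if "x \<in> V" "y \<in> V" for x y
    unfolding S_def using that by (simp add: R_diff[OF z] vs.scale_right_diff_distrib flip: Gs_diff) (simp add: algebra_simps)
  define K where "K = D * (1 + cmod (z - cnj z0) * B)"
  have K: "K > 0" unfolding K_def using D B by (intro mult_pos_pos add_pos_nonneg) auto
  have S_bd: "Hs.nrm (S x) \<le> K * kn x" if x: "x \<in> V" for x
  proof -
    have "kn (x + sc (z - cnj z0) (R z x)) \<le> kn x + cmod (z - cnj z0) * kn (R z x)"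
      by (rule order_trans[OF kn_triangle]) (simp add: kn_scale)
    also have "\<dots> \<le> kn x + cmod (z - cnj z0) * (B * kn x)"
      by (intro add_left_mono mult_left_mono B x) simp
    finally have "D * kn (x + sc (z - cnj z0) (R z x)) \<le> D * (kn x + cmod (z - cnj z0) * (B * kn x))"
      using D by (intro mult_left_mono) auto
    thus ?thesis unfolding S_def using D(2)[of "x + sc (z - cnj z0) (R z x)"] by (simp add: K_def algebra_simps)
  qed
  define T where "T h = S (\<gamma> z h)" for h
  have T: "bop sch iph T"
  proof (rule Hs.bopI[of _ "K * M"])
    fix h show "Hs.nrm (T h) \<le> K * M * Hs.nrm h"
      unfolding T_def using order_trans[OF S_bd[OF \<gamma>_in_V[OF z]] mult_left_mono[OF Mb]] K r by (simp add: mult.assoc)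
  next
    fix x y show "T (x + y) = T x + T y"
      unfolding T_def S_def \<gamma>_add[OF z] using \<gamma>_in_V[OF z]
      by (simp add: R_add[OF z] vs.scale_right_distrib flip: Gs_add) (simp add: algebra_simps)
  next
    fix c x show "T (sch c x) = sch c (T x)"
      unfolding T_def S_def \<gamma>_scale[OF z] using \<gamma>_in_V[OF z]
      by (simp add: R_scale[OF z] vs.scale_right_distrib mult.commute flip: Gs_scale)
  qed
  have quot: "sch (1 / (w - z)) (Q w h - Q z h) = S (\<gamma> w h)" if w: "cmod (w - z) < r" "w \<noteq> z" for w h
  proof -
    note wr = rho[OF w(1)]
    have ne: "w - z \<noteq> 0" using w by simp
    have "sc (w - cnj z0) (\<gamma> w h) - sc (z - cnj z0) (\<gamma> z h)
      = sc (w - z) (\<gamma> w h) + sc (z - cnj z0) (\<gamma> w h - \<gamma> z h)"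
      by (simp add: vs.scale_right_diff_distrib vs.scale_left_diff_distrib)
    also have "\<dots> = sc (w - z) (\<gamma> w h + sc (z - cnj z0) (R z (\<gamma> w h)))"
      unfolding \<gamma>_shift[OF wr z, symmetric] by (simp add: vs.scale_right_distrib mult.commute)
    finally have "Q w h - Q z h = Gs (sc (w - z) (\<gamma> w h + sc (z - cnj z0) (R z (\<gamma> w h))))"
      by (simp add: Q_eq[OF wr] Q_eq[OF z] flip: Gs_scale Gs_diff)
    thus ?thesis using ne by (simp add: S_def Gs_scale)
  qed
  have ev: "eventually (\<lambda>w. cmod (w - z) < r \<and> w \<noteq> z) (at z)"
    unfolding eventually_at using r by (auto simp: dist_norm)
  have est: "Hs.nrm (sch (1 / (w - z)) (Q w h - Q z h) - T h) \<le> (K * B * M * cmod (w - z)) * Hs.nrm h"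
    if w: "cmod (w - z) < r" "w \<noteq> z" for w h
  proof -
    note wr = rho[OF w(1)]
    have "sch (1 / (w - z)) (Q w h - Q z h) - T h = S (\<gamma> w h - \<gamma> z h)"
      unfolding quot[OF w] T_def by (rule S_diff[symmetric]) (intro \<gamma>_in_V wr z)+
    also have "Hs.nrm \<dots> \<le> K * kn (\<gamma> w h - \<gamma> z h)"
      by (intro S_bd V_diff \<gamma>_in_V wr z)
    also have "kn (\<gamma> w h - \<gamma> z h) = cmod (w - z) * kn (R z (\<gamma> w h))"
      unfolding \<gamma>_shift[OF wr z, symmetric] by (rule kn_scale)
    also have "kn (R z (\<gamma> w h)) \<le> B * (M * Hs.nrm h)"
      by (rule order_trans[OF B(2)[OF \<gamma>_in_V[OF wr]]]) (intro mult_left_mono Mb w, use B in auto)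
    finally show ?thesis using K by (simp add: mult_ac mult_right_mono)
  qed
  have "((\<lambda>w. opnorm iph (\<lambda>h. sch (1 / (w - z)) (Q w h - Q z h) - T h)) \<longlongrightarrow> 0) (at z)"
  proof (rule Hs.opnorm_tendsto_0I[where g = "\<lambda>w. K * B * M * cmod (w - z)"])
    show "eventually (\<lambda>w. bop sch iph (\<lambda>h. sch (1 / (w - z)) (Q w h - Q z h) - T h) \<and>
      (\<forall>h. Hs.nrm (sch (1 / (w - z)) (Q w h - Q z h) - T h) \<le> (K * B * M * cmod (w - z)) * Hs.nrm h)
      \<and> 0 \<le> K * B * M * cmod (w - z)) (at z)"
      using ev
    proof eventually_elim
      case (elim w)
      hence w: "cmod (w - z) < r" "w \<noteq> z" by auto
      show ?case
        using est[OF w] K B M by (auto intro!: Hs.bop_diff Hs.bop_scale bop_Q rho w z T)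
    qed
    have "((\<lambda>w. K * B * M * cmod (w - z)) \<longlongrightarrow> K * B * M * cmod (z - z)) (at z)"
      by (intro tendsto_intros)
    thus "((\<lambda>w. K * B * M * cmod (w - z)) \<longlongrightarrow> 0) (at z)" by simp
  qed
  thus ?thesis unfolding holo_at_def using T by blast
qed

lemma represents_Q:
  assumes "pontryagin sc ip \<mu>" "Im z0 > 0"
  shows "represents sch iph sc ip V A G z0 Q"
  unfolding represents_def hadj_Q_z0
  using assms closed_nondeg selfadj z0_rho G_bounded G_in_V Q_rep by blast

lemma minimal_triplet_iff:
  "minimal_triplet sc ip V A G z0 \<longleftrightarrow> V = kclosure sc ip (cspan sc (\<Gamma>_set \<rho>))"
  unfolding minimal_triplet_def \<Gamma>_set_def \<gamma>_def ..

end

section \<open>Poles of the resolvent\<close>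

lemma Bfun_add:
  fixes f g :: "'a \<Rightarrow> 'b::real_normed_vector"
  assumes "Bfun f F" "Bfun g F"
  shows "Bfun (\<lambda>x. f x + g x) F"
proof -
  obtain K where K: "eventually (\<lambda>x. norm (f x) \<le> K) F" using assms(1) by (auto elim: BfunE)
  obtain L where L: "eventually (\<lambda>x. norm (g x) \<le> L) F" using assms(2) by (auto elim: BfunE)
  have "eventually (\<lambda>x. norm (f x + g x) \<le> K + L) F"
    using K L by eventually_elim (rule norm_add_rule_thm)
  thus ?thesis by (rule BfunI)
qed

lemma Bfun_mult:
  fixes f g :: "'a \<Rightarrow> 'b::real_normed_algebra"
  assumes "Bfun f F" "Bfun g F"
  shows "Bfun (\<lambda>x. f x * g x) F"
proof -
  obtain K where K: "K > 0" "eventually (\<lambda>x. norm (f x) \<le> K) F" using assms(1) by (rule BfunE)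
  obtain L where L: "L > 0" "eventually (\<lambda>x. norm (g x) \<le> L) F" using assms(2) by (rule BfunE)
  have "eventually (\<lambda>x. norm (f x * g x) \<le> K * L) F"
    using K(2) L(2)
    by eventually_elim (use K L in \<open>auto intro!: order_trans[OF norm_mult_ineq] mult_mono\<close>)
  thus ?thesis by (rule BfunI)
qed

lemma tendsto_imp_Bfun:
  fixes f :: "'a \<Rightarrow> 'b::real_normed_vector"
  assumes "(f \<longlongrightarrow> l) F"
  shows "Bfun f F"
proof (rule BfunI)
  show "eventually (\<lambda>x. norm (f x) \<le> norm l + 1) F"
    using tendstoD[OF assms, of 1, simplified]
  proof eventually_elim
    case (elim x)
    thus ?case using norm_triangle_sub[of "f x" l] by (simp add: dist_norm)
  qed
qed

lemma Bfun_diff: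
  fixes f g :: "'a \<Rightarrow> 'b::real_normed_vector"
  assumes "Bfun f F" "Bfun g F"
  shows "Bfun (\<lambda>x. f x - g x) F"
proof -
  have "Bfun (\<lambda>x. - g x) F" using assms(2) unfolding Bfun_def by simp
  from Bfun_add[OF assms(1) this] show ?thesis by simp
qed

lemma Bfun_cong_eventually:
  fixes f g :: "'a \<Rightarrow> 'b::real_normed_vector"
  assumes "eventually (\<lambda>x. f x = g x) F" "Bfun g F"
  shows "Bfun f F"
proof -
  obtain K where K: "eventually (\<lambda>x. norm (g x) \<le> K) F" using assms(2) by (auto elim: BfunE)
  have "eventually (\<lambda>x. norm (f x) \<le> K) F" using assms(1) K by eventually_elim simp
  thus ?thesis by (rule BfunI)
qed

context krein_space begin

lemma closure_sequence:
  assumes "x \<in> kclosure sc ip S"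
  shows "\<exists>s. (\<forall>n::nat. s n \<in> S) \<and> (\<lambda>n. kn (s n - x)) \<longlonglongrightarrow> 0"
proof -
  have "\<forall>n::nat. \<exists>y\<in>S. kn (x - y) < 1 / real (Suc n)"
    using assms unfolding kclosure_def by simp
  then obtain s where s: "\<And>n. s n \<in> S" "\<And>n. kn (x - s n) < 1 / real (Suc n)" by metis
  have "(\<lambda>n. kn (s n - x)) \<longlonglongrightarrow> 0"
  proof (rule tendsto_sandwich[OF _ _ tendsto_const LIMSEQ_inverse_real_of_nat[unfolded inverse_eq_divide]])
    show "eventually (\<lambda>n. 0 \<le> kn (s n - x)) sequentially" by (simp add: kn_nonneg)
    show "eventually (\<lambda>n. kn (s n - x) \<le> 1 / real (Suc n)) sequentially"
      using s(2) kn_minus_commute[of x] by (intro always_eventually allI) (metis less_imp_le)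
  qed
  thus ?thesis using s(1) by blast
qed

lemma tendsto_ip:
  assumes x: "(\<lambda>n. kn (s n - x)) \<longlonglongrightarrow> 0" and y: "(\<lambda>n. kn (t n - y)) \<longlonglongrightarrow> 0"
  shows "(\<lambda>n. ip (s n) (t n)) \<longlonglongrightarrow> ip x y"
proof (rule LIM_zero_cancel, rule Lim_null_comparison)
  show "eventually (\<lambda>n. norm (ip (s n) (t n) - ip x y) \<le>
     kn (s n - x) * (kn y + kn (t n - y)) + kn x * kn (t n - y)) sequentially"
    by (simp add: ip_diff_bound)
  have "(\<lambda>n. kn (s n - x) * (kn y + kn (t n - y)) + kn x * kn (t n - y)) \<longlonglongrightarrow> 0 * (kn y + 0) + kn x * 0"
    by (intro tendsto_intros x y)
  thus "(\<lambda>n. kn (s n - x) * (kn y + kn (t n - y)) + kn x * kn (t n - y)) \<longlonglongrightarrow> 0" by simp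
qed

lemma tendsto_kn:
  assumes x: "(\<lambda>n. kn (s n - x)) \<longlonglongrightarrow> 0"
  shows "(\<lambda>n. kn (s n)) \<longlonglongrightarrow> kn x"
  by (rule LIM_zero_cancel, rule Lim_null_comparison[OF _ x]) (simp add: kn_diff_abs)

end

section \<open>Weak holomorphy of the resolvent and norm bounds at isolated singularities\<close>

context sa_relation begin

lemma resolvent_continuous:
  assumes z: "z \<in> \<rho>"
  obtains r N where "r > 0" "N > 0" "\<And>w. cmod (w - z) < r \<Longrightarrow> w \<in> \<rho>"
    "\<And>w y. cmod (w - z) < r \<Longrightarrow> y \<in> V \<Longrightarrow> kn (R w y - R z y) \<le> N * cmod (w - z) * kn y"
proof -
  obtain r M where r: "r > 0" and M: "M > 0"
    and rho: "\<And>w. cmod (w - z) < r \<Longrightarrow> w \<in> \<rho>" and Mb: "\<And>w y. cmod (w - z) < r \<Longrightarrow> y \<in> V \<Longrightarrow> kn (R w y) \<le> M * kn y"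
    using rho_ball[OF z] by meson
  have "kn (R w y - R z y) \<le> (M * M) * cmod (w - z) * kn y" if w: "cmod (w - z) < r" and y: "y \<in> V" for w y
  proof -
    have "kn (R w y - R z y) = cmod (w - z) * kn (R z (R w y))"
      unfolding resolvent_identity[OF rho[OF w] z y, symmetric] by (rule kn_scale)
    also have "\<dots> \<le> cmod (w - z) * (M * (M * kn y))"
      using M r by (intro mult_left_mono order_trans[OF Mb[of z]] Mb w y R_props(1)[OF rho[OF w]]) auto
    finally show ?thesis by (simp add: mult_ac)
  qed
  thus ?thesis using that[of r "M * M"] r M rho by simp
qed

text \<open>The maximum principle will be applied to scalar functions, so the weak derivative
  [R z (R z x), y] is all that is computed.\<close>

lemma resolvent_holomorphic:
  assumes x: "x \<in> V"
  shows "(\<lambda>w. ip (R w x) y) holomorphic_on \<rho>"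
  unfolding holomorphic_on_def
proof
  fix z assume z: "z \<in> \<rho>"
  obtain r N where r: "r > 0" "N > 0" and rho: "\<And>w. cmod (w - z) < r \<Longrightarrow> w \<in> \<rho>"
    and N: "\<And>w y. cmod (w - z) < r \<Longrightarrow> y \<in> V \<Longrightarrow> kn (R w y - R z y) \<le> N * cmod (w - z) * kn y"
    using resolvent_continuous[OF z] by metis
  obtain B where B: "B > 0" "\<And>y. y \<in> V \<Longrightarrow> kn (R z y) \<le> B * kn y" using R_bounded[OF z] by auto
  let ?D = "ip (R z (R z x)) y"
  note Rzx = R_props(1)[OF z x]
  have "((\<lambda>w. (ip (R w x) y - ip (R z x) y) / (w - z)) \<longlongrightarrow> ?D) (at z)"
  proof (rule LIM_zero_cancel, rule Lim_null_comparison)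
    have "eventually (\<lambda>w. cmod (w - z) < r \<and> w \<noteq> z) (at z)"
      unfolding eventually_at using r by (auto simp: dist_norm)
    thus "eventually (\<lambda>w. norm ((ip (R w x) y - ip (R z x) y) / (w - z) - ?D)
        \<le> B * (N * cmod (w - z) * kn x) * kn y) (at z)"
    proof eventually_elim
      case (elim w)
      hence w: "cmod (w - z) < r" "w - z \<noteq> 0" by auto
      note wr = rho[OF w(1)]
      note Rwx = R_props(1)[OF wr x]
      have "ip (R w x) y - ip (R z x) y = (w - z) * ip (R z (R w x)) y"
        using arg_cong[OF resolvent_identity[OF wr z x], of "\<lambda>v. ip v y"] by (simp add: ip_simps)
      hence "(ip (R w x) y - ip (R z x) y) / (w - z) - ?D = ip (R z (R w x - R z x)) y"
        using w(2) by (simp add: R_diff[OF z Rwx Rzx] ip_simps)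
      also have "cmod \<dots> \<le> kn (R z (R w x - R z x)) * kn y" by (rule ip_bound)
      also have "\<dots> \<le> B * (N * cmod (w - z) * kn x) * kn y"
        by (intro mult_right_mono kn_nonneg order_trans[OF B(2)] mult_left_mono N w x V_diff Rwx Rzx less_imp_le[OF B(1)])
      finally show ?case .
    qed
    have "((\<lambda>w. B * (N * cmod (w - z) * kn x) * kn y) \<longlongrightarrow> B * (N * cmod (z - z) * kn x) * kn y) (at z)"
      by (intro tendsto_intros)
    thus "((\<lambda>w. B * (N * cmod (w - z) * kn x) * kn y) \<longlongrightarrow> 0) (at z)" by simp
  qed
  hence "((\<lambda>w. ip (R w x) y) has_field_derivative ?D) (at z)" by (simp add: has_field_derivative_iff)
  thus "(\<lambda>w. ip (R w x) y) field_differentiable at z within \<rho>"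
    using field_differentiable_at_within field_differentiable_def by blast
qed

text \<open>Finitely many discs of \<open>rho_ball\<close> cover S, and the sum of their bounds is a
  common bound.\<close>

lemma resolvent_bounded_on_compact:
  assumes S: "compact S" "S \<subseteq> \<rho>"
  shows "\<exists>M\<ge>0. \<forall>w\<in>S. \<forall>y\<in>V. kn (R w y) \<le> M * kn y"
proof -
  have "\<forall>z\<in>S. \<exists>r M. r > 0 \<and> M > 0 \<and> (\<forall>w. cmod (w - z) < r \<longrightarrow> (\<forall>y\<in>V. kn (R w y) \<le> M * kn y))"
    using rho_ball S(2) by (meson subsetD)
  then obtain r M where rM: "\<And>z. z \<in> S \<Longrightarrow> r z > 0" "\<And>z. z \<in> S \<Longrightarrow> M z > 0"
    "\<And>z w y. z \<in> S \<Longrightarrow> cmod (w - z) < r z \<Longrightarrow> y \<in> V \<Longrightarrow> kn (R w y) \<le> M z * kn y" by metis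
  have "S \<subseteq> (\<Union>z\<in>S. ball z (r z))" using rM(1) by force
  then obtain F where F: "F \<subseteq> S" "finite F" "S \<subseteq> (\<Union>z\<in>F. ball z (r z))"
    using compactE_image[OF S(1), of S "\<lambda>z. ball z (r z)"] by auto
  have "kn (R w y) \<le> (\<Sum>z\<in>F. M z) * kn y" if w: "w \<in> S" and y: "y \<in> V" for w y
  proof -
    obtain z where z: "z \<in> F" "cmod (w - z) < r z" using F(3) w by (auto simp: dist_norm norm_minus_commute)
    have "kn (R w y) \<le> M z * kn y" using rM(3) z F(1) y by auto
    also have "\<dots> \<le> (\<Sum>z\<in>F. M z) * kn y"
      using z F rM(2) by (intro mult_right_mono kn_nonneg member_le_sum) (auto intro: less_imp_le)
    finally show ?thesis .
  qed
  moreover have "(\<Sum>z\<in>F. M z) \<ge> 0" using F rM(2) by (intro sum_nonneg) (auto intro: less_imp_le)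
  ultimately show ?thesis by blast
qed

text \<open>The maximum principle turns pointwise boundedness of \<open>(w - z)\<^sup>n [R w x, y]\<close> on a dense set of
  \<open>x, y\<close> into a bound that is uniform in \<open>x, y\<close>, since on a circle around \<open>z\<close> the resolvent is bounded.\<close>

lemma resolvent_pole_from_dense:
  assumes r0: "r0 > 0" and punct: "\<And>w. 0 < cmod (w - z) \<Longrightarrow> cmod (w - z) < r0 \<Longrightarrow> w \<in> \<rho>"
    and L: "L \<subseteq> V" "V \<subseteq> kclosure sc ip L"
    and bd: "\<And>x y. x \<in> L \<Longrightarrow> y \<in> L \<Longrightarrow> Bfun (\<lambda>w. (w - z) ^ n * ip (R w x) y) (at z)"
  shows "\<exists>r>0. \<exists>M\<ge>0. \<forall>w. 0 < cmod (w - z) \<and> cmod (w - z) < r \<longrightarrow>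
    w \<in> \<rho> \<and> (\<forall>y\<in>V. cmod (w - z) ^ Suc n * kn (R w y) \<le> M * kn y)"
proof -
  \<comment> \<open>Half the radius keeps the closed disc, and with it the circle of comparison,
    inside the ball of radius r0.\<close>
  define r where "r = r0 / 2"
  have r: "r > 0" "r < r0" using r0 by (auto simp: r_def)
  have sph: "sphere z r \<subseteq> \<rho>"
    using punct r by (auto simp: dist_norm norm_minus_commute)
  obtain M where M: "M \<ge> 0" "\<And>w y. w \<in> sphere z r \<Longrightarrow> y \<in> V \<Longrightarrow> kn (R w y) \<le> M * kn y"
    using resolvent_bounded_on_compact[OF compact_sphere sph] by metis
  define N where "N = r ^ Suc n * M"
  have N0: "N \<ge> 0" using r M by (simp add: N_def)
  have dense: "cmod (w - z) ^ Suc n * cmod (ip (R w x) y) \<le> N * kn x * kn y"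
    if x: "x \<in> L" and y: "y \<in> L" and w: "0 < cmod (w - z)" "cmod (w - z) < r" for x y w
  proof -
    \<comment> \<open>The additional factor w - z makes F tend to 0 at z, since the other factors
      together stay bounded; the singularity is removable with value 0.\<close>
    define F where "F w = (if w = z then 0 else (w - z) ^ Suc n * ip (R w x) y)" for w
    have xV: "x \<in> V" using x L by auto
    have pr: "ball z r0 - {z} \<subseteq> \<rho>"
    proof
      fix v assume "v \<in> ball z r0 - {z}"
      thus "v \<in> \<rho>" using punct[of v] by (simp add: dist_norm norm_minus_commute)
    qed
    have "(\<lambda>w. (w - z) ^ Suc n * ip (R w x) y) holomorphic_on (ball z r0 - {z})"
      by (intro holomorphic_intros holomorphic_on_subset[OF resolvent_holomorphic[OF xV] pr])
    hence hF: "F holomorphic_on (ball z r0 - {z})"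
      by (rule holomorphic_transform) (auto simp: F_def)
    have "continuous_on (ball z r0) F"
      unfolding continuous_on_eq_continuous_at[OF open_ball]
    proof
      fix v assume v: "v \<in> ball z r0"
      show "isCont F v"
      proof (cases "v = z")
        case False
        have "continuous_on (ball z r0 - {z}) F" by (rule holomorphic_on_imp_continuous_on[OF hF])
        thus ?thesis using v False by (simp add: continuous_on_eq_continuous_at open_delete)
      next
        case True
        obtain K where K: "eventually (\<lambda>w. cmod ((w - z) ^ n * ip (R w x) y) \<le> K) (at z)"
          using bd[OF x y] by (auto elim: BfunE)
        have "(F \<longlongrightarrow> 0) (at z)"
        proof (rule Lim_null_comparison)
          have "eventually (\<lambda>w. w \<noteq> z) (at z)" by (simp add: eventually_at_filter)
          with K show "eventually (\<lambda>w. norm (F w) \<le> cmod (w - z) * K) (at z)"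
          proof eventually_elim
            case (elim w)
            have "norm (F w) = cmod (w - z) * cmod ((w - z) ^ n * ip (R w x) y)"
              using elim by (simp add: F_def norm_mult norm_power mult.assoc)
            thus ?case using elim by (simp add: mult_left_mono)
          qed
          have "((\<lambda>w. cmod (w - z) * K) \<longlongrightarrow> cmod (z - z) * K) (at z)" by (intro tendsto_intros)
          thus "((\<lambda>w. cmod (w - z) * K) \<longlongrightarrow> 0) (at z)" by simp
        qed
        thus ?thesis using True by (simp add: isCont_def F_def)
      qed
    qed
    hence holF: "F holomorphic_on ball z r0"
      using no_isolated_singularity[of "ball z r0" F "{z}"] hF by simp
    have sub: "cball z r \<subseteq> ball z r0" using r by auto
    have "norm (F w) \<le> N * kn x * kn y"
    proof (rule maximum_modulus_frontier[of F "cball z r"])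
      show "F holomorphic_on interior (cball z r)"
        by (rule holomorphic_on_subset[OF holF]) (use sub interior_subset in blast)
      show "continuous_on (closure (cball z r)) F"
        using continuous_on_subset[OF holomorphic_on_imp_continuous_on[OF holF] sub] by simp
      show "w \<in> cball z r" using w by (auto simp: dist_norm norm_minus_commute)
      fix v assume "v \<in> frontier (cball z r)"
      hence v: "v \<in> sphere z r" using r by (simp add: frontier_cball)
      hence vr: "cmod (v - z) = r" by (simp add: dist_norm norm_minus_commute)
      have "norm (F v) \<le> r ^ Suc n * cmod (ip (R v x) y)"
        using r vr by (auto simp: F_def norm_mult norm_power)
      also have "\<dots> \<le> r ^ Suc n * (M * kn x * kn y)"
        using r by (intro mult_left_mono order_trans[OF ip_bound] mult_right_mono M v xV kn_nonneg) auto
      finally show "norm (F v) \<le> N * kn x * kn y" by (simp add: N_def mult_ac)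
    qed simp
    thus ?thesis using w by (auto simp: F_def norm_mult norm_power mult.assoc)
  qed
  \<comment> \<open>For fixed w the resolvent is continuous, so the estimate passes from L to its
    closure; N depends on neither w nor x nor y.\<close>
  have all: "cmod (w - z) ^ Suc n * cmod (ip (R w x) y) \<le> N * kn x * kn y"
    if x: "x \<in> V" and y: "y \<in> V" and w: "0 < cmod (w - z)" "cmod (w - z) < r" for x y w
  proof -
    have wr: "w \<in> \<rho>" using punct w r by auto
    obtain B where B: "B > 0" "\<And>y. y \<in> V \<Longrightarrow> kn (R w y) \<le> B * kn y" using R_bounded[OF wr] by auto
    obtain s where s: "\<And>k::nat. s k \<in> L" "(\<lambda>k. kn (s k - x)) \<longlonglongrightarrow> 0" using closure_sequence x L(2) by blast
    obtain t where t: "\<And>k::nat. t k \<in> L" "(\<lambda>k. kn (t k - y)) \<longlonglongrightarrow> 0" using closure_sequence y L(2) by blast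
    have "(\<lambda>k. kn (R w (s k) - R w x)) \<longlonglongrightarrow> 0"
    proof (rule tendsto_sandwich[OF _ _ tendsto_const])
      show "eventually (\<lambda>k. 0 \<le> kn (R w (s k) - R w x)) sequentially" by (simp add: kn_nonneg)
      have "s k \<in> V" for k using s(1) L(1) by blast
      thus "eventually (\<lambda>k. kn (R w (s k) - R w x) \<le> B * kn (s k - x)) sequentially"
        using x by (simp add: B(2) V_diff flip: R_diff[OF wr])
      show "(\<lambda>k. B * kn (s k - x)) \<longlonglongrightarrow> 0" using tendsto_mult_left[OF s(2), of B] by simp
    qed
    from tendsto_ip[OF this t(2)] have 1: "(\<lambda>k. ip (R w (s k)) (t k)) \<longlonglongrightarrow> ip (R w x) y" .
    show ?thesis
    proof (rule LIMSEQ_le)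
      show "(\<lambda>k. cmod (w - z) ^ Suc n * cmod (ip (R w (s k)) (t k))) \<longlonglongrightarrow> cmod (w - z) ^ Suc n * cmod (ip (R w x) y)"
        by (intro tendsto_intros 1)
      show "(\<lambda>k. N * kn (s k) * kn (t k)) \<longlonglongrightarrow> N * kn x * kn y"
        by (intro tendsto_intros tendsto_kn s t)
      show "\<exists>k0. \<forall>k\<ge>k0. cmod (w - z) ^ Suc n * cmod (ip (R w (s k)) (t k)) \<le> N * kn (s k) * kn (t k)"
        using dense s(1) t(1) w by blast
    qed
  qed
  obtain D where D: "D \<ge> 0" "\<And>x. kn (E x) \<le> D * kn x" using E_bounded by auto
  have "cmod (w - z) ^ Suc n * kn (R w y) \<le> N * D * kn y"
    if y: "y \<in> V" and w: "0 < cmod (w - z)" "cmod (w - z) < r" for y w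
  proof -
    have wr: "w \<in> \<rho>" using punct w r by auto
    let ?v = "R w y"
    have vV: "?v \<in> V" by (rule R_props(1)[OF wr y])
    \<comment> \<open>The norm is recovered by testing with J v, and \<open>E\<close> brings this
      test vector back into V, where the estimate for products is available.\<close>
    have "(kn ?v)\<^sup>2 = Re (ip ?v (J ?v))"
      by (simp add: knorm_eq H.nrm_power2) (simp add: hip_def J_sym)
    also have "ip ?v (J ?v) = ip ?v (E (J ?v))" by (simp add: ip_E_right vV)
    finally have "(kn ?v)\<^sup>2 \<le> cmod (ip ?v (E (J ?v)))" using complex_Re_le_cmod by metis
    hence "cmod (w - z) ^ Suc n * (kn ?v)\<^sup>2 \<le> cmod (w - z) ^ Suc n * cmod (ip ?v (E (J ?v)))"
      by (rule mult_left_mono) simp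
    also have "\<dots> \<le> N * kn y * kn (E (J ?v))" by (rule all[OF y E_in_V w])
    also have "\<dots> \<le> N * kn y * (D * kn ?v)"
      using D(2)[of "J ?v"] N0 by (intro mult_left_mono mult_nonneg_nonneg) (auto simp: kn_nonneg)
    finally have le: "kn ?v * (cmod (w - z) ^ Suc n * kn ?v) \<le> kn ?v * (N * D * kn y)"
      by (simp only: power2_eq_square mult_ac)
    show ?thesis
    proof (cases "kn ?v = 0")
      case True thus ?thesis using N0 D kn_nonneg[of y] by simp
    next
      case False
      hence "kn ?v > 0" using kn_nonneg[of ?v] by linarith
      thus ?thesis using le mult_le_cancel_left_pos by blast
    qed
  qed
  moreover have "w \<in> \<rho>" if "0 < cmod (w - z)" "cmod (w - z) < r" for w using punct that r by auto
  ultimately show ?thesis using r N0 D by (intro exI[of _ r] exI[of _ "N * D"] conjI allI impI ballI) auto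
qed

end

section \<open>Poles of the function against poles of the resolvent\<close>

context rep_function begin

text \<open>Near z the function bounds [gamma(w) h, gamma(v) g] through the kernel identity, and
  \<open>\<gamma>_shift\<close> converts this into a bound for the resolvent at w between gamma(u) h
  and gamma(v) g. Minimality makes the span of such vectors dense in V.\<close>

lemma resolvent_pole:
  assumes z: "z \<notin> \<rho>" and r0: "r0 > 0"
    and punct: "\<And>w. 0 < cmod (w - z) \<Longrightarrow> cmod (w - z) < r0 \<Longrightarrow> w \<in> \<rho>"
    and pole: "pole_at sch iph Q z"
    and minimal: "minimal_triplet sc ip V A G z0"
  shows "\<exists>n. \<exists>r>0. \<exists>M\<ge>0. \<forall>w. 0 < cmod (w - z) \<and> cmod (w - z) < r \<longrightarrow>
    w \<in> \<rho> \<and> (\<forall>y\<in>V. cmod (w - z) ^ n * kn (R w y) \<le> M * kn y)"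
proof -
  let ?L = "cspan sc (\<Gamma>_set \<rho>)"
  have LV: "?L \<subseteq> V" by (rule cspan_minimal[OF subspace_V]) (auto simp: \<Gamma>_set_def \<gamma>_in_V)
  have ev: "eventually (\<lambda>w. w \<in> \<rho>) (at z)"
    unfolding eventually_at using r0 punct by (auto simp: dist_norm intro!: exI[of _ r0])
  obtain n T where T: "bop sch iph T"
    and lim: "((\<lambda>w. opnorm iph (\<lambda>h. sch ((w - z) ^ n) (Q w h) - T h)) \<longlongrightarrow> 0) (at z)"
    using pole unfolding pole_at_def by auto
  have QB: "Bfun (\<lambda>w. (w - z) ^ n * iph (Q w h) g) (at z)" for h g
  proof (rule BfunI)
    have "eventually (\<lambda>w. dist (opnorm iph (\<lambda>h. sch ((w - z) ^ n) (Q w h) - T h)) 0 < 1) (at z)"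
      by (rule tendstoD[OF lim]) simp
    with ev show "eventually (\<lambda>w. norm ((w - z) ^ n * iph (Q w h) g) \<le> (1 + opnorm iph T) * Hs.nrm h * Hs.nrm g) (at z)"
    proof eventually_elim
      case (elim w)
      let ?S = "\<lambda>h. sch ((w - z) ^ n) (Q w h) - T h"
      have S: "bop sch iph ?S" by (intro Hs.bop_diff Hs.bop_scale bop_Q elim T)
      have "Hs.nrm (?S h) \<le> opnorm iph ?S * Hs.nrm h" by (rule Hs.opnorm_apply[OF S])
      also have "\<dots> \<le> 1 * Hs.nrm h" using elim by (intro mult_right_mono) auto
      finally have 1: "Hs.nrm (?S h) \<le> Hs.nrm h" by simp
      have "norm ((w - z) ^ n * iph (Q w h) g) = cmod (iph (sch ((w - z) ^ n) (Q w h)) g)" by (simp add: Hs.ip_simps)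
      also have "\<dots> \<le> Hs.nrm (sch ((w - z) ^ n) (Q w h)) * Hs.nrm g" by (rule Hs.cauchy_schwarz)
      also have "\<dots> \<le> (Hs.nrm (T h) + Hs.nrm (?S h)) * Hs.nrm g" by (intro mult_right_mono Hs.nrm_triangle_rev) simp
      also have "\<dots> \<le> ((1 + opnorm iph T) * Hs.nrm h) * Hs.nrm g"
        using 1 Hs.opnorm_apply[OF T, of h] by (intro mult_right_mono) (auto simp: distrib_right)
      finally show ?case .
    qed
  qed
  have pw: "Bfun (\<lambda>w. (w - z) ^ n * c) (at z)" for c :: complex
    by (rule tendsto_imp_Bfun[where l = "(z - z) ^ n * c"]) (intro tendsto_intros)
  have gen: "Bfun (\<lambda>w. (w - z) ^ n * ip (R w (\<gamma> u h)) (\<gamma> v g)) (at z)"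
    if u: "u \<in> \<rho>" and v: "v \<in> \<rho>" for u v h g
  proof -
    note v' = cnj_in_rho[OF v]
    \<comment> \<open>z lies outside the resolvent set, to which u and cnj v belong, so both
      denominators stay away from 0 near z.\<close>
    have uz: "u - z \<noteq> 0" and vz: "z - cnj v \<noteq> 0" using u v' z by auto
    define X where "X = ip (\<gamma> u h) (\<gamma> v g)"
    define c where "c = iph (C h) g + (cnj v - cnj z0) * ip (\<gamma> (cnj v) h) (G g)"
    have "Bfun (\<lambda>w. 1 / (u - w) * ((w - z) ^ n * X - 1 / (w - cnj v) * ((w - z) ^ n * iph (Q w h) g - (w - z) ^ n * c))) (at z)"
    proof (rule Bfun_mult[OF _ Bfun_diff[OF pw Bfun_mult[OF _ Bfun_diff[OF QB pw]]]])
      show "Bfun (\<lambda>w. 1 / (u - w)) (at z)"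
        by (rule tendsto_imp_Bfun[where l = "1 / (u - z)"]) (intro tendsto_intros uz)
      show "Bfun (\<lambda>w. 1 / (w - cnj v)) (at z)"
        by (rule tendsto_imp_Bfun[where l = "1 / (z - cnj v)"]) (intro tendsto_intros vz)
    qed
    moreover have "eventually (\<lambda>w. (w - z) ^ n * ip (R w (\<gamma> u h)) (\<gamma> v g) =
      1 / (u - w) * ((w - z) ^ n * X - 1 / (w - cnj v) * ((w - z) ^ n * iph (Q w h) g - (w - z) ^ n * c))) (at z)"
    proof -
      have e1: "eventually (\<lambda>w. w \<noteq> u) (at z)" using uz by (intro eventually_neq_at_within[of _ _ UNIV, simplified])
      have e2: "eventually (\<lambda>w. w \<noteq> cnj v) (at z)" using vz by (intro eventually_neq_at_within[of _ _ UNIV, simplified])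
      show ?thesis using ev e1 e2
      proof eventually_elim
        case (elim w)
        hence ne: "u - w \<noteq> 0" "w - cnj v \<noteq> 0" by auto
        have "(u - w) * ip (R w (\<gamma> u h)) (\<gamma> v g) = X - ip (\<gamma> w h) (\<gamma> v g)"
          using arg_cong[OF \<gamma>_shift[OF u elim(1)], of "\<lambda>x. ip x (\<gamma> v g)"] by (simp add: ip_simps X_def)
        hence a: "ip (R w (\<gamma> u h)) (\<gamma> v g) = 1 / (u - w) * (X - ip (\<gamma> w h) (\<gamma> v g))"
          using ne by (simp add: field_simps)
        have "(w - cnj v) * ip (\<gamma> w h) (\<gamma> v g) = iph (Q w h) g - c"
          unfolding \<gamma>_kernel[OF elim(1) v] iph_Q[OF elim(1)] c_def by simp
        hence b: "ip (\<gamma> w h) (\<gamma> v g) = 1 / (w - cnj v) * (iph (Q w h) g - c)"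
          using ne by (simp add: field_simps)
        show ?case unfolding a b by (simp only: right_diff_distrib mult_ac)
      qed
    qed
    ultimately show ?thesis by (rule Bfun_cong_eventually[rotated])
  qed
  have left: "Bfun (\<lambda>w. (w - z) ^ n * ip (R w x) (\<gamma> v g)) (at z)" if x: "x \<in> ?L" and v: "v \<in> \<rho>" for x v g
  proof -
    let ?W = "{x \<in> V. Bfun (\<lambda>w. (w - z) ^ n * ip (R w x) (\<gamma> v g)) (at z)}"
    have "csubspace sc ?W"
      unfolding csubspace_def
    proof (intro conjI ballI allI)
      have "eventually (\<lambda>w. (w - z) ^ n * ip (R w 0) (\<gamma> v g) = 0) (at z)"
        using ev by eventually_elim (use R_diff[of _ 0 0] V_zero in auto)
      hence "Bfun (\<lambda>w. (w - z) ^ n * ip (R w 0) (\<gamma> v g)) (at z)"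
        by (rule Bfun_cong_eventually) (rule Bfun_const)
      thus "0 \<in> ?W" using V_zero by simp
    next
      fix x y assume xy: "x \<in> ?W" "y \<in> ?W"
      have "eventually (\<lambda>w. (w - z) ^ n * ip (R w (x + y)) (\<gamma> v g) =
        (w - z) ^ n * ip (R w x) (\<gamma> v g) + (w - z) ^ n * ip (R w y) (\<gamma> v g)) (at z)"
        using ev by eventually_elim (use xy in \<open>auto simp: R_add ip_simps algebra_simps\<close>)
      thus "x + y \<in> ?W" using xy by (auto intro: V_add Bfun_cong_eventually[OF _ Bfun_add])
    next
      fix c x assume x: "x \<in> ?W"
      have "eventually (\<lambda>w. (w - z) ^ n * ip (R w (sc c x)) (\<gamma> v g) = c * ((w - z) ^ n * ip (R w x) (\<gamma> v g))) (at z)"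
        using ev by eventually_elim (use x in \<open>auto simp: R_scale ip_simps\<close>)
      moreover have "Bfun (\<lambda>w. c * ((w - z) ^ n * ip (R w x) (\<gamma> v g))) (at z)"
        using Bfun_mult[OF Bfun_const] x by blast
      ultimately have "Bfun (\<lambda>w. (w - z) ^ n * ip (R w (sc c x)) (\<gamma> v g)) (at z)"
        by (rule Bfun_cong_eventually)
      thus "sc c x \<in> ?W" using V_scale x by blast
    qed
    moreover have "\<Gamma>_set \<rho> \<subseteq> ?W" using gen v \<gamma>_in_V by (auto simp: \<Gamma>_set_def)
    ultimately show ?thesis using cspan_minimal x by blast
  qed
  have both: "Bfun (\<lambda>w. (w - z) ^ n * ip (R w x) y) (at z)" if x: "x \<in> ?L" and y: "y \<in> ?L" for x y
  proof -
    let ?W = "{y. Bfun (\<lambda>w. (w - z) ^ n * ip (R w x) y) (at z)}"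
    have "csubspace sc ?W"
      unfolding csubspace_def
    proof (intro conjI ballI allI)
      fix a b assume "a \<in> ?W" "b \<in> ?W"
      thus "a + b \<in> ?W" using Bfun_add[of "\<lambda>w. (w - z) ^ n * ip (R w x) a" "at z" "\<lambda>w. (w - z) ^ n * ip (R w x) b"]
        by (simp add: ip_simps distrib_left)
    next
      fix c a assume "a \<in> ?W"
      thus "sc c a \<in> ?W" using Bfun_mult[OF Bfun_const, of "\<lambda>w. (w - z) ^ n * ip (R w x) a" "at z" "cnj c"]
        by (simp add: ip_simps mult_ac)
    qed (simp add: Bfun_const)
    moreover have "\<Gamma>_set \<rho> \<subseteq> ?W" using left x by (auto simp: \<Gamma>_set_def)
    ultimately show ?thesis using cspan_minimal y by blast
  qed
  have "V \<subseteq> kclosure sc ip ?L" using minimal unfolding minimal_triplet_iff by simp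
  from resolvent_pole_from_dense[OF r0 punct LV this both] show ?thesis by blast
qed

text \<open>Regular points and poles are brought into one form, with exponent 0 at points of the
  resolvent set, so that no case distinction is left to later arguments.\<close>

lemma resolvent_bound_near_nonreal:
  assumes mer: "meromorphic_nonreal sch iph \<rho> Q" and min: "minimal_triplet sc ip V A G z0" and z: "z \<notin> \<real>"
  shows "\<exists>n. \<exists>r>0. \<exists>M\<ge>0. \<forall>w. 0 < cmod (w - z) \<and> cmod (w - z) < r \<longrightarrow>
    w \<in> \<rho> \<and> (\<forall>y\<in>V. cmod (w - z) ^ n * kn (R w y) \<le> M * kn y)"
proof (cases "z \<in> \<rho>")
  case True
  from rho_ball[OF this] obtain r M where "r > 0" "M > 0"
    "\<And>w. cmod (w - z) < r \<longrightarrow> w \<in> \<rho> \<and> (\<forall>y\<in>V. kn (R w y) \<le> M * kn y)" by blast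
  thus ?thesis by (intro exI[of _ 0] exI[of _ r] exI[of _ M] conjI) auto
next
  case False
  with mer z obtain r where r: "r > 0" "{w. 0 < cmod (w - z) \<and> cmod (w - z) < r} \<subseteq> \<rho>"
    and pole: "pole_at sch iph Q z" unfolding meromorphic_nonreal_def by blast
  show ?thesis by (rule resolvent_pole[OF False r(1) _ pole min]) (use r(2) in blast)
qed

text \<open>\<open>pole_at\<close> admits the limit T = 0, so a bound is enough: one more factor w -
  z turns boundedness into convergence to 0.\<close>

lemma pole_at_from_resolvent_bound:
  assumes r: "r > 0" and M: "M \<ge> 0" and b: "\<And>w. 0 < cmod (w - z) \<Longrightarrow> cmod (w - z) < r \<Longrightarrow>
    w \<in> \<rho> \<and> (\<forall>y\<in>V. cmod (w - z) ^ n * kn (R w y) \<le> M * kn y)"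
  shows "pole_at sch iph Q z"
proof -
  obtain B where B: "B > 0" "\<And>h. kn (G h) \<le> B * Hs.nrm h" using G_bound by auto
  obtain D where D: "D > 0" "\<And>k. Hs.nrm (Gs k) \<le> D * kn k" using Gs_bound by auto
  define c where "c = opnorm iph C"
  have c: "c \<ge> 0" "\<And>h. Hs.nrm (C h) \<le> c * Hs.nrm h"
    unfolding c_def using Hs.opnorm_nonneg[OF C_bop] Hs.opnorm_apply[OF C_bop] by auto
  \<comment> \<open>On the disc of radius 1 around z both \<open>cmod (w - z0)\<close> and
    \<open>cmod (w - cnj z0)\<close> are at most a.\<close>
  define a where "a = cmod (z - z0) + cmod (z - cnj z0) + 1"
  define N where "N = c + a * (D * (B + a * (M * B)))"
  have N: "N \<ge> 0" unfolding N_def a_def using c B D M by (intro add_nonneg_nonneg mult_nonneg_nonneg) auto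
  have est: "Hs.nrm (sch ((w - z) ^ Suc n) (Q w h) - 0) \<le> N * cmod (w - z) * Hs.nrm h"
    if w: "0 < cmod (w - z)" "cmod (w - z) < min r 1" for w h
  proof -
    let ?p = "cmod (w - z) ^ n"
    have wr: "w \<in> \<rho>" and Rw: "?p * kn (R w (G h)) \<le> M * kn (G h)" using b[of w] w G_in_V by auto
    have p1: "?p \<le> 1" "?p \<ge> 0" using w by (auto intro: power_le_one)
    have "cmod (w - u) \<le> cmod (w - z) + cmod (z - u)" for u
      using norm_triangle_ineq[of "w - z" "z - u"] by simp
    from this[of z0] this[of "cnj z0"] w norm_ge_zero[of "z - z0"] norm_ge_zero[of "z - cnj z0"]
    have az0: "cmod (w - z0) \<le> a" and az0': "cmod (w - cnj z0) \<le> a"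
      unfolding a_def by linarith+
    have a0: "a \<ge> 0" by (simp add: a_def)
    have "?p * kn (\<gamma> w h) \<le> ?p * (kn (G h) + cmod (w - z0) * kn (R w (G h)))"
      unfolding \<gamma>_def using p1 by (intro mult_left_mono order_trans[OF kn_triangle]) (auto simp: kn_scale)
    also have "\<dots> = ?p * kn (G h) + cmod (w - z0) * (?p * kn (R w (G h)))" by (simp add: algebra_simps)
    also have "\<dots> \<le> 1 * (B * Hs.nrm h) + a * (M * (B * Hs.nrm h))"
      using p1 a0 M by (intro add_mono mult_mono az0 B order_trans[OF Rw] mult_left_mono) (auto simp: kn_nonneg)
    finally have g: "?p * kn (\<gamma> w h) \<le> (B + a * (M * B)) * Hs.nrm h" by (simp add: algebra_simps)
    have "?p * Hs.nrm (Q w h) \<le> ?p * (Hs.nrm (C h) + cmod (w - cnj z0) * Hs.nrm (Gs (\<gamma> w h)))"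
      unfolding Q_eq[OF wr] using p1 by (intro mult_left_mono order_trans[OF Hs.nrm_triangle]) (auto simp: Hs.nrm_scale)
    also have "\<dots> \<le> ?p * (c * Hs.nrm h + a * (D * kn (\<gamma> w h)))"
      using p1 a0 by (intro mult_left_mono add_mono c mult_mono az0' D) auto
    also have "\<dots> = ?p * (c * Hs.nrm h) + a * (D * (?p * kn (\<gamma> w h)))" by (simp add: algebra_simps)
    also have "\<dots> \<le> 1 * (c * Hs.nrm h) + a * (D * ((B + a * (M * B)) * Hs.nrm h))"
      using p1 a0 c D by (intro add_mono mult_right_mono mult_left_mono g) auto
    finally have "?p * Hs.nrm (Q w h) \<le> N * Hs.nrm h" by (simp add: N_def algebra_simps)
    from mult_left_mono[OF this, of "cmod (w - z)"] show ?thesis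
      by (simp add: Hs.nrm_scale norm_mult norm_power mult_ac)
  qed
  have "eventually (\<lambda>w. 0 < cmod (w - z) \<and> cmod (w - z) < min r 1) (at z)"
    unfolding eventually_at using r by (auto simp: dist_norm intro!: exI[of _ "min r 1"])
  hence "((\<lambda>w. opnorm iph (\<lambda>h. sch ((w - z) ^ Suc n) (Q w h) - 0)) \<longlongrightarrow> 0) (at z)"
  proof (intro Hs.opnorm_tendsto_0I[where g = "\<lambda>w. N * cmod (w - z)"])
    assume "eventually (\<lambda>w. 0 < cmod (w - z) \<and> cmod (w - z) < min r 1) (at z)"
    thus "eventually (\<lambda>w. bop sch iph (\<lambda>h. sch ((w - z) ^ Suc n) (Q w h) - 0) \<and>
      (\<forall>h. Hs.nrm (sch ((w - z) ^ Suc n) (Q w h) - 0) \<le> N * cmod (w - z) * Hs.nrm h) \<and> 0 \<le> N * cmod (w - z)) (at z)"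
    proof eventually_elim
      case (elim w)
      have "bop sch iph (\<lambda>h. sch ((w - z) ^ Suc n) (Q w h))" using b[of w] elim by (intro Hs.bop_scale bop_Q) auto
      thus ?case using est[of w] elim N by auto
    qed
    have "((\<lambda>w. N * cmod (w - z)) \<longlongrightarrow> N * cmod (z - z)) (at z)" by (intro tendsto_intros)
    thus "((\<lambda>w. N * cmod (w - z)) \<longlongrightarrow> 0) (at z)" by simp
  qed
  moreover have "bop sch iph (\<lambda>h. 0)" by (rule Hs.bopI[of _ 0]) auto
  ultimately show ?thesis unfolding pole_at_def by blast
qed

end

section \<open>Reducing subspaces\<close>

context herm_space begin

lemma gram_neg_eigs_add:
  assumes add: "\<And>x y. x \<in> set xs \<Longrightarrow> y \<in> set xs \<Longrightarrow> ip x y = ip (f x) (f y) + ip (g x) (g y)"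
  shows "neg_eigs (gram ip xs) \<le> neg_eigs (gram ip (map f xs)) + neg_eigs (gram ip (map g xs))"
proof -
  have "neg_eigs (gram ip xs) \<le>
    neg_eigs (gram (\<lambda>x y. ip (f x) (f y)) xs) + neg_eigs (gram (\<lambda>x y. ip (g x) (g y)) xs)"
    by (rule gram_subadd) (rule ip_cnj, rule ip_cnj, rule add)
  also have "gram (\<lambda>x y. ip (f x) (f y)) xs = gram ip (map f xs)" by (rule gram_map) simp
  also have "gram (\<lambda>x y. ip (g x) (g y)) xs = gram ip (map g xs)" by (rule gram_map) simp
  finally show ?thesis .
qed

lemma negon_append:
  assumes x: "negon ip xs" and y: "negon ip ys"
    and o: "\<And>a b. a \<in> set xs \<Longrightarrow> b \<in> set ys \<Longrightarrow> ip a b = 0"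
  shows "negon ip (xs @ ys)"
proof -
  have o': "ip b a = 0" if "a \<in> set xs" "b \<in> set ys" for a b
    using o[OF that] ip_cnj[of b a] by simp
  show ?thesis
    unfolding negon_def
  proof (intro allI impI)
    fix i j assume i: "i < length (xs @ ys)" and j: "j < length (xs @ ys)"
    show "ip ((xs @ ys) ! i) ((xs @ ys) ! j) = (if i = j then - 1 else 0)"
    proof (cases "i < length xs"; cases "j < length xs")
      assume "i < length xs" "j < length xs"
      thus ?thesis using x by (simp add: negon_def nth_append)
    next
      assume "i < length xs" "\<not> j < length xs"
      thus ?thesis using o[of "xs ! i" "ys ! (j - length xs)"] j by (auto simp: nth_append)
    next
      assume "\<not> i < length xs" "j < length xs"
      thus ?thesis using o'[of "xs ! j" "ys ! (i - length xs)"] i by (auto simp: nth_append)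
    next
      assume n: "\<not> i < length xs" "\<not> j < length xs"
      hence "i - length xs < length ys" "j - length xs < length ys" using i j by auto
      with y have "ip (ys ! (i - length xs)) (ys ! (j - length xs)) = (if i - length xs = j - length xs then -1 else 0)"
        unfolding negon_def by blast
      moreover have "i - length xs = j - length xs \<longleftrightarrow> i = j" using n by auto
      ultimately show ?thesis using n by (simp add: nth_append)
    qed
  qed
qed

text \<open>A squeeze: appending orthogonal lists gives k1 + k2 \<le> k, and subadditivity along x =
  f x + g x gives the reverse. P1 and P2 need only span the components, because the kernels of the
  summands may live on larger domains.\<close>

lemma neg_squares_orthogonal_sum:
  assumes V: "csubspace sc V1" "csubspace sc V2"
    and orth: "\<And>x y. x \<in> V1 \<Longrightarrow> y \<in> V2 \<Longrightarrow> ip x y = 0"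
    and P: "P1 \<subseteq> V1" "P2 \<subseteq> V2"
    and ns: "neg_squares ip V1 k1" "neg_squares ip V2 k2" "neg_squares ip UNIV k" "neg_squares ip P k"
    and split: "\<And>x. x \<in> cspan sc P \<Longrightarrow> f x \<in> cspan sc P1 \<and> g x \<in> cspan sc P2 \<and> x = f x + g x"
  shows "k1 + k2 = k" "neg_squares ip P1 k1" "neg_squares ip P2 k2"
proof -
  note ns1 = ns(1)[unfolded neg_squares_iff cspan_csubspace[OF V(1)]]
    and ns2 = ns(2)[unfolded neg_squares_iff cspan_csubspace[OF V(2)]]
  have PV: "cspan sc P1 \<subseteq> V1" "cspan sc P2 \<subseteq> V2" by (rule cspan_minimal[OF V(1) P(1)], rule cspan_minimal[OF V(2) P(2)])
  have orth': "ip y x = 0" if "x \<in> V1" "y \<in> V2" for x y using orth[OF that] ip_cnj[of y x] by simp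
  have le: "k1 + k2 \<le> k"
  proof -
    obtain xs where xs: "negon ip xs" "set xs \<subseteq> V1" "length xs = k1" using ns1 by blast
    obtain ys where ys: "negon ip ys" "set ys \<subseteq> V2" "length ys = k2" using ns2 by blast
    have "negon ip (xs @ ys)" by (rule negon_append) (use xs ys orth in auto)
    hence "length (xs @ ys) \<le> k"
      using ns(3)[unfolded neg_squares_iff] negon_imp_negdef cspan_superset[of UNIV sc] by blast
    thus ?thesis using xs ys by simp
  qed
  obtain ys where ys: "negon ip ys" "set ys \<subseteq> cspan sc P" "length ys = k"
    using ns(4)[unfolded neg_squares_iff] by blast
  have "ip x y = ip (f x) (f y) + ip (g x) (g y)" if "x \<in> set ys" "y \<in> set ys" for x y
  proof -
    have "x \<in> cspan sc P" "y \<in> cspan sc P" using that ys by auto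
    with split PV have x: "f x \<in> V1" "g x \<in> V2" "x = f x + g x" and y: "f y \<in> V1" "g y \<in> V2" "y = f y + g y"
      by blast+
    have "ip x y = ip (f x + g x) (f y + g y)" using x(3) y(3) by metis
    thus ?thesis using orth[OF x(1) y(2)] orth'[OF y(1) x(2)] by (simp add: ip_simps)
  qed
  hence "neg_eigs (gram ip ys) \<le> neg_eigs (gram ip (map f ys)) + neg_eigs (gram ip (map g ys))"
    by (rule gram_neg_eigs_add)
  moreover have "length ys \<le> neg_eigs (gram ip ys)"
    by (rule negdef_length_le[OF negon_imp_negdef[OF ys(1)] cspan_superset])
  moreover obtain us where us: "negon ip us" "set us \<subseteq> cspan sc (set (map f ys))" "length us = neg_eigs (gram ip (map f ys))"
    using exists_negon_in_span by blast
  moreover obtain vs where vs: "negon ip vs" "set vs \<subseteq> cspan sc (set (map g ys))" "length vs = neg_eigs (gram ip (map g ys))"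
    using exists_negon_in_span by blast
  moreover have "cspan sc (set (map f ys)) \<subseteq> cspan sc P1" "cspan sc (set (map g ys)) \<subseteq> cspan sc P2"
    by (rule cspan_minimal[OF csubspace_cspan]; use split ys(2) in force)+
  hence us': "set us \<subseteq> cspan sc P1" and vs': "set vs \<subseteq> cspan sc P2" using us vs by auto
  moreover have "length us \<le> k1" using ns1 negon_imp_negdef[OF us(1)] us' PV by blast
  moreover have "length vs \<le> k2" using ns2 negon_imp_negdef[OF vs(1)] vs' PV by blast
  \<comment> \<open>Equality throughout the chain makes us and vs lists of full length inside the
    spans of P1 and P2.\<close>
  ultimately have lens: "k1 + k2 = k" "length us = k1" "length vs = k2" using ys(3) le by auto
  show "k1 + k2 = k" by (rule lens)
  show "neg_squares ip P1 k1" unfolding neg_squares_iff using us us' lens ns1 PV by blast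
  show "neg_squares ip P2 k2" unfolding neg_squares_iff using vs vs' lens ns2 PV by blast
qed

end

text \<open>Only K1 is studied here; the second summand is obtained by interpreting the locale again
  with K1 and K2 exchanged.\<close>

locale reducing_subspace = rep_function sc ip UNIV A sch iph G z0 C Q
  for sc :: "complex \<Rightarrow> 'a::ab_group_add \<Rightarrow> 'a" and ip :: "'a \<Rightarrow> 'a \<Rightarrow> complex" and A
    and sch :: "complex \<Rightarrow> 'h::ab_group_add \<Rightarrow> 'h" and iph :: "'h \<Rightarrow> 'h \<Rightarrow> complex" and G z0 C Q +
  fixes K1 K2 :: "'a set"
  assumes K1: "closed_nondeg_subspace sc ip K1"
    and orth: "x \<in> K1 \<Longrightarrow> y \<in> K2 \<Longrightarrow> ip x y = 0"
    and decomp: "\<exists>a\<in>K1. \<exists>b\<in>K2. k = a + b"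
    and invariant1: "z \<in> \<rho> \<Longrightarrow> y \<in> K1 \<Longrightarrow> resolv sc UNIV A z y \<in> K1"
    and invariant2: "z \<in> \<rho> \<Longrightarrow> y \<in> K2 \<Longrightarrow> resolv sc UNIV A z y \<in> K2"
    and K2: "csubspace sc K2"
begin

lemma orth': "y \<in> K2 \<Longrightarrow> x \<in> K1 \<Longrightarrow> ip y x = 0"
  using orth[of x y] cnj_ip_zero by blast

sublocale P: krein_subspace sc ip K1
proof
  fix k
  obtain a b where "a \<in> K1" "b \<in> K2" "k = a + b" using decomp by blast
  thus "\<exists>v\<in>K1. \<forall>u\<in>K1. ip (k - v) u = 0" by (intro bexI[of _ a]) (auto simp: orth')
qed (rule K1)

lemma E_sum: "a \<in> K1 \<Longrightarrow> b \<in> K2 \<Longrightarrow> P.E (a + b) = a"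
  by (rule P.oproj_eqI) (auto simp: orth')

lemma R_UNIV_props: "z \<in> \<rho> \<Longrightarrow> (R z y, y + sc z (R z y)) \<in> A"
  by (rule R_props(2)) auto

abbreviation A1 :: "('a \<times> 'a) set" where "A1 \<equiv> A \<inter> (K1 \<times> K1)"

lemma R_in_A1: "z \<in> \<rho> \<Longrightarrow> y \<in> K1 \<Longrightarrow> (R z y, y + sc z (R z y)) \<in> A1"
  using R_UNIV_props[of z y] invariant1[of z y] P.V_add[OF _ P.V_scale[OF invariant1]] by blast

sublocale P: sa_relation sc ip K1 "A \<inter> (K1 \<times> K1)"
proof
  \<comment> \<open>A test against A1 must be upgraded to a test against all of A. The resolvent at
    z0 splits any (u, v) in A into a pair of A1 and a pair with both entries in K2, and the latter
    is orthogonal to f and g.\<close>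
  have "(f, g) \<in> A" if f: "f \<in> K1" and g: "g \<in> K1" and s: "\<forall>(u, v)\<in>A1. ip v f = ip u g" for f g
  proof (rule A_memI)
    fix u v assume uv: "(u, v) \<in> A"
    obtain a b where ab: "a \<in> K1" "b \<in> K2" "v - sc z0 u = a + b" using decomp by blast
    have "R z0 (v - sc z0 u) = u" by (rule R_eqI[OF z0_rho]) (use uv in auto)
    hence u: "u = R z0 a + R z0 b" unfolding ab(3) by (simp add: R_add[OF z0_rho])
    have "v = (v - sc z0 u) + sc z0 u" by simp
    hence v: "v = (a + sc z0 (R z0 a)) + (b + sc z0 (R z0 b))"
      unfolding ab(3) by (simp add: u vs.scale_right_distrib algebra_simps)
    have b: "R z0 b \<in> K2" "b + sc z0 (R z0 b) \<in> K2"
      using invariant2[OF z0_rho ab(2)] ab(2) by (auto intro: csubspaceD[OF K2])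
    have "ip v f = ip (a + sc z0 (R z0 a)) f"
      unfolding v using orth'[OF b(2) f] by (simp add: ip_add_left)
    also have "\<dots> = ip (R z0 a) g" using s R_in_A1[OF z0_rho ab(1)] by blast
    also have "\<dots> = ip u g" unfolding u using orth'[OF b(1) g] by (simp add: ip_add_left)
    finally show "ip v f = ip u g" .
  qed auto
  thus "selfadj_rel ip K1 A1" unfolding selfadj_rel_def by (auto intro: A_sym)
qed

text \<open>On the invariant subspace K1 the resolvent of A inverts A1 - z. Only an inclusion is to
  be expected, since the spectrum on K2 counts for A as well.\<close>

lemma
  assumes z: "z \<in> \<rho>"
  shows rho_subset: "z \<in> P.\<rho>" and R_restrict: "y \<in> K1 \<Longrightarrow> P.R z y = R z y"
proof -
  obtain B where B: "\<And>y. kn (R z y) \<le> B * kn y" using R_bounded[OF z] by auto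
  have 1: "R z y \<in> K1 \<and> (R z y, y + sc z (R z y)) \<in> A1" if "y \<in> K1" for y
    using R_in_A1[OF z that] by auto
  have 2: "d = 0" if "(d, sc z d) \<in> A1" for d
  proof -
    have "R z 0 = d" by (rule R_eqI[OF z]) (use that in auto)
    moreover have "R z 0 = 0" using R_diff[OF z, of 0 0] by simp
    ultimately show ?thesis by simp
  qed
  show "z \<in> P.\<rho>" "y \<in> K1 \<Longrightarrow> P.R z y = R z y" using P.rhoI[OF 1 2 B] by auto
qed

text \<open>Both summands are invariant, so \<open>R z\<close> maps each component of x into its own
  summand.\<close>

lemma E_R:
  assumes z: "z \<in> \<rho>"
  shows "P.E (R z x) = R z (P.E x)"
proof -
  obtain a b where ab: "a \<in> K1" "b \<in> K2" "x = a + b" using decomp by blast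
  have "R z x = R z a + R z b" unfolding ab(3) by (rule R_add[OF z]) auto
  thus ?thesis using ab E_sum invariant1[OF z ab(1)] invariant2[OF z ab(2)] by simp
qed

sublocale P: rep_triplet sc ip K1 "A \<inter> (K1 \<times> K1)" sch iph "\<lambda>h. oproj ip K1 (G h)" z0
proof
  obtain D where D: "D \<ge> 0" "\<And>x. kn (P.E x) \<le> D * kn x" using P.E_bounded by auto
  obtain B where B: "\<And>h. kn (G h) \<le> B * Hs.nrm h" using G_bound by auto
  have "kn (P.E (G h)) \<le> D * B * Hs.nrm h" for h
    using order_trans[OF D(2) mult_left_mono[OF B D(1)]] by (simp add: mult.assoc)
  thus "bop_HK sch iph sc ip (\<lambda>h. P.E (G h))"
    unfolding bop_HK_def clinear_def by (auto simp: G_add G_scale P.E_add P.E_scale)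
qed (use P.E_in_V rho_subset[OF z0_rho] in auto)

lemma compressed_\<gamma>:
  assumes z: "z \<in> \<rho>"
  shows "P.\<gamma> z h = P.E (\<gamma> z h)"
  by (simp add: P.\<gamma>_def \<gamma>_def P.E_add P.E_scale E_R[OF z] R_restrict[OF z] P.E_in_V)

text \<open>T leaves room for the resolvent set of A1, which contains that of A. The half-plane sets
  of the kernels and the full sets of the minimality condition are both instances.\<close>

lemma E_cspan:
  assumes S: "S \<subseteq> \<rho>" and x: "x \<in> cspan sc (\<Gamma>_set S)" and ST: "S \<subseteq> T"
  shows "P.E x \<in> cspan sc (P.\<Gamma>_set T)"
proof -
  let ?W = "{x. P.E x \<in> cspan sc (P.\<Gamma>_set T)}"
  have E0: "P.E 0 = 0" using P.E_id[OF P.V_zero] .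
  have "csubspace sc ?W"
    unfolding csubspace_def
    using csubspaceD[OF csubspace_cspan[of sc "P.\<Gamma>_set T"]] by (auto simp: P.E_add P.E_scale E0)
  moreover have "\<Gamma>_set S \<subseteq> ?W"
  proof
    fix y assume "y \<in> \<Gamma>_set S"
    then obtain z h where z: "z \<in> S" "y = \<gamma> z h" by (auto simp: \<Gamma>_set_def)
    hence "P.E y = P.\<gamma> z h" "z \<in> T" using compressed_\<gamma>[of z h] S ST by auto
    hence "P.E y \<in> P.\<Gamma>_set T" unfolding P.\<Gamma>_set_def by blast
    thus "y \<in> ?W" using cspan_superset by blast
  qed
  ultimately show ?thesis using cspan_minimal x by blast
qed

text \<open>A bounded projection maps a dense set onto a dense subset of its range; the divisor
  \<open>D + 1\<close> is positive even if D = 0.\<close>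

lemma compressed_minimal:
  assumes min: "minimal_triplet sc ip UNIV A G z0"
  shows "minimal_triplet sc ip K1 A1 (\<lambda>h. oproj ip K1 (G h)) z0"
proof -
  let ?L = "cspan sc (P.\<Gamma>_set P.\<rho>)"
  have "\<exists>y\<in>?L. kn (x - y) < e" if x: "x \<in> K1" and e: "e > 0" for x e
  proof -
    obtain D where D: "D \<ge> 0" "\<And>x. kn (P.E x) \<le> D * kn x" using P.E_bounded by auto
    have "e / (D + 1) > 0" using e D by simp
    moreover have "x \<in> kclosure sc ip (cspan sc (\<Gamma>_set \<rho>))"
      using min unfolding minimal_triplet_def \<Gamma>_set_def \<gamma>_def by blast
    ultimately obtain y where y: "y \<in> cspan sc (\<Gamma>_set \<rho>)" "kn (x - y) < e / (D + 1)"
      unfolding kclosure_def by blast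
    have "kn (x - P.E y) = kn (P.E (x - y))" using x by (simp add: P.E_diff P.E_id)
    also have "\<dots> \<le> D * kn (x - y)" by (rule D(2))
    also have "\<dots> \<le> (D + 1) * kn (x - y)" by (intro mult_right_mono kn_nonneg) simp
    also have "\<dots> < e" using y(2) D by (simp add: pos_less_divide_eq mult.commute)
    finally have "kn (x - P.E y) < e" .
    moreover have "P.E y \<in> ?L" by (rule E_cspan[OF _ y(1)]) (use rho_subset in auto)
    ultimately show ?thesis by blast
  qed
  hence 1: "K1 \<subseteq> kclosure sc ip ?L" unfolding kclosure_def by blast
  have "?L \<subseteq> K1" by (rule cspan_minimal[OF P.subspace_V]) (auto simp: P.\<Gamma>_set_def P.\<gamma>_in_V)
  hence "kclosure sc ip ?L \<subseteq> kclosure sc ip K1" unfolding kclosure_def by blast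
  with 1 have "K1 = kclosure sc ip ?L" unfolding P.closed_V by blast
  thus ?thesis unfolding minimal_triplet_def P.\<Gamma>_set_def P.\<gamma>_def by simp
qed

end

section \<open>The function attached to a reducing subspace\<close>

locale reducing_subspace_part = reducing_subspace sc ip A sch iph G z0 C Q K1 K2
  for sc :: "complex \<Rightarrow> 'a::ab_group_add \<Rightarrow> 'a" and ip :: "'a \<Rightarrow> 'a \<Rightarrow> complex" and A
    and sch :: "complex \<Rightarrow> 'h::ab_group_add \<Rightarrow> 'h" and iph :: "'h \<Rightarrow> 'h \<Rightarrow> complex" and G z0 C Q K1 K2 +
  fixes S1 :: "'h \<Rightarrow> 'h"
  assumes S1: "bsa sch iph S1"
begin

abbreviation G1 :: "'h \<Rightarrow> 'a" where "G1 \<equiv> \<lambda>h. oproj ip K1 (G h)"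
abbreviation C1 :: "'h \<Rightarrow> 'h" where
  "C1 \<equiv> \<lambda>h. S1 h - sch ((z0 - cnj z0) / 2) (gadj iph ip G1 (G1 h))"
abbreviation Q1 :: "complex \<Rightarrow> 'h \<Rightarrow> 'h" where "Q1 \<equiv> rep_fun sch iph sc ip K1 A1 G1 z0 C1"

lemma S1_bop: "bop sch iph S1" and S1_sym: "iph (S1 x) y = iph x (S1 y)"
  using S1 by (auto simp: bsa_def)

lemma iph_C1: "iph (C1 h) g = iph (S1 h) g - (z0 - cnj z0) / 2 * ip (G1 h) (G1 g)"
  by (simp add: Hs.ip_simps P.Gs_left)

text \<open>The constant term is arranged for \<open>C_adj\<close>: the symmetric S1 contributes
  nothing, and (z0 - cnj z0) / 2 is purely imaginary, so the two copies of the second term add up to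
  the required right side.\<close>

sublocale PQ: rep_function sc ip K1 "A \<inter> (K1 \<times> K1)" sch iph "\<lambda>h. oproj ip K1 (G h)" z0
  "\<lambda>h. S1 h - sch ((z0 - cnj z0) / 2) (gadj iph ip (\<lambda>h. oproj ip K1 (G h)) (oproj ip K1 (G h)))"
  "rep_fun sch iph sc ip K1 (A \<inter> (K1 \<times> K1)) (\<lambda>h. oproj ip K1 (G h)) z0
    (\<lambda>h. S1 h - sch ((z0 - cnj z0) / 2) (gadj iph ip (\<lambda>h. oproj ip K1 (G h)) (oproj ip K1 (G h))))"
proof
  obtain D where D: "D > 0" "\<And>k. Hs.nrm (P.Gs k) \<le> D * kn k" using P.Gs_bound by auto
  obtain B where B: "\<And>h. kn (G1 h) \<le> B * Hs.nrm h" using P.G_bound by auto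
  have "bop sch iph (\<lambda>h. P.Gs (G1 h))"
  proof (rule Hs.bopI[of _ "D * B"])
    fix h show "Hs.nrm (P.Gs (G1 h)) \<le> D * B * Hs.nrm h"
      using order_trans[OF D(2) mult_left_mono[OF B less_imp_le[OF D(1)]]] by (simp add: mult.assoc)
  qed (simp_all only: P.G_add P.G_scale P.Gs_add P.Gs_scale)
  thus "bop sch iph C1" by (intro Hs.bop_diff Hs.bop_scale S1_bop)
  fix g h
  have "cnj (iph (S1 g) h) = iph (S1 h) g" using Hs.ip_cnj[of h "S1 g"] S1_sym[of h g] by simp
  moreover have "cnj (ip (G1 g) (G1 h)) = ip (G1 h) (G1 g)" by (rule ip_cnj[symmetric])
  ultimately show "cnj (iph (C1 g) h) - iph (C1 h) g = (z0 - cnj z0) * ip (G1 h) (G1 g)"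
    unfolding iph_C1 by (simp add: field_simps)
qed simp

text \<open>Near every nonreal point the resolvent of A has a bound of finite order; the bound
  passes to the restriction \<open>P.R\<close> and from there to \<open>Q1\<close>.\<close>

lemma compressed_meromorphic:
  assumes mer: "meromorphic_nonreal sch iph \<rho> Q" and min: "minimal_triplet sc ip UNIV A G z0"
  shows "meromorphic_nonreal sch iph P.\<rho> Q1"
  unfolding meromorphic_nonreal_def
proof (intro conjI ballI allI impI; (elim conjE)?)
  fix z assume z: "z \<notin> \<real>" "z \<notin> P.\<rho>"
  obtain n r M where r: "r > 0" "M \<ge> 0" and b: "\<And>w. 0 < cmod (w - z) \<and> cmod (w - z) < r \<Longrightarrow>
    w \<in> \<rho> \<and> (\<forall>y\<in>UNIV. cmod (w - z) ^ n * kn (R w y) \<le> M * kn y)"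
    using resolvent_bound_near_nonreal[OF mer min z(1)] by blast
  from r(1) b rho_subset show "\<exists>r>0. {w. 0 < cmod (w - z) \<and> cmod (w - z) < r} \<subseteq> P.\<rho>" by blast
  show "pole_at sch iph Q1 z"
  proof (rule PQ.pole_at_from_resolvent_bound[OF r])
    fix w assume "0 < cmod (w - z)" "cmod (w - z) < r"
    with b[of w] show "w \<in> P.\<rho> \<and> (\<forall>y\<in>K1. cmod (w - z) ^ n * kn (P.R w y) \<le> M * kn y)"
      by (auto simp: R_restrict rho_subset)
  qed
qed (use P.open_rho PQ.bop_Q PQ.holo_Q in auto)

lemma compressed_minimal_rep:
  assumes "pontryagin sc ip \<mu>" "Im z0 > 0" "minimal_triplet sc ip UNIV A G z0"
  shows "minimal_rep sch iph sc ip K1 A1 G1 z0 Q1"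
  unfolding minimal_rep_def
  using PQ.represents_Q[OF assms(1,2)] compressed_minimal[OF assms(3)] by blast

lemma compressed_Nkappa:
  assumes mer: "meromorphic_nonreal sch iph \<rho> Q" and min: "minimal_triplet sc ip UNIV A G z0"
    and ns: "neg_squares ip (P.\<Gamma>_set (P.\<rho> \<inter> {z. Im z > 0})) k"
  shows "Nkappa sch iph k P.\<rho> Q1"
  unfolding Nkappa_def
proof (intro conjI ballI)
  fix z assume z: "z \<in> P.\<rho>"
  show z': "cnj z \<in> P.\<rho>" by (rule P.cnj_in_rho[OF z])
  show "hadj iph (Q1 (cnj z)) = Q1 z" using PQ.hadj_Q[OF z'] by simp
qed (use compressed_meromorphic[OF mer min] PQ.neg_squares_kernel ns in auto)

end

text \<open>\<open>Nkappa\<close> makes the constant term bounded, because it identifies the adjoint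
  of Q(z0) with Q at the conjugate point; the representation at z0 itself supplies
  \<open>C_adj\<close>.\<close>

lemma rep_functionI:
  assumes H: "hilbert sch iph" and nk: "Nkappa sch iph \<kappa> (rho sc ip UNIV A) Q"
    and rep: "represents sch iph sc ip UNIV A G z0 Q"
  shows "rep_function sc ip UNIV A sch iph G z0 (hadj iph (Q z0)) Q"
proof -
  interpret krein_space sc ip
    by unfold_locales (use rep in \<open>auto simp: represents_def pontryagin_def\<close>)
  have "\<exists>v\<in>UNIV. \<forall>u\<in>UNIV. ip (k - v) u = 0" for k
    by (rule bexI[of _ k]) auto
  then interpret rep_triplet sc ip UNIV A sch iph G z0
    by unfold_locales (use H rep in \<open>auto simp: represents_def\<close>)
  show ?thesis
  proof
    have z0': "cnj z0 \<in> \<rho>" "hadj iph (Q (cnj (cnj z0))) = Q (cnj z0)"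
      using nk z0_rho unfolding Nkappa_def by blast+
    have bop: "bop sch iph (Q z)" if "z \<in> \<rho>" for z
      using nk that unfolding Nkappa_def meromorphic_nonreal_def by blast
    show "bop sch iph (hadj iph (Q z0))" using z0' bop by simp
    show Q: "Q z h = rep_fun sch iph sc ip UNIV A G z0 (hadj iph (Q z0)) z h" if "z \<in> \<rho>" for z h
      using rep that unfolding represents_def by blast
    fix g h
    have "cnj (iph (hadj iph (Q z0) g) h) = iph (Q z0 h) g"
      using Hs.ip_cnj[of h "hadj iph (Q z0) g"] Hs.hadj_eq[OF bop[OF z0_rho], of h g] by simp
    also have "\<dots> = iph (hadj iph (Q z0) h) g + (z0 - cnj z0) * ip (G h) (G g)"
      by (subst Q[OF z0_rho]) (simp add: rep_fun_def Hs.ip_simps Gs_left)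
    finally show "cnj (iph (hadj iph (Q z0) g) h) - iph (hadj iph (Q z0) h) g = (z0 - cnj z0) * ip (G h) (G g)"
      by simp
  qed
qed

section \<open>Both summands together: the decomposition of part (i)\<close>

theorem reducing_decomposition:
  fixes sch :: "complex \<Rightarrow> 'h::ab_group_add \<Rightarrow> 'h" and sck :: "complex \<Rightarrow> 'k::ab_group_add \<Rightarrow> 'k"
  assumes H: "hilbert sch iph" and po: "pontryagin sck ipk \<kappa>"
    and nk: "Nkappa sch iph \<kappa> (rho sck ipk UNIV A) Q"
    and min: "minimal_rep sch iph sck ipk UNIV A G z0 Q"
    and K: "closed_nondeg_subspace sck ipk K1" "closed_nondeg_subspace sck ipk K2"
    and orth: "\<forall>x\<in>K1. \<forall>y\<in>K2. ipk x y = 0" and dec: "\<forall>k. \<exists>a\<in>K1. \<exists>b\<in>K2. k = a + b"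
    and inv1: "\<forall>z\<in>rho sck ipk UNIV A. \<forall>y\<in>K1. resolv sck UNIV A z y \<in> K1"
    and inv2: "\<forall>z\<in>rho sck ipk UNIV A. \<forall>y\<in>K2. resolv sck UNIV A z y \<in> K2"
    and ns: "neg_squares ipk K1 \<kappa>1" "neg_squares ipk K2 \<kappa>2"
    and S: "bsa sch iph S1" "bsa sch iph S2"
    and Ssum: "\<forall>h. S1 h + S2 h = sch (1/2) (Q z0 h + hadj iph (Q z0) h)"
  defines "A1 \<equiv> A \<inter> (K1 \<times> K1)" and "A2 \<equiv> A \<inter> (K2 \<times> K2)"
    and "G1 \<equiv> \<lambda>h. oproj ipk K1 (G h)" and "G2 \<equiv> \<lambda>h. oproj ipk K2 (G h)"
  defines "Q1 \<equiv> rep_fun sch iph sck ipk K1 A1 G1 z0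
                  (\<lambda>h. S1 h - sch ((z0 - cnj z0) / 2) (gadj iph ipk G1 (G1 h)))"
    and "Q2 \<equiv> rep_fun sch iph sck ipk K2 A2 G2 z0
                  (\<lambda>h. S2 h - sch ((z0 - cnj z0) / 2) (gadj iph ipk G2 (G2 h)))"
  shows "Nkappa sch iph \<kappa>1 (rho sck ipk K1 A1) Q1" "minimal_rep sch iph sck ipk K1 A1 G1 z0 Q1"
    "Nkappa sch iph \<kappa>2 (rho sck ipk K2 A2) Q2" "minimal_rep sch iph sck ipk K2 A2 G2 z0 Q2"
    "\<forall>z\<in>rho sck ipk UNIV A. \<forall>h. Q z h = Q1 z h + Q2 z h" "\<kappa>1 + \<kappa>2 = \<kappa>"
proof -
  have rep: "represents sch iph sck ipk UNIV A G z0 Q" and mint: "minimal_triplet sck ipk UNIV A G z0"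
    using min by (auto simp: minimal_rep_def)
  have Im0: "Im z0 > 0" using rep by (auto simp: represents_def)
  have mer: "meromorphic_nonreal sch iph (rho sck ipk UNIV A) Q" using nk by (auto simp: Nkappa_def)
  interpret O: rep_function sck ipk UNIV A sch iph G z0 "hadj iph (Q z0)" Q
    by (rule rep_functionI[OF H nk rep])
  have cs: "csubspace sck K1" "csubspace sck K2" using K by (auto simp: closed_nondeg_subspace_def)
  have orth2: "ipk x y = 0" if "x \<in> K2" "y \<in> K1" for x y using orth that O.cnj_ip_zero by blast
  have dec2: "\<exists>a\<in>K2. \<exists>b\<in>K1. k = a + b" for k using dec by (metis add.commute)
  interpret X1: reducing_subspace_part sck ipk A sch iph G z0 "hadj iph (Q z0)" Q K1 K2 S1
    by unfold_locales (use K cs orth dec inv1 inv2 S in auto)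
  interpret X2: reducing_subspace_part sck ipk A sch iph G z0 "hadj iph (Q z0)" Q K2 K1 S2
    by unfold_locales (use K cs orth2 dec2 inv1 inv2 S in auto)
  have Esum: "x = X1.P.E x + X2.P.E x" for x
  proof -
    obtain a b where ab: "a \<in> K1" "b \<in> K2" "x = a + b" using dec by blast
    show ?thesis using X1.E_sum[OF ab(1,2)] X2.E_sum[OF ab(2,1)] ab(3) by (simp add: add.commute)
  qed
  let ?C = "{z. Im z > 0}"
  let ?P = "O.\<Gamma>_set (O.\<rho> \<inter> ?C)"
    and ?P1 = "X1.P.\<Gamma>_set (X1.P.\<rho> \<inter> ?C)" and ?P2 = "X2.P.\<Gamma>_set (X2.P.\<rho> \<inter> ?C)"
  have nsU: "neg_squares ipk UNIV \<kappa>" using po by (simp add: pontryagin_def)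
  have nsP: "neg_squares ipk ?P \<kappa>"
    using nk O.neg_squares_kernel unfolding Nkappa_def by blast
  have P1: "?P1 \<subseteq> K1" by (auto simp: X1.P.\<Gamma>_set_def X1.P.\<gamma>_in_V)
  have P2: "?P2 \<subseteq> K2" by (auto simp: X2.P.\<Gamma>_set_def X2.P.\<gamma>_in_V)
  have split: "X1.P.E x \<in> cspan sck ?P1 \<and> X2.P.E x \<in> cspan sck ?P2 \<and> x = X1.P.E x + X2.P.E x"
    if "x \<in> cspan sck ?P" for x
  proof (intro conjI)
    show "X1.P.E x \<in> cspan sck ?P1" by (rule X1.E_cspan[OF _ that]) (use X1.rho_subset in auto)
    show "X2.P.E x \<in> cspan sck ?P2" by (rule X2.E_cspan[OF _ that]) (use X2.rho_subset in auto)
  qed (rule Esum)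
  have o: "ipk x y = 0" if "x \<in> K1" "y \<in> K2" for x y using orth that by blast
  note dim = O.neg_squares_orthogonal_sum[OF cs o P1 P2 ns nsU nsP split]
  show "\<kappa>1 + \<kappa>2 = \<kappa>" by (rule dim)
  show "Nkappa sch iph \<kappa>1 (rho sck ipk K1 A1) Q1" unfolding Q1_def A1_def G1_def
    by (rule X1.compressed_Nkappa[OF mer mint dim(2)])
  show "Nkappa sch iph \<kappa>2 (rho sck ipk K2 A2) Q2" unfolding Q2_def A2_def G2_def
    by (rule X2.compressed_Nkappa[OF mer mint dim(3)])
  show "minimal_rep sch iph sck ipk K1 A1 G1 z0 Q1" unfolding Q1_def A1_def G1_def
    by (rule X1.compressed_minimal_rep[OF po Im0 mint])
  show "minimal_rep sch iph sck ipk K2 A2 G2 z0 Q2" unfolding Q2_def A2_def G2_def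
    by (rule X2.compressed_minimal_rep[OF po Im0 mint])
  show "\<forall>z\<in>rho sck ipk UNIV A. \<forall>h. Q z h = Q1 z h + Q2 z h"
  proof (intro ballI allI)
    fix z h assume z: "z \<in> O.\<rho>"
    have ips: "ipk x y = ipk (X1.P.E x) (X1.P.E y) + ipk (X2.P.E x) (X2.P.E y)" for x y
    proof -
      have "ipk x y = ipk (X1.P.E x) y + ipk (X2.P.E x) y" by (subst Esum) (rule O.ip_add_left)
      thus ?thesis using X1.P.ip_E_right[OF X1.P.E_in_V] X2.P.ip_E_right[OF X2.P.E_in_V] by simp
    qed
    \<comment> \<open>After testing against g the operators \<open>gadj\<close> disappear, and the
      products in K1 and K2 add up by \<open>ips\<close>, since gamma of each summand is the
      projection of gamma.\<close>
    have "iph (Q z h) g = iph (Q1 z h + Q2 z h) g" for g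
    proof -
      let ?t = "(z0 - cnj z0) * ipk (G h) (G g)"
      have "iph (Q z0 h) g = iph (hadj iph (Q z0) h) g + ?t"
        using O.iph_Q[OF O.z0_rho, of h g] by (simp add: O.\<gamma>_z0)
      moreover have "iph (S1 h) g + iph (S2 h) g = (iph (Q z0 h) g + iph (hadj iph (Q z0) h) g) / 2"
        using arg_cong[OF Ssum[rule_format, of h], of "\<lambda>x. iph x g"] by (simp add: O.Hs.ip_simps)
      \<comment> \<open>S1 + S2 is half the sum of Q(z0) and its adjoint, and ?t is their
        difference; so the adjoint equals S1 + S2 minus half of ?t.\<close>
      ultimately have Cs: "iph (hadj iph (Q z0) h) g = iph (S1 h) g + iph (S2 h) g - ?t / 2"
        by (simp add: field_simps)
      have "iph (Q1 z h + Q2 z h) g = iph (Q1 z h) g + iph (Q2 z h) g" by (rule O.Hs.ip_add_left)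
      also have "\<dots> = iph (X1.C1 h) g + (z - cnj z0) * ipk (X1.P.E (O.\<gamma> z h)) (X1.P.E (G g))
        + (iph (X2.C1 h) g + (z - cnj z0) * ipk (X2.P.E (O.\<gamma> z h)) (X2.P.E (G g)))"
        unfolding Q1_def Q2_def A1_def A2_def G1_def G2_def
        using X1.PQ.iph_Q[OF X1.rho_subset[OF z], of h g] X2.PQ.iph_Q[OF X2.rho_subset[OF z], of h g]
        by (simp only: X1.compressed_\<gamma>[OF z] X2.compressed_\<gamma>[OF z])
      also have "\<dots> = iph (S1 h) g + iph (S2 h) g - ?t / 2 + (z - cnj z0) * ipk (O.\<gamma> z h) (G g)"
        unfolding X1.iph_C1 X2.iph_C1 ips[of "O.\<gamma> z h"] ips[of "G h"] by (simp add: field_simps)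
      also have "\<dots> = iph (Q z h) g" unfolding O.iph_Q[OF z] Cs ..
      finally show ?thesis ..
    qed
    thus "Q z h = Q1 z h + Q2 z h" by (rule O.Hs.ip_cong_left)
  qed
qed

section \<open>Direct sums\<close>

lemma ipnorm_pip_bounds:
  assumes 1: "hilbert s1 i1" and 2: "hilbert s2 i2"
  shows "ipnorm (pip i1 i2) x \<le> ipnorm i1 (fst x) + ipnorm i2 (snd x)"
    "ipnorm i1 (fst x) \<le> ipnorm (pip i1 i2) x" "ipnorm i2 (snd x) \<le> ipnorm (pip i1 i2) x"
proof -
  interpret H1: hilb s1 i1 by unfold_locales (rule 1)
  interpret H2: hilb s2 i2 by unfold_locales (rule 2)
  have e: "ipnorm (pip i1 i2) x = sqrt ((H1.nrm (fst x))\<^sup>2 + (H2.nrm (snd x))\<^sup>2)"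
    by (simp add: ipnorm_def[of "pip i1 i2"] pip_def H1.nrm_power2 H2.nrm_power2)
  show "ipnorm (pip i1 i2) x \<le> ipnorm i1 (fst x) + ipnorm i2 (snd x)"
    unfolding e by (rule sqrt_sum_squares_le_sum) auto
  show "ipnorm i1 (fst x) \<le> ipnorm (pip i1 i2) x" "ipnorm i2 (snd x) \<le> ipnorm (pip i1 i2) x"
    unfolding e by (auto intro: real_le_rsqrt)
qed

lemma hermitian_form_pip:
  assumes 1: "hermitian_form s1 i1" and 2: "hermitian_form s2 i2"
  shows "hermitian_form (psc s1 s2) (pip i1 i2)"
proof -
  interpret H1: herm_space s1 i1 by unfold_locales (rule 1)
  interpret H2: herm_space s2 i2 by unfold_locales (rule 2)
  have "vector_space (psc s1 s2)"
    by unfold_locales (auto simp: psc_def H1.vs.scale_right_distrib H2.vs.scale_right_distrib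
      H1.vs.scale_left_distrib H2.vs.scale_left_distrib)
  moreover have "pip i1 i2 y x = cnj (pip i1 i2 x y)" for x y
  proof -
    have "i1 (fst y) (fst x) = cnj (i1 (fst x) (fst y))" by (rule H1.ip_cnj)
    moreover have "i2 (snd y) (snd x) = cnj (i2 (snd x) (snd y))" by (rule H2.ip_cnj)
    ultimately show ?thesis by (simp only: pip_def complex_cnj_add)
  qed
  moreover have "pip i1 i2 (x + y) z = pip i1 i2 x z + pip i1 i2 y z"
    "pip i1 i2 (psc s1 s2 c x) y = c * pip i1 i2 x y" for x y z c
    by (simp_all add: pip_def psc_def H1.ip_simps H2.ip_simps algebra_simps)
  ultimately show ?thesis unfolding hermitian_form_def by blast
qed

lemma hilbert_pip:
  assumes 1: "hilbert s1 i1" and 2: "hilbert s2 i2"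
  shows "hilbert (psc s1 s2) (pip i1 i2)"
proof -
  interpret H1: hilb s1 i1 by unfold_locales (rule 1)
  interpret H2: hilb s2 i2 by unfold_locales (rule 2)
  note b = ipnorm_pip_bounds[OF 1 2]
  let ?n = "ipnorm (pip i1 i2)"
  have cs: "csubspace (psc s1 s2) UNIV" by (simp add: csubspace_def)
  have real: "pip i1 i2 x x = of_real ((H1.nrm (fst x))\<^sup>2 + (H2.nrm (snd x))\<^sup>2)" for x
    by (simp only: pip_def H1.ip_self H2.ip_self of_real_add)
  have pos: "pip i1 i2 x x \<in> \<real> \<and> Re (pip i1 i2 x x) \<ge> 0 \<and> (pip i1 i2 x x = 0 \<longrightarrow> x = 0)" for x
  proof (intro conjI impI)
    assume "pip i1 i2 x x = 0"
    hence "(H1.nrm (fst x))\<^sup>2 + (H2.nrm (snd x))\<^sup>2 = 0" unfolding real by (simp only: of_real_eq_0_iff)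
    hence "H1.nrm (fst x) = 0" "H2.nrm (snd x) = 0" by (auto simp: add_nonneg_eq_0_iff)
    thus "x = 0" by (simp add: prod_eq_iff)
  qed (auto simp: real)
  have comp: "\<exists>l\<in>UNIV. (\<lambda>n. ?n (s n - l)) \<longlonglongrightarrow> 0"
    if c: "\<forall>e>0. \<exists>N. \<forall>m\<ge>N. \<forall>n\<ge>N. ?n (s m - s n) < e" for s :: "nat \<Rightarrow> 'a \<times> 'b"
  proof -
    have "\<exists>N. \<forall>m\<ge>N. \<forall>n\<ge>N. H1.nrm (fst (s m) - fst (s n)) < e" if "e > 0" for e
      using c[rule_format, OF that] b(2)[of "s _ - s _"] by (metis fst_diff le_less_trans)
    from H1.nrm_complete[OF this] obtain l1 where l1: "(\<lambda>n. H1.nrm (fst (s n) - l1)) \<longlonglongrightarrow> 0" by blast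
    have "\<exists>N. \<forall>m\<ge>N. \<forall>n\<ge>N. H2.nrm (snd (s m) - snd (s n)) < e" if "e > 0" for e
      using c[rule_format, OF that] b(3)[of "s _ - s _"] by (metis snd_diff le_less_trans)
    from H2.nrm_complete[OF this] obtain l2 where l2: "(\<lambda>n. H2.nrm (snd (s n) - l2)) \<longlonglongrightarrow> 0" by blast
    have "(\<lambda>n. ?n (s n - (l1, l2))) \<longlonglongrightarrow> 0"
    proof (rule tendsto_sandwich[OF _ _ tendsto_const])
      show "(\<lambda>n. H1.nrm (fst (s n) - l1) + H2.nrm (snd (s n) - l2)) \<longlonglongrightarrow> 0"
        using tendsto_add[OF l1 l2] by simp
      show "eventually (\<lambda>n. ?n (s n - (l1, l2)) \<le> H1.nrm (fst (s n) - l1) + H2.nrm (snd (s n) - l2)) sequentially"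
        using b(1)[of "s _ - (l1, l2)"] by simp
      show "eventually (\<lambda>n. 0 \<le> ?n (s n - (l1, l2))) sequentially"
        using order_trans[OF H1.nrm_nonneg b(2)] by simp
    qed
    thus ?thesis by blast
  qed
  show ?thesis
    unfolding hilbert_def hilbert_on_def
    by (intro conjI ballI allI impI hermitian_form_pip[OF H1.hermitian H2.hermitian] cs comp)
       (use pos in blast)+
qed

section \<open>Orthogonal sums of Krein spaces\<close>

locale krein_pair = X1: krein_space sc1 ip1 + X2: krein_space sc2 ip2
  for sc1 :: "complex \<Rightarrow> 'a::ab_group_add \<Rightarrow> 'a" and ip1 and sc2 :: "complex \<Rightarrow> 'b::ab_group_add \<Rightarrow> 'b" and ip2
begin

lemma fund_sym_pair: "fund_sym (psc sc1 sc2) (pip ip1 ip2) (map_prod X1.J X2.J)"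
proof -
  have "(\<lambda>x y. pip ip1 ip2 (map_prod X1.J X2.J x) y) = pip X1.hip X2.hip"
    by (auto simp: fun_eq_iff pip_def X1.hip_def X2.hip_def)
  moreover have "hilbert (psc sc1 sc2) (pip X1.hip X2.hip)"
    by (rule hilbert_pip[OF X1.H.hilbert X2.H.hilbert])
  ultimately have hil: "hilbert (psc sc1 sc2) (\<lambda>x y. pip ip1 ip2 (map_prod X1.J X2.J x) y)" by simp
  show ?thesis
    unfolding fund_sym_def
  proof (intro conjI allI)
    show "hilbert (psc sc1 sc2) (\<lambda>x y. pip ip1 ip2 (map_prod X1.J X2.J x) y)" by (rule hil)
  qed (use X1.fund_sym_J X2.fund_sym_J in \<open>auto simp: fund_sym_def pip_def psc_def prod_eq_iff\<close>)
qed

sublocale P: krein_space "psc sc1 sc2" "pip ip1 ip2"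
  using fund_sym_pair hermitian_form_pip[OF X1.hermitian X2.hermitian]
  by unfold_locales (auto simp: krein_def)

text \<open>The norm of the pair space refers to its own choice of fundamental symmetry, which need
  not be \<open>map_prod X1.J X2.J\<close>. \<open>fund_sym_norm_equiv\<close>, used in both
  directions, compares it with the norm of the product symmetry.\<close>

lemma knorm_pair_bounds:
  "\<exists>c>0. \<forall>x. P.kn x \<le> c * (X1.kn (fst x) + X2.kn (snd x)) \<and> X1.kn (fst x) \<le> c * P.kn x \<and> X2.kn (snd x) \<le> c * P.kn x"
proof -
  let ?n = "ipnorm (pip X1.hip X2.hip)"
  have hp: "(\<lambda>x y. pip ip1 ip2 (map_prod X1.J X2.J x) y) = pip X1.hip X2.hip"
    by (auto simp: fun_eq_iff pip_def X1.hip_def X2.hip_def)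
  have kn: "P.kn = ipnorm (\<lambda>x y. pip ip1 ip2 (P.J x) y)"
    unfolding P.knorm_eq P.hip_def[abs_def] ..
  obtain a where a: "a \<ge> 0" "\<And>x. P.kn x \<le> a * ?n x"
    using fund_sym_norm_equiv[OF P.hermitian P.fund_sym_J fund_sym_pair] unfolding kn hp by blast
  obtain b where b: "b \<ge> 0" "\<And>x. ?n x \<le> b * P.kn x"
    using fund_sym_norm_equiv[OF P.hermitian fund_sym_pair P.fund_sym_J] unfolding kn hp by blast
  note n = ipnorm_pip_bounds[OF X1.H.hilbert X2.H.hilbert, folded X1.knorm_eq X2.knorm_eq]
  let ?c = "a + b + 1"
  have "P.kn x \<le> ?c * (X1.kn (fst x) + X2.kn (snd x))" for x
  proof -
    have "P.kn x \<le> a * (X1.kn (fst x) + X2.kn (snd x))"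
      by (rule order_trans[OF a(2)]) (intro mult_left_mono n a)
    also have "\<dots> \<le> ?c * (X1.kn (fst x) + X2.kn (snd x))"
      using b by (intro mult_right_mono add_nonneg_nonneg X1.kn_nonneg X2.kn_nonneg) simp
    finally show ?thesis .
  qed
  moreover have "?n x \<le> ?c * P.kn x" for x
    by (rule order_trans[OF b(2)]) (intro mult_right_mono P.kn_nonneg, use a in simp)
  hence "X1.kn (fst x) \<le> ?c * P.kn x" "X2.kn (snd x) \<le> ?c * P.kn x" for x
    using n(2,3)[of x] order_trans by blast+
  moreover have "?c > 0" using a b by simp
  ultimately show ?thesis by blast
qed

lemma gram_pair_le:
  "neg_eigs (gram (pip ip1 ip2) xs) \<le> neg_eigs (gram ip1 (map fst xs)) + neg_eigs (gram ip2 (map snd xs))"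
proof -
  have "neg_eigs (gram (pip ip1 ip2) xs) \<le>
    neg_eigs (gram (\<lambda>x y. ip1 (fst x) (fst y)) xs) + neg_eigs (gram (\<lambda>x y. ip2 (snd x) (snd y)) xs)"
  proof (rule gram_subadd)
    show "ip1 (fst q) (fst p) = cnj (ip1 (fst p) (fst q))" for p q by (rule X1.ip_cnj)
    show "ip2 (snd q) (snd p) = cnj (ip2 (snd p) (snd q))" for p q by (rule X2.ip_cnj)
  qed (simp add: pip_def)
  also have "gram (\<lambda>x y. ip1 (fst x) (fst y)) xs = gram ip1 (map fst xs)" by (rule gram_map) simp
  also have "gram (\<lambda>x y. ip2 (snd x) (snd y)) xs = gram ip2 (map snd xs)" by (rule gram_map) simp
  finally show ?thesis .
qed

text \<open>Subadditivity bounds the index from above; lists from the two factors, padded with 0 and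
  appended, reach the bound.\<close>

lemma neg_squares_pair:
  assumes 1: "neg_squares ip1 UNIV k1" and 2: "neg_squares ip2 UNIV k2"
  shows "neg_squares (pip ip1 ip2) UNIV (k1 + k2)"
proof -
  have le: "neg_eigs (gram (pip ip1 ip2) xs) \<le> k1 + k2" for xs
    using gram_pair_le[of xs] 1 2 unfolding neg_squares_def by (meson add_mono order_trans subset_UNIV)
  obtain xs where xs: "negon ip1 xs" "length xs = k1" using 1 unfolding X1.neg_squares_iff by blast
  obtain ys where ys: "negon ip2 ys" "length ys = k2" using 2 unfolding X2.neg_squares_iff by blast
  let ?zs = "map (\<lambda>x. (x, 0)) xs @ map (\<lambda>y. (0, y)) ys"
  have "negon (pip ip1 ip2) ?zs"
    by (rule P.negon_append) (use xs ys in \<open>auto simp: negon_def pip_def\<close>)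
  from P.negdef_length_le[OF negon_imp_negdef[OF this] cspan_superset] xs ys
  have "k1 + k2 \<le> neg_eigs (gram (pip ip1 ip2) ?zs)" by simp
  with le[of ?zs] have "neg_eigs (gram (pip ip1 ip2) ?zs) = k1 + k2" by simp
  with le show ?thesis unfolding neg_squares_def by blast
qed

end

section \<open>The direct sum of two triplets\<close>

locale rep_pair = R1: rep_function sc1 ip1 UNIV A1 sch iph G1 z0 C1 Q1 + R2: rep_function sc2 ip2 UNIV A2 sch iph G2 z0 C2 Q2
  for sc1 :: "complex \<Rightarrow> 'a::ab_group_add \<Rightarrow> 'a" and ip1 A1
    and sc2 :: "complex \<Rightarrow> 'b::ab_group_add \<Rightarrow> 'b" and ip2 A2
    and sch :: "complex \<Rightarrow> 'h::ab_group_add \<Rightarrow> 'h" and iph G1 G2 z0 C1 C2 Q1 Q2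
begin

sublocale krein_pair sc1 ip1 sc2 ip2 ..

lemma zero_in_A: "(0, 0) \<in> A1" "(0, 0) \<in> A2"
  by (auto intro: R1.A_memI R2.A_memI)

sublocale P: sa_relation "psc sc1 sc2" "pip ip1 ip2" UNIV "prel A1 A2"
proof
  show "closed_nondeg_subspace (psc sc1 sc2) (pip ip1 ip2) UNIV"
    unfolding closed_nondeg_subspace_def
  proof (intro conjI ballI impI)
    show "kclosure (psc sc1 sc2) (pip ip1 ip2) UNIV = UNIV"
      using P.H.clos_superset[of UNIV] by (auto simp: P.kclosure_eq)
  qed (auto simp: csubspace_def intro: P.nondegenerate)
  show "\<exists>v\<in>UNIV. \<forall>u\<in>UNIV. pip ip1 ip2 (k - v) u = 0" for k by (rule bexI[of _ k]) auto
  have adj: "((f1, f2), (g1, g2)) \<in> prel A1 A2"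
    if s: "\<forall>(u, v)\<in>prel A1 A2. pip ip1 ip2 v (f1, f2) = pip ip1 ip2 u (g1, g2)" for f1 f2 g1 g2
  proof -
    have "(f1, g1) \<in> A1"
    proof (rule R1.A_memI)
      fix u v assume "(u, v) \<in> A1"
      \<comment> \<open>Padding with (0, 0), which belongs to both relations, tests one component at
        a time.\<close>
      hence "((u, 0), (v, 0)) \<in> prel A1 A2" using zero_in_A by (simp add: prel_def)
      from s[rule_format, OF this] show "ip1 v f1 = ip1 u g1" by (simp add: pip_def)
    qed auto
    moreover have "(f2, g2) \<in> A2"
    proof (rule R2.A_memI)
      fix u v assume "(u, v) \<in> A2"
      hence "((0, u), (0, v)) \<in> prel A1 A2" using zero_in_A by (simp add: prel_def)
      from s[rule_format, OF this] show "ip2 v f2 = ip2 u g2" by (simp add: pip_def)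
    qed auto
    ultimately show ?thesis by (simp add: prel_def)
  qed
  show "selfadj_rel (pip ip1 ip2) UNIV (prel A1 A2)"
    unfolding selfadj_rel_def
  proof (intro conjI equalityI subsetI)
    fix x assume x: "x \<in> prel A1 A2"
    obtain f1 f2 g1 g2 where xe: "x = ((f1, f2), (g1, g2))" by (metis prod.collapse)
    have "pip ip1 ip2 v (f1, f2) = pip ip1 ip2 u (g1, g2)" if "(u, v) \<in> prel A1 A2" for u v
      using that x R1.A_sym[of "fst u" "fst v" f1 g1] R2.A_sym[of "snd u" "snd v" f2 g2]
      by (cases u; cases v) (simp add: xe prel_def pip_def)
    thus "x \<in> {(f, g). f \<in> UNIV \<and> g \<in> UNIV \<and> (\<forall>(u, v)\<in>prel A1 A2. pip ip1 ip2 v f = pip ip1 ip2 u g)}"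
      by (auto simp: xe)
  next
    fix x assume x: "x \<in> {(f, g). f \<in> UNIV \<and> g \<in> UNIV \<and> (\<forall>(u, v)\<in>prel A1 A2. pip ip1 ip2 v f = pip ip1 ip2 u g)}"
    obtain f1 f2 g1 g2 where xe: "x = ((f1, f2), (g1, g2))" by (metis prod.collapse)
    show "x \<in> prel A1 A2"
      unfolding xe by (rule adj) (use x in \<open>simp add: xe\<close>)
  qed simp
qed

lemma pair_resolvent:
  assumes z: "z \<in> R1.\<rho>" "z \<in> R2.\<rho>"
  shows "z \<in> P.\<rho>" "P.R z y = (R1.R z (fst y), R2.R z (snd y))"
proof -
  obtain c where c: "c > 0" "\<And>x. P.kn x \<le> c * (R1.kn (fst x) + R2.kn (snd x))"
    "\<And>x. R1.kn (fst x) \<le> c * P.kn x" "\<And>x. R2.kn (snd x) \<le> c * P.kn x" using knorm_pair_bounds by blast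
  obtain B1 where B1: "B1 > 0" "\<And>y. R1.kn (R1.R z y) \<le> B1 * R1.kn y" using R1.R_bounded[OF z(1)] by auto
  obtain B2 where B2: "B2 > 0" "\<And>y. R2.kn (R2.R z y) \<le> B2 * R2.kn y" using R2.R_bounded[OF z(2)] by auto
  let ?f = "\<lambda>y. (R1.R z (fst y), R2.R z (snd y))"
  have 1: "?f y \<in> UNIV \<and> (?f y, y + psc sc1 sc2 z (?f y)) \<in> prel A1 A2" for y
    using R1.R_props(2)[OF z(1), of "fst y"] R2.R_props(2)[OF z(2), of "snd y"]
    by (cases y) (simp add: prel_def psc_def)
  have 2: "d = 0" if d: "(d, psc sc1 sc2 z d) \<in> prel A1 A2" for d
  proof -
    have d1: "(fst d, sc1 z (fst d)) \<in> A1" and d2: "(snd d, sc2 z (snd d)) \<in> A2"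
      using d by (cases d; simp add: prel_def psc_def)+
    have "R1.R z 0 = fst d" by (rule R1.R_eqI[OF z(1)]) (use d1 in auto)
    moreover have "R2.R z 0 = snd d" by (rule R2.R_eqI[OF z(2)]) (use d2 in auto)
    ultimately show ?thesis using R1.R_diff[OF z(1), of 0 0] R2.R_diff[OF z(2), of 0 0] by (simp add: prod_eq_iff)
  qed
  have 3: "P.kn (?f y) \<le> c * (B1 * c + B2 * c) * P.kn y" for y
  proof -
    have "P.kn (?f y) \<le> c * (R1.kn (R1.R z (fst y)) + R2.kn (R2.R z (snd y)))" using c(2)[of "?f y"] by simp
    also have "\<dots> \<le> c * (B1 * (c * P.kn y) + B2 * (c * P.kn y))"
      using c(1) B1(1) B2(1)
      by (intro mult_left_mono add_mono order_trans[OF B1(2)] order_trans[OF B2(2)] c) auto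
    finally show ?thesis by (simp add: algebra_simps)
  qed
  show "z \<in> P.\<rho>" by (rule P.rhoI(1)[OF 1 2 3])
  show "P.R z y = (R1.R z (fst y), R2.R z (snd y))" using P.rhoI(2)[OF 1 2 3] by blast
qed

text \<open>The domain of Q in part (ii) is exactly \<open>P.\<rho>\<close>, and both summands must
  be represented there. For that inclusion each component resolvent is cut out of \<open>P.R\<close>
  by padding the argument with 0.\<close>

lemma rho_pair: "P.\<rho> = R1.\<rho> \<inter> R2.\<rho>"
proof (intro equalityI subsetI IntI)
  fix z assume z: "z \<in> P.\<rho>"
  obtain c where c: "c > 0" "\<And>x. P.kn x \<le> c * (R1.kn (fst x) + R2.kn (snd x))"
    "\<And>x. R1.kn (fst x) \<le> c * P.kn x" "\<And>x. R2.kn (snd x) \<le> c * P.kn x" using knorm_pair_bounds by blast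
  obtain B where B: "B > 0" "\<And>y. P.kn (P.R z y) \<le> B * P.kn y" using P.R_bounded[OF z] by auto
  have A: "(P.R z y, y + psc sc1 sc2 z (P.R z y)) \<in> prel A1 A2" for y by (rule P.R_props(2)[OF z]) simp
  have P0: "P.R z 0 = 0" using P.R_diff[OF z, of 0 0] by simp
  show "z \<in> R1.\<rho>"
  proof (rule R1.rhoI(1)[where f = "\<lambda>y. fst (P.R z (y, 0))"])
    show "fst (P.R z (y, 0)) \<in> UNIV \<and> (fst (P.R z (y, 0)), y + sc1 z (fst (P.R z (y, 0)))) \<in> A1" for y
      using A[of "(y, 0)"] by (cases "P.R z (y, 0)") (simp add: prel_def psc_def)
    show "d = 0" if "(d, sc1 z d) \<in> A1" for d
    proof -
      have "P.R z 0 = (d, 0)"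
        by (rule P.R_eqI[OF z]) (use that zero_in_A in \<open>auto simp: prel_def psc_def\<close>)
      thus ?thesis using P0 by (simp add: zero_prod_def)
    qed
    show "R1.kn (fst (P.R z (y, 0))) \<le> c * (B * c) * R1.kn y" for y
    proof -
      have "R1.kn (fst (P.R z (y, 0))) \<le> c * (B * (c * (R1.kn y + R2.kn 0)))"
        using c(1) B(1) c(2)[of "(y, 0)"]
        by (intro order_trans[OF c(3)] mult_left_mono order_trans[OF B(2)]) auto
      thus ?thesis by (simp add: R2.kn_zero mult_ac)
    qed
  qed
  show "z \<in> R2.\<rho>"
  proof (rule R2.rhoI(1)[where f = "\<lambda>y. snd (P.R z (0, y))"])
    show "snd (P.R z (0, y)) \<in> UNIV \<and> (snd (P.R z (0, y)), y + sc2 z (snd (P.R z (0, y)))) \<in> A2" for y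
      using A[of "(0, y)"] by (cases "P.R z (0, y)") (simp add: prel_def psc_def)
    show "d = 0" if "(d, sc2 z d) \<in> A2" for d
    proof -
      have "P.R z 0 = (0, d)"
        by (rule P.R_eqI[OF z]) (use that zero_in_A in \<open>auto simp: prel_def psc_def\<close>)
      thus ?thesis using P0 by (simp add: zero_prod_def)
    qed
    show "R2.kn (snd (P.R z (0, y))) \<le> c * (B * c) * R2.kn y" for y
    proof -
      have "R2.kn (snd (P.R z (0, y))) \<le> c * (B * (c * (R1.kn 0 + R2.kn y)))"
        using c(1) B(1) c(2)[of "(0, y)"]
        by (intro order_trans[OF c(4)] mult_left_mono order_trans[OF B(2)]) auto
      thus ?thesis by (simp add: R1.kn_zero mult_ac)
    qed
  qed
qed (use pair_resolvent(1) in auto)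

sublocale P: rep_triplet "psc sc1 sc2" "pip ip1 ip2" UNIV "prel A1 A2" sch iph "\<lambda>h. (G1 h, G2 h)" z0
proof
  obtain c where c: "c > 0" "\<And>x. P.kn x \<le> c * (R1.kn (fst x) + R2.kn (snd x))" using knorm_pair_bounds by blast
  obtain B1 where B1: "\<And>h. R1.kn (G1 h) \<le> B1 * R1.Hs.nrm h" using R1.G_bound by auto
  obtain B2 where B2: "\<And>h. R2.kn (G2 h) \<le> B2 * R1.Hs.nrm h" using R2.G_bound by auto
  have "P.kn (G1 h, G2 h) \<le> c * (B1 + B2) * R1.Hs.nrm h" for h
  proof -
    have "P.kn (G1 h, G2 h) \<le> c * (R1.kn (G1 h) + R2.kn (G2 h))" using c(2)[of "(G1 h, G2 h)"] by simp
    also have "\<dots> \<le> c * (B1 * R1.Hs.nrm h + B2 * R1.Hs.nrm h)"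
      using c(1) by (intro mult_left_mono add_mono B1 B2) auto
    finally show ?thesis by (simp add: algebra_simps)
  qed
  thus "bop_HK sch iph (psc sc1 sc2) (pip ip1 ip2) (\<lambda>h. (G1 h, G2 h))"
    unfolding bop_HK_def clinear_def by (auto simp: psc_def R1.G_add R1.G_scale R2.G_add R2.G_scale)
  show "z0 \<in> P.\<rho>" unfolding rho_pair using R1.z0_rho R2.z0_rho by blast
qed simp

lemma Gs_pair: "P.Gs (x, y) = R1.Gs x + R2.Gs y"
  by (rule R1.Hs.ip_cong_right) (simp add: P.Gs_right R1.Gs_right R2.Gs_right R1.Hs.ip_simps pip_def)

lemma \<gamma>_pair: "z \<in> P.\<rho> \<Longrightarrow> P.\<gamma> z h = (R1.\<gamma> z h, R2.\<gamma> z h)"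
  using pair_resolvent(2)[of z "(G1 h, G2 h)"]
  by (simp add: rho_pair P.\<gamma>_def R1.\<gamma>_def R2.\<gamma>_def psc_def)

abbreviation Q :: "complex \<Rightarrow> 'h \<Rightarrow> 'h" where "Q \<equiv> \<lambda>z h. Q1 z h + Q2 z h"

sublocale PQ: rep_function "psc sc1 sc2" "pip ip1 ip2" UNIV "prel A1 A2" sch iph "\<lambda>h. (G1 h, G2 h)" z0
  "\<lambda>h. C1 h + C2 h" "\<lambda>z h. Q1 z h + Q2 z h"
proof
  show "bop sch iph (\<lambda>h. C1 h + C2 h)" by (rule R1.Hs.bop_add[OF R1.C_bop R2.C_bop])
  fix g h
  have "cnj (iph (C1 g + C2 g) h) - iph (C1 h + C2 h) g
    = (cnj (iph (C1 g) h) - iph (C1 h) g) + (cnj (iph (C2 g) h) - iph (C2 h) g)"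
    by (simp add: R1.Hs.ip_simps)
  thus "cnj (iph (C1 g + C2 g) h) - iph (C1 h + C2 h) g = (z0 - cnj z0) * pip ip1 ip2 (G1 h, G2 h) (G1 g, G2 g)"
    unfolding R1.C_adj R2.C_adj by (simp add: pip_def algebra_simps)
next
  fix z h assume z: "z \<in> P.\<rho>"
  hence z12: "z \<in> R1.\<rho>" "z \<in> R2.\<rho>" by (auto simp: rho_pair)
  have "rep_fun sch iph (psc sc1 sc2) (pip ip1 ip2) UNIV (prel A1 A2) (\<lambda>h. (G1 h, G2 h)) z0 (\<lambda>h. C1 h + C2 h) z h
    = C1 h + C2 h + sch (z - cnj z0) (P.Gs (P.\<gamma> z h))" by (simp add: rep_fun_def P.\<gamma>_def)
  also have "\<dots> = Q1 z h + Q2 z h"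
    unfolding \<gamma>_pair[OF z] Gs_pair R1.Q_eq[OF z12(1)] R2.Q_eq[OF z12(2)]
    by (simp add: R1.Hs.vs.scale_right_distrib algebra_simps)
  finally show "Q1 z h + Q2 z h = rep_fun sch iph (psc sc1 sc2) (pip ip1 ip2) UNIV (prel A1 A2)
    (\<lambda>h. (G1 h, G2 h)) z0 (\<lambda>h. C1 h + C2 h) z h" ..
qed

text \<open>The kernel of \<open>P.Gs\<close> is the orthogonal complement of the range, so
  injectivity makes that complement trivial.\<close>

lemma range_dense:
  assumes inj: "inj P.Gs"
  shows "kclosure (psc sc1 sc2) (pip ip1 ip2) (range (\<lambda>h. (G1 h, G2 h))) = UNIV"
proof (rule P.dense_if_trivial_complement)
  have "0 = (\<lambda>h. (G1 h, G2 h)) 0"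
    using P.G_scale[of 0 0] by simp
  thus "csubspace (psc sc1 sc2) (range (\<lambda>h. (G1 h, G2 h)))"
    unfolding csubspace_def using P.G_add[symmetric] P.G_scale[symmetric] by blast
  fix x assume x: "\<And>s. s \<in> range (\<lambda>h. (G1 h, G2 h)) \<Longrightarrow> pip ip1 ip2 x s = 0"
  have "P.Gs x = 0" by (rule R1.Hs.ip_cong_left) (simp add: P.Gs_left x)
  moreover have "P.Gs 0 = 0" by (rule R1.Hs.ip_cong_left) (simp add: P.Gs_left)
  ultimately show "x = 0" by (intro injD[OF inj]) (simp only:)
qed

lemma range_in_\<Gamma>_set: "z0 \<in> S \<Longrightarrow> range (\<lambda>h. (G1 h, G2 h)) \<subseteq> P.\<Gamma>_set S"
  unfolding P.\<Gamma>_set_def using P.\<gamma>_z0[symmetric] by blast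

lemma pair_minimal:
  assumes inj: "inj P.Gs"
  shows "minimal_triplet (psc sc1 sc2) (pip ip1 ip2) UNIV (prel A1 A2) (\<lambda>h. (G1 h, G2 h)) z0"
proof -
  have "range (\<lambda>h. (G1 h, G2 h)) \<subseteq> cspan (psc sc1 sc2) (P.\<Gamma>_set P.\<rho>)"
    using range_in_\<Gamma>_set[OF P.z0_rho] cspan_superset by blast
  from P.H.clos_mono[OF this] range_dense[OF inj] show ?thesis
    unfolding PQ.minimal_triplet_iff P.kclosure_eq by blast
qed

text \<open>The estimate is made for the resolvents, where a point that is regular for one summand
  simply has order 0; n1 + n2 serves as a common order.\<close>

lemma pair_meromorphic:
  assumes mer: "meromorphic_nonreal sch iph R1.\<rho> Q1" "meromorphic_nonreal sch iph R2.\<rho> Q2"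
    and min: "minimal_triplet sc1 ip1 UNIV A1 G1 z0" "minimal_triplet sc2 ip2 UNIV A2 G2 z0"
  shows "meromorphic_nonreal sch iph P.\<rho> Q"
proof -
  obtain c where c: "c > 0" "\<And>x. P.kn x \<le> c * (R1.kn (fst x) + R2.kn (snd x))"
    "\<And>x. R1.kn (fst x) \<le> c * P.kn x" "\<And>x. R2.kn (snd x) \<le> c * P.kn x" using knorm_pair_bounds by blast
  have poles: "(\<exists>r>0. {w. 0 < cmod (w - z) \<and> cmod (w - z) < r} \<subseteq> P.\<rho>) \<and> pole_at sch iph Q z"
    if z: "z \<notin> \<real>" for z
  proof -
    obtain n1 r1 M1 where r1: "r1 > 0" "M1 \<ge> 0" and 1: "\<And>w. 0 < cmod (w - z) \<and> cmod (w - z) < r1 \<Longrightarrow>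
      w \<in> R1.\<rho> \<and> (\<forall>y\<in>UNIV. cmod (w - z) ^ n1 * R1.kn (R1.R w y) \<le> M1 * R1.kn y)" using R1.resolvent_bound_near_nonreal[OF mer(1) min(1) z] by blast
    obtain n2 r2 M2 where r2: "r2 > 0" "M2 \<ge> 0" and 2: "\<And>w. 0 < cmod (w - z) \<and> cmod (w - z) < r2 \<Longrightarrow>
      w \<in> R2.\<rho> \<and> (\<forall>y\<in>UNIV. cmod (w - z) ^ n2 * R2.kn (R2.R w y) \<le> M2 * R2.kn y)" using R2.resolvent_bound_near_nonreal[OF mer(2) min(2) z] by blast
    \<comment> \<open>The entry 1 keeps powers of \<open>cmod (w - z)\<close> at most 1, so that
      raising either exponent to n1 + n2 preserves the bounds.\<close>
    define r where "r = Min {r1, r2, 1}"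
    have r: "r > 0" "r \<le> r1" "r \<le> r2" "r \<le> 1" using r1 r2 by (auto simp: r_def)
    have main: "w \<in> P.\<rho> \<and> (\<forall>y\<in>UNIV. cmod (w - z) ^ (n1 + n2) * P.kn (P.R w y) \<le> c * (M1 * c + M2 * c) * P.kn y)"
      if w: "0 < cmod (w - z)" "cmod (w - z) < r" for w
    proof -
      have w1: "w \<in> R1.\<rho>" and w2: "w \<in> R2.\<rho>" using 1[of w] 2[of w] w r by auto
      let ?p = "cmod (w - z)"
      have p: "?p ^ m \<le> 1" "?p ^ m \<ge> 0" for m using w r by (auto intro: power_le_one)
      have k1: "?p ^ (n1 + n2) * R1.kn (R1.R w y) \<le> M1 * R1.kn y" for y
      proof -
        have "?p ^ n2 * (?p ^ n1 * R1.kn (R1.R w y)) \<le> 1 * (?p ^ n1 * R1.kn (R1.R w y))"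
          by (intro mult_right_mono mult_nonneg_nonneg p R1.kn_nonneg)
        also have "\<dots> \<le> M1 * R1.kn y" using 1[of w] w r by auto
        finally show ?thesis by (simp add: power_add mult_ac)
      qed
      have k2: "?p ^ (n1 + n2) * R2.kn (R2.R w y) \<le> M2 * R2.kn y" for y
      proof -
        have "?p ^ n1 * (?p ^ n2 * R2.kn (R2.R w y)) \<le> 1 * (?p ^ n2 * R2.kn (R2.R w y))"
          by (intro mult_right_mono mult_nonneg_nonneg p R2.kn_nonneg)
        also have "\<dots> \<le> M2 * R2.kn y" using 2[of w] w r by auto
        finally show ?thesis by (simp add: power_add mult_ac)
      qed
      have "?p ^ (n1 + n2) * P.kn (P.R w y) \<le> c * (M1 * c + M2 * c) * P.kn y" for y
      proof -
        have "?p ^ (n1 + n2) * P.kn (P.R w y) \<le>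
          ?p ^ (n1 + n2) * (c * (R1.kn (R1.R w (fst y)) + R2.kn (R2.R w (snd y))))"
          using c(2)[of "P.R w y"] unfolding pair_resolvent(2)[OF w1 w2] by (intro mult_left_mono p) simp
        also have "\<dots> = c * (?p ^ (n1 + n2) * R1.kn (R1.R w (fst y)) + ?p ^ (n1 + n2) * R2.kn (R2.R w (snd y)))"
          by (simp add: algebra_simps)
        also have "\<dots> \<le> c * (M1 * (c * P.kn y) + M2 * (c * P.kn y))"
          using c(1) r1 r2
          by (intro mult_left_mono add_mono order_trans[OF k1] order_trans[OF k2] c) auto
        finally show ?thesis by (simp add: algebra_simps)
      qed
      thus ?thesis using pair_resolvent(1)[OF w1 w2] by blast
    qed
    have "pole_at sch iph Q z"
      by (rule PQ.pole_at_from_resolvent_bound[OF r(1) _ main]) (use c(1) r1 r2 in auto)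
    thus ?thesis using r(1) main by blast
  qed
  show ?thesis
    unfolding meromorphic_nonreal_def
    using P.open_rho PQ.bop_Q PQ.holo_Q poles by blast
qed

lemma pair_neg_squares:
  assumes inj: "inj P.Gs" and z0: "Im z0 > 0"
    and m: "neg_squares ip1 UNIV m1" "neg_squares ip2 UNIV m2"
    and k: "neg_squares ip1 (R1.\<Gamma>_set (R1.\<rho> \<inter> {z. Im z > 0})) k1"
      "neg_squares ip2 (R2.\<Gamma>_set (R2.\<rho> \<inter> {z. Im z > 0})) k2"
  shows "neg_squares (pip ip1 ip2) (P.\<Gamma>_set (P.\<rho> \<inter> {z. Im z > 0})) (k1 + k2)"
proof -
  let ?S = "P.\<rho> \<inter> {z. Im z > 0}"
  have le: "neg_eigs (gram (pip ip1 ip2) xs) \<le> k1 + k2" if xs: "set xs \<subseteq> P.\<Gamma>_set ?S" for xs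
  proof -
    have el: "fst x \<in> R1.\<Gamma>_set (R1.\<rho> \<inter> {z. Im z > 0}) \<and> snd x \<in> R2.\<Gamma>_set (R2.\<rho> \<inter> {z. Im z > 0})"
      if x: "x \<in> P.\<Gamma>_set ?S" for x
    proof -
      obtain z h where "z \<in> ?S" "x = P.\<gamma> z h" using x by (auto simp: P.\<Gamma>_set_def)
      thus ?thesis using \<gamma>_pair[of z h] unfolding R1.\<Gamma>_set_def R2.\<Gamma>_set_def rho_pair by auto
    qed
    hence "set (map fst xs) \<subseteq> R1.\<Gamma>_set (R1.\<rho> \<inter> {z. Im z > 0})" "set (map snd xs) \<subseteq> R2.\<Gamma>_set (R2.\<rho> \<inter> {z. Im z > 0})"
      using xs by auto
    hence "neg_eigs (gram ip1 (map fst xs)) \<le> k1" "neg_eigs (gram ip2 (map snd xs)) \<le> k2"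
      using k unfolding neg_squares_def by blast+
    thus ?thesis using gram_pair_le[of xs] by linarith
  qed
  obtain ys where ys: "negon (pip ip1 ip2) ys" "length ys = m1 + m2"
    using neg_squares_pair[OF m] unfolding P.neg_squares_iff by blast
  obtain zs where zs: "negdef (pip ip1 ip2) zs" "set zs \<subseteq> range (\<lambda>h. (G1 h, G2 h))" "length zs = m1 + m2"
    using P.negdef_in_dense[OF ys(1), of "range (\<lambda>h. (G1 h, G2 h))"] ys(2) range_dense[OF inj] by auto
  \<comment> \<open>gamma at z0 is Gamma itself and z0 lies in the upper half plane, so the
    approximating vectors are among those that represent the kernel of Q.\<close>
  have zsS: "set zs \<subseteq> P.\<Gamma>_set ?S"
    using zs(2) range_in_\<Gamma>_set[of ?S] P.z0_rho z0 by blast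
  \<comment> \<open>The vectors of each kernel lie in the respective space, which bounds k_i by m_i.
    Together with the lower bound m1 + m2 this even forces k_i = m_i.\<close>
  have "k1 \<le> m1" "k2 \<le> m2" using k m unfolding neg_squares_def by (metis subset_UNIV)+
  moreover have "m1 + m2 \<le> neg_eigs (gram (pip ip1 ip2) zs)"
    using P.negdef_length_le[OF zs(1) cspan_superset] zs(3) by simp
  ultimately have "neg_eigs (gram (pip ip1 ip2) zs) = k1 + k2" using le[OF zsS] by linarith
  with le zsS show ?thesis unfolding neg_squares_def by blast
qed

end

section \<open>The converse of part (ii)\<close>

theorem direct_sum_representation:
  fixes sch :: "complex \<Rightarrow> 'h::ab_group_add \<Rightarrow> 'h"
    and sc1 :: "complex \<Rightarrow> 'k1::ab_group_add \<Rightarrow> 'k1" and sc2 :: "complex \<Rightarrow> 'k2::ab_group_add \<Rightarrow> 'k2"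
  assumes H: "hilbert sch iph"
    and nk1: "Nkappa sch iph \<kappa>1 (rho sc1 ip1 UNIV A1) Q1" and min1: "minimal_rep sch iph sc1 ip1 UNIV A1 G1 z0 Q1"
    and nk2: "Nkappa sch iph \<kappa>2 (rho sc2 ip2 UNIV A2) Q2" and min2: "minimal_rep sch iph sc2 ip2 UNIV A2 G2 z0 Q2"
    and inj: "inj (gadj iph (pip ip1 ip2) (\<lambda>h. (G1 h, G2 h)))"
  defines "Q \<equiv> \<lambda>z h. Q1 z h + Q2 z h" and "sc \<equiv> psc sc1 sc2" and "ip \<equiv> pip ip1 ip2"
    and "A \<equiv> prel A1 A2" and "G \<equiv> \<lambda>h. (G1 h, G2 h)"
  shows "represents sch iph sc ip UNIV A G z0 Q"
    "\<forall>z\<in>rho sc ip UNIV A. \<forall>h. Q z h =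
       rep_fun sch iph sc ip UNIV A G z0 (\<lambda>h. hadj iph (Q1 z0) h + hadj iph (Q2 z0) h) z h"
    "minimal_triplet sc ip UNIV A G z0" "Nkappa sch iph (\<kappa>1 + \<kappa>2) (rho sc ip UNIV A) Q"
proof -
  have rep1: "represents sch iph sc1 ip1 UNIV A1 G1 z0 Q1" and mt1: "minimal_triplet sc1 ip1 UNIV A1 G1 z0"
    using min1 by (auto simp: minimal_rep_def)
  have rep2: "represents sch iph sc2 ip2 UNIV A2 G2 z0 Q2" and mt2: "minimal_triplet sc2 ip2 UNIV A2 G2 z0"
    using min2 by (auto simp: minimal_rep_def)
  obtain m1 m2 where m: "neg_squares ip1 UNIV m1" "neg_squares ip2 UNIV m2"
    using rep1 rep2 by (auto simp: represents_def pontryagin_def)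
  have z0: "Im z0 > 0" using rep1 by (auto simp: represents_def)
  interpret R1: rep_function sc1 ip1 UNIV A1 sch iph G1 z0 "hadj iph (Q1 z0)" Q1
    by (rule rep_functionI[OF H nk1 rep1])
  interpret R2: rep_function sc2 ip2 UNIV A2 sch iph G2 z0 "hadj iph (Q2 z0)" Q2
    by (rule rep_functionI[OF H nk2 rep2])
  interpret X: rep_pair sc1 ip1 A1 sc2 ip2 A2 sch iph G1 G2 z0 "hadj iph (Q1 z0)" "hadj iph (Q2 z0)" Q1 Q2 ..
  \<comment> \<open>\<open>represents\<close> asks for some negative index of the pair space; m1 +
    m2 is at hand before it is compared with \<kappa>1 + \<kappa>2.\<close>
  have po: "pontryagin (psc sc1 sc2) (pip ip1 ip2) (m1 + m2)"
    unfolding pontryagin_def using X.P.krein X.neg_squares_pair[OF m] by blast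
  show "represents sch iph sc ip UNIV A G z0 Q"
    unfolding sc_def ip_def A_def G_def Q_def by (rule X.PQ.represents_Q[OF po z0])
  show "\<forall>z\<in>rho sc ip UNIV A. \<forall>h. Q z h =
       rep_fun sch iph sc ip UNIV A G z0 (\<lambda>h. hadj iph (Q1 z0) h + hadj iph (Q2 z0) h) z h"
    unfolding sc_def ip_def A_def G_def Q_def using X.PQ.Q_rep by blast
  show "minimal_triplet sc ip UNIV A G z0"
    unfolding sc_def ip_def A_def G_def by (rule X.pair_minimal[OF inj])
  have mer: "meromorphic_nonreal sch iph R1.\<rho> Q1" "meromorphic_nonreal sch iph R2.\<rho> Q2"
    using nk1 nk2 by (auto simp: Nkappa_def)
  have k: "neg_squares ip1 (R1.\<Gamma>_set (R1.\<rho> \<inter> {z. Im z > 0})) \<kappa>1"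
    "neg_squares ip2 (R2.\<Gamma>_set (R2.\<rho> \<inter> {z. Im z > 0})) \<kappa>2"
    using nk1 nk2 R1.neg_squares_kernel R2.neg_squares_kernel unfolding Nkappa_def by blast+
  show "Nkappa sch iph (\<kappa>1 + \<kappa>2) (rho sc ip UNIV A) Q"
    unfolding sc_def ip_def A_def Q_def Nkappa_def
  proof (intro conjI ballI)
    show "meromorphic_nonreal sch iph X.P.\<rho> X.Q" by (rule X.pair_meromorphic[OF mer mt1 mt2])
    show "neg_squares (\<lambda>(z, h) (w, g). iph (NQ iph sch X.Q z w h) g) ((X.P.\<rho> \<inter> {z. Im z > 0}) \<times> UNIV) (\<kappa>1 + \<kappa>2)"
      unfolding X.PQ.neg_squares_kernel by (rule X.pair_neg_squares[OF inj z0 m k])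
    fix z assume z: "z \<in> X.P.\<rho>"
    show z': "cnj z \<in> X.P.\<rho>" by (rule X.P.cnj_in_rho[OF z])
    show "hadj iph (X.Q (cnj z)) = X.Q z" using X.PQ.hadj_Q[OF z'] by simp
  qed
qed

theorem theorem1:
  fixes sch :: "complex \<Rightarrow> 'h::ab_group_add \<Rightarrow> 'h" and iph :: "'h \<Rightarrow> 'h \<Rightarrow> complex"
  assumes H: "hilbert sch iph"
  shows
  \<comment> \<open>(i) decomposition\<close>
  "(\<forall>(sck :: complex \<Rightarrow> 'k::ab_group_add \<Rightarrow> 'k) ipk \<kappa> A G z0 Q K1 K2 \<kappa>1 \<kappa>2 S1 S2.
      pontryagin sck ipk \<kappa> \<and> Nkappa sch iph \<kappa> (rho sck ipk UNIV A) Q \<and>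
      minimal_rep sch iph sck ipk UNIV A G z0 Q \<and>
      closed_nondeg_subspace sck ipk K1 \<and> closed_nondeg_subspace sck ipk K2 \<and>
      (\<forall>x\<in>K1. \<forall>y\<in>K2. ipk x y = 0) \<and> (\<forall>k. \<exists>a\<in>K1. \<exists>b\<in>K2. k = a + b) \<and>
      (\<forall>z\<in>rho sck ipk UNIV A. \<forall>y\<in>K1. resolv sck UNIV A z y \<in> K1) \<and>
      (\<forall>z\<in>rho sck ipk UNIV A. \<forall>y\<in>K2. resolv sck UNIV A z y \<in> K2) \<and>
      neg_squares ipk K1 \<kappa>1 \<and> neg_squares ipk K2 \<kappa>2 \<and>
      bsa sch iph S1 \<and> bsa sch iph S2 \<and>
      (\<forall>h. S1 h + S2 h = sch (1/2) (Q z0 h + hadj iph (Q z0) h))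
    \<longrightarrow>
      (let A1 = A \<inter> (K1 \<times> K1); A2 = A \<inter> (K2 \<times> K2);
           G1 = (\<lambda>h. oproj ipk K1 (G h)); G2 = (\<lambda>h. oproj ipk K2 (G h));
           Q1 = rep_fun sch iph sck ipk K1 A1 G1 z0
                  (\<lambda>h. S1 h - sch ((z0 - cnj z0) / 2) (gadj iph ipk G1 (G1 h)));
           Q2 = rep_fun sch iph sck ipk K2 A2 G2 z0
                  (\<lambda>h. S2 h - sch ((z0 - cnj z0) / 2) (gadj iph ipk G2 (G2 h)))
       in Nkappa sch iph \<kappa>1 (rho sck ipk K1 A1) Q1 \<and> minimal_rep sch iph sck ipk K1 A1 G1 z0 Q1 \<and>
          Nkappa sch iph \<kappa>2 (rho sck ipk K2 A2) Q2 \<and> minimal_rep sch iph sck ipk K2 A2 G2 z0 Q2 \<and>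
          (\<forall>z\<in>rho sck ipk UNIV A. \<forall>h. Q z h = Q1 z h + Q2 z h) \<and>
          \<kappa>1 + \<kappa>2 = \<kappa>)) \<and>
  \<comment> \<open>(ii) converse\<close>
  (\<forall>(sc1 :: complex \<Rightarrow> 'k1::ab_group_add \<Rightarrow> 'k1) ip1 A1 G1 Q1 \<kappa>1
     (sc2 :: complex \<Rightarrow> 'k2::ab_group_add \<Rightarrow> 'k2) ip2 A2 G2 Q2 \<kappa>2 z0.
      Nkappa sch iph \<kappa>1 (rho sc1 ip1 UNIV A1) Q1 \<and> minimal_rep sch iph sc1 ip1 UNIV A1 G1 z0 Q1 \<and>
      Nkappa sch iph \<kappa>2 (rho sc2 ip2 UNIV A2) Q2 \<and> minimal_rep sch iph sc2 ip2 UNIV A2 G2 z0 Q2 \<and>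
      inj (gadj iph (pip ip1 ip2) (\<lambda>h. (G1 h, G2 h)))
    \<longrightarrow>
      (let Q = (\<lambda>z h. Q1 z h + Q2 z h); sc = psc sc1 sc2; ip = pip ip1 ip2;
           A = prel A1 A2; G = (\<lambda>h. (G1 h, G2 h))
       in represents sch iph sc ip UNIV A G z0 Q \<and>
          (\<forall>z\<in>rho sc ip UNIV A. \<forall>h. Q z h =
             rep_fun sch iph sc ip UNIV A G z0 (\<lambda>h. hadj iph (Q1 z0) h + hadj iph (Q2 z0) h) z h) \<and>
          minimal_triplet sc ip UNIV A G z0 \<and>
          Nkappa sch iph (\<kappa>1 + \<kappa>2) (rho sc ip UNIV A) Q))"
proof ((rule conjI; intro allI impI; elim conjE), goal_cases)
  case 1
  show ?case unfolding Let_def by (intro conjI reducing_decomposition[OF H 1])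
next
  case 2
  show ?case unfolding Let_def by (intro conjI direct_sum_representation[OF H 2])
qed

end
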